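(* No Inoue surface (of type $\mathcal{S}^0$, $\mathcal{S}^+$ or $\mathcal{S}^-$) admits an LCK metric with potential.
   Context: LCK metrics: a Hermitian metric $g$ on a complex manifold $X=(M,J)$, with fundamental two-form $\omega(X,Y)=g(JX,Y)$, is locally conformally Kähler (LCK) if there is a closed one-form $\theta$ (its Lee form) with $d\omega=\theta\wedge\omega$. An LCK metric with potential is an LCK metric for which there is a covering $\tilde X$ of $X$ on which the pull-back $\tilde\omega$ of $\omega$ satisfies $\tilde\omega=\frac{dd^cf}{f}$, where $d^c=JdJ^{-1}$, for a plurisubharmonic function $f:\tilde X\to\mathbb{R}^+$ (positive reals) such that for every deck transformation $\gamma$ there is $c_\gamma\in\mathbb{R}$ with $\gamma^*f=e^{c_\gamma}f$. Inoue surfaces (all with the complex structure inherited from $\mathbb{C}\times\mathbb{H}$, $\mathbb{H}$ the upper half-plane): Type $\mathcal{S}^0$: let $A\in\mathrm{SL}_3(\mathbb{Z})$ have one real eigenvalue $\alpha>1$ and two complex (non-real) eigenvalues $\beta,\bar\beta$, with a real eigenvector $(a_1,a_2,a_3)^t$ for $\alpha$ and a complex eigenvector $(b_1,b_2,b_3)^t$ for $\beta$. $\mathcal{S}^0=(\mathbb{C}\times\mathbb{H})/G_A$, where $G_A$ is generated by $(z,w)\mapsto(\beta z,\alpha w)$ and $(z,w)\mapsto(z+b_i,w+a_i)$, $i=1,2,3$. Type $\mathcal{S}^+$: let $N=(n_{ij})\in\mathrm{SL}_2(\mathbb{Z})$ have real eigenvalues $\alpha>1$ and $1/\alpha$, with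 real eigenvectors $(a_1,a_2)^t$ and $(b_1,b_2)^t$ respectively; fix integers $p,q,r$, $r\ne0$, and $z\in\mathbb{C}$. Put $e_i=\tfrac12 n_{i1}(n_{i1}-1)a_1b_1+\tfrac12 n_{i2}(n_{i2}-1)a_2b_2+n_{i1}n_{i2}b_1a_2$ ($i=1,2$) and define $c_1,c_2$ by $(c_1,c_2)=(c_1,c_2)N^t+(e_1,e_2)+\frac{b_1a_2-b_2a_1}{r}(p,q)$. On $\mathbb{C}\times\mathbb{H}\cong\mathbb{R}^3\times\mathbb{R}^+$, with complex coordinates $(x+\mathrm{i}y,\,w+\mathrm{i}t)$, $t>0$, let $G^+_{N,p,q,r,z}$ be generated by $g_0(x,y,w,t)=(x+\operatorname{Re}z,y+\operatorname{Im}z,\alpha w,\alpha t)$, $g_i(x,y,w,t)=(x+b_iw+c_i,y+b_it,w+a_i,t)$ for $i=1,2$, and $g_3(x,y,w,t)=(x+\frac{b_1a_2-b_2a_1}{r},y,w,t)$. Then $\mathcal{S}^+_{N,p,q,r,z}$ is the quotient by $G^+_{N,p,q,r,z}$. Type $\mathcal{S}^-$: let $N=(n_{ij})\in\mathrm{GL}_2(\mathbb{Z})$, $\det N=-1$, with eigenvalues $\alpha>1$ and $-1/\alpha$ and corresponding real eigenvectors $(a_1,a_2)^t$ and $(b_1,b_2)^t$; fix integers $p,q,r$, $r\neq0$; let $e_1,e_2$ be given by the same formula as for type $\mathcal{S}^+$, and $c_1,c_2$ by $-(c_1,c_2)=(c_1,c_2)N^t+(e_1,e_2)+\frac{b_1a_2-b_2a_1}{r}(p,q)$.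 Then $\mathcal{S}^-_{N,p,q,r}$ is the quotient of $\mathbb{C}\times\mathbb{H}$ by the group generated by $g_0(x,y,w,t)=(-x,-y,\alpha w,\alpha t)$ and $g_1,g_2,g_3$ given by the same formulas as for type $\mathcal{S}^+$. *)

theory Defs
  imports "HOL-Analysis.Analysis" "HOL-Algebra.Bij" "HOL-Algebra.Generated_Groups"
begin

section \<open>Smooth and holomorphic maps between open subsets of complex vector spaces\<close>

text \<open>The complex vector space of dimension \<open>CARD('n)\<close> is the type \<open>complex^'n\<close>; multiplication
  by \<open>\<i>\<close> is its complex structure \<open>J\<close>. All definitions in this section are meant for open \<open>S\<close>.\<close>

primrec Ck_on :: "nat \<Rightarrow> 'a::real_normed_vector set \<Rightarrow> ('a \<Rightarrow> 'b::real_normed_vector) \<Rightarrow> bool" where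
  "Ck_on 0 S F \<longleftrightarrow> continuous_on S F"
| "Ck_on (Suc k) S F \<longleftrightarrow> (\<forall>x\<in>S. F differentiable (at x)) \<and>
     (\<forall>v. Ck_on k S (\<lambda>x. frechet_derivative F (at x) v))"

definition smooth_on :: "'a::real_normed_vector set \<Rightarrow> ('a \<Rightarrow> 'b::real_normed_vector) \<Rightarrow> bool" where
  "smooth_on S F \<longleftrightarrow> (\<forall>k. Ck_on k S F)"

text \<open>The Cauchy-Riemann equations: the real derivative commutes with \<open>J\<close>.\<close>

definition holomorphic_map_on ::
    "(complex^'n) set \<Rightarrow> (complex^'n \<Rightarrow> complex^'m) \<Rightarrow> bool" where
  "holomorphic_map_on S F \<longleftrightarrow> smooth_on S F \<and>
     (\<forall>x\<in>S. \<forall>v. frechet_derivative F (at x) (\<i> *s v) = \<i> *s frechet_derivative F (at x) v)"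

text \<open>Sub-mean value property on every closed complex disc contained in \<open>S\<close>. It is only used for
  continuous \<open>F\<close>, so upper semicontinuity is not required separately.\<close>

definition plurisubharmonic_on :: "(complex^'n) set \<Rightarrow> (complex^'n \<Rightarrow> real) \<Rightarrow> bool" where
  "plurisubharmonic_on S F \<longleftrightarrow> continuous_on S F \<and>
     (\<forall>x v. (\<forall>\<zeta>. norm \<zeta> \<le> 1 \<longrightarrow> x + \<zeta> *s v \<in> S) \<longrightarrow>
        F x \<le> 1 / (2 * pi) * integral {0..2 * pi} (\<lambda>t. F (x + cis t *s v)))"


section \<open>Differential forms in coordinates\<close>

text \<open>A form on an open subset of \<open>complex^'n\<close> is a function of the point and of the tangent vectors.
  The exterior derivatives are evaluated on constant vector fields; the wedge product is the
  alternating sum without normalising factor, as in \<open>(\<alpha> \<and> \<beta>)(u,v) = \<alpha> u * \<beta> v - \<alpha> v * \<beta> u\<close>.\<close>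

type_synonym 'n form1 = "complex^'n \<Rightarrow> complex^'n \<Rightarrow> real"
type_synonym 'n form2 = "complex^'n \<Rightarrow> complex^'n \<Rightarrow> complex^'n \<Rightarrow> real"

definition ext_d1 :: "('n::finite) form1 \<Rightarrow> 'n form2" where
  "ext_d1 \<theta> x u v =
     frechet_derivative (\<lambda>y. \<theta> y v) (at x) u - frechet_derivative (\<lambda>y. \<theta> y u) (at x) v"

definition ext_d2 :: "('n::finite) form2 \<Rightarrow>
    complex^'n \<Rightarrow> complex^'n \<Rightarrow> complex^'n \<Rightarrow> complex^'n \<Rightarrow> real" where
  "ext_d2 \<omega> x u v w =
     frechet_derivative (\<lambda>y. \<omega> y v w) (at x) u
   - frechet_derivative (\<lambda>y. \<omega> y u w) (at x) v
   + frechet_derivative (\<lambda>y. \<omega> y u v) (at x) w"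

definition wedge12 :: "('n::finite) form1 \<Rightarrow> 'n form2 \<Rightarrow>
    complex^'n \<Rightarrow> complex^'n \<Rightarrow> complex^'n \<Rightarrow> complex^'n \<Rightarrow> real" where
  "wedge12 \<theta> \<omega> x u v w = \<theta> x u * \<omega> x v w - \<theta> x v * \<omega> x u w + \<theta> x w * \<omega> x u v"

text \<open>\<open>d\<^sup>c = J d J\<^sup>-\<^sup>1\<close>, where \<open>J\<close> acts trivially on functions and by \<open>(J \<alpha>)(v) = \<alpha> (J\<^sup>-\<^sup>1 v)\<close> on one-forms.
  This sign makes \<open>dd\<^sup>c F (v, J v) \<ge> 0\<close> for plurisubharmonic \<open>F\<close>, in accordance with
  \<open>\<omega> (v, J v) = g (J v, J v) \<ge> 0\<close>.\<close>

definition d_c :: "(complex^'n \<Rightarrow> real) \<Rightarrow> ('n::finite) form1" where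
  "d_c F x v = frechet_derivative F (at x) (- (\<i> *s v))"

definition dd_c :: "(complex^'n \<Rightarrow> real) \<Rightarrow> ('n::finite) form2" where
  "dd_c F = ext_d1 (d_c F)"

definition pullback1 :: "(complex^'m \<Rightarrow> complex^'n) \<Rightarrow> ('n::finite) form1 \<Rightarrow> ('m::finite) form1" where
  "pullback1 P \<theta> x u = \<theta> (P x) (frechet_derivative P (at x) u)"

definition pullback2 :: "(complex^'m \<Rightarrow> complex^'n) \<Rightarrow> ('n::finite) form2 \<Rightarrow> ('m::finite) form2" where
  "pullback2 P \<omega> x u v =
     \<omega> (P x) (frechet_derivative P (at x) u) (frechet_derivative P (at x) v)"


section \<open>Complex manifolds\<close>

text \<open>A chart \<open>(U, \<phi>)\<close> consists of its domain and a map that matters only on the domain.\<close>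

type_synonym ('a, 'n) chart = "'a set \<times> ('a \<Rightarrow> complex^'n)"

record ('a, 'n::finite) cmanifold =
  mtop :: "'a topology"
  atlas :: "('a, 'n) chart set"

text \<open>\<open>map_in_charts (U, \<phi>) (V, \<psi>) h\<close> is the coordinate expression of \<open>h\<close>, and
  \<open>map_dom_in_charts (U, \<phi>) (V, \<psi>) W h\<close> is the set on which it represents the restriction of \<open>h\<close> to \<open>W\<close>.\<close>

definition map_in_charts ::
    "('a, 'n::finite) chart \<Rightarrow> ('b, 'm::finite) chart \<Rightarrow> ('a \<Rightarrow> 'b) \<Rightarrow> complex^'n \<Rightarrow> complex^'m" where
  "map_in_charts c d h = snd d \<circ> h \<circ> inv_into (fst c) (snd c)"

definition map_dom_in_charts ::
    "('a, 'n::finite) chart \<Rightarrow> ('b, 'm::finite) chart \<Rightarrow> 'a set \<Rightarrow> ('a \<Rightarrow> 'b) \<Rightarrow> (complex^'n) set" where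
  "map_dom_in_charts c d W h = snd c ` (fst c \<inter> W \<inter> h -` fst d)"

definition fun_in_chart :: "('a, 'n::finite) chart \<Rightarrow> ('a \<Rightarrow> real) \<Rightarrow> complex^'n \<Rightarrow> real" where
  "fun_in_chart c f = f \<circ> inv_into (fst c) (snd c)"

definition complex_manifold :: "('a, 'n::finite) cmanifold \<Rightarrow> bool" where
  "complex_manifold M \<longleftrightarrow>
     Hausdorff_space (mtop M) \<and> second_countable (mtop M) \<and>
     (\<Union>c\<in>atlas M. fst c) = topspace (mtop M) \<and>
     (\<forall>(U, \<phi>)\<in>atlas M. openin (mtop M) U \<and> open (\<phi> ` U) \<and>
        homeomorphic_map (subtopology (mtop M) U) (top_of_set (\<phi> ` U)) \<phi>) \<and>
     (\<forall>c\<in>atlas M. \<forall>d\<in>atlas M.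
        holomorphic_map_on (map_dom_in_charts c d UNIV id) (map_in_charts c d id))"

definition holomorphic_on_manifold ::
    "('a, 'n::finite) cmanifold \<Rightarrow> ('b, 'm::finite) cmanifold \<Rightarrow> 'a set \<Rightarrow> ('a \<Rightarrow> 'b) \<Rightarrow> bool" where
  "holomorphic_on_manifold M M' W h \<longleftrightarrow>
     (\<forall>c\<in>atlas M. \<forall>d\<in>atlas M'.
        holomorphic_map_on (map_dom_in_charts c d W h) (map_in_charts c d h))"

text \<open>The topological part is as for \<open>covering_space\<close> in the library, but for abstract topologies.
  The complex structure upstairs is the pulled-back one, that is, every sheet is mapped
  biholomorphically onto its image.\<close>

definition holomorphic_covering ::
    "('b, 'n::finite) cmanifold \<Rightarrow> ('a, 'n) cmanifold \<Rightarrow> ('b \<Rightarrow> 'a) \<Rightarrow> bool" where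
  "holomorphic_covering Y X \<pi> \<longleftrightarrow>
     complex_manifold Y \<and>
     continuous_map (mtop Y) (mtop X) \<pi> \<and> \<pi> ` topspace (mtop Y) = topspace (mtop X) \<and>
     (\<forall>x\<in>topspace (mtop X). \<exists>U \<V>. x \<in> U \<and> openin (mtop X) U \<and>
        \<Union>\<V> = topspace (mtop Y) \<inter> \<pi> -` U \<and> pairwise disjnt \<V> \<and>
        (\<forall>V\<in>\<V>. openin (mtop Y) V \<and>
           homeomorphic_map (subtopology (mtop Y) V) (subtopology (mtop X) U) \<pi> \<and>
           holomorphic_on_manifold Y X V \<pi> \<and>
           holomorphic_on_manifold X Y U (inv_into V \<pi>)))"

definition deck_transformation ::
    "('b, 'n::finite) cmanifold \<Rightarrow> ('b \<Rightarrow> 'a) \<Rightarrow> ('b \<Rightarrow> 'b) \<Rightarrow> bool" where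
  "deck_transformation Y \<pi> \<gamma> \<longleftrightarrow> homeomorphic_map (mtop Y) (mtop Y) \<gamma> \<and>
     (\<forall>y\<in>topspace (mtop Y). \<pi> (\<gamma> y) = \<pi> y)"

text \<open>Covariant tensor fields on a manifold are given by their coordinate expressions in the charts of
  the atlas, which have to be related by the transition maps.\<close>

definition one_form :: "('a, 'n::finite) cmanifold \<Rightarrow> (('a, 'n) chart \<Rightarrow> 'n form1) \<Rightarrow> bool" where
  "one_form M \<theta> \<longleftrightarrow>
     (\<forall>c\<in>atlas M.
        (\<forall>x\<in>snd c ` fst c. linear (\<theta> c x)) \<and>
        (\<forall>u. smooth_on (snd c ` fst c) (\<lambda>x. \<theta> c x u))) \<and>
     (\<forall>c\<in>atlas M. \<forall>d\<in>atlas M. \<forall>x\<in>map_dom_in_charts c d UNIV id. \<forall>u.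
        \<theta> c x u = pullback1 (map_in_charts c d id) (\<theta> d) x u)"

definition covariant_2_tensor ::
    "('a, 'n::finite) cmanifold \<Rightarrow> (('a, 'n) chart \<Rightarrow> 'n form2) \<Rightarrow> bool" where
  "covariant_2_tensor M g \<longleftrightarrow>
     (\<forall>c\<in>atlas M.
        (\<forall>x\<in>snd c ` fst c. bilinear (g c x)) \<and>
        (\<forall>u v. smooth_on (snd c ` fst c) (\<lambda>x. g c x u v))) \<and>
     (\<forall>c\<in>atlas M. \<forall>d\<in>atlas M. \<forall>x\<in>map_dom_in_charts c d UNIV id. \<forall>u v.
        g c x u v = pullback2 (map_in_charts c d id) (g d) x u v)"


section \<open>Locally conformally Kaehler metrics with potential\<close>

definition hermitian_metric ::
    "('a, 'n::finite) cmanifold \<Rightarrow> (('a, 'n) chart \<Rightarrow> 'n form2) \<Rightarrow> bool" where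
  "hermitian_metric M g \<longleftrightarrow> covariant_2_tensor M g \<and>
     (\<forall>c\<in>atlas M. \<forall>x\<in>snd c ` fst c.
        (\<forall>u v. g c x u v = g c x v u) \<and>
        (\<forall>u. u \<noteq> 0 \<longrightarrow> g c x u u > 0) \<and>
        (\<forall>u v. g c x (\<i> *s u) (\<i> *s v) = g c x u v))"

definition fundamental_form ::
    "(('a, 'n::finite) chart \<Rightarrow> 'n form2) \<Rightarrow> ('a, 'n) chart \<Rightarrow> 'n form2" where
  "fundamental_form g c x u v = g c x (\<i> *s u) v"

definition lck_metric ::
    "('a, 'n::finite) cmanifold \<Rightarrow> (('a, 'n) chart \<Rightarrow> 'n form2) \<Rightarrow> bool" where
  "lck_metric M g \<longleftrightarrow> hermitian_metric M g \<and>
     (\<exists>\<theta>. one_form M \<theta> \<and>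
        (\<forall>c\<in>atlas M. \<forall>x\<in>snd c ` fst c.
           (\<forall>u v. ext_d1 (\<theta> c) x u v = 0) \<and>
           (\<forall>u v w. ext_d2 (fundamental_form g c) x u v w
                      = wedge12 (\<theta> c) (fundamental_form g c) x u v w)))"

definition lck_potential ::
    "('a, 'n::finite) cmanifold \<Rightarrow> (('a, 'n) chart \<Rightarrow> 'n form2) \<Rightarrow>
     ('b, 'n) cmanifold \<Rightarrow> ('b \<Rightarrow> 'a) \<Rightarrow> ('b \<Rightarrow> real) \<Rightarrow> bool" where
  "lck_potential X g Y \<pi> f \<longleftrightarrow>
     (\<forall>y\<in>topspace (mtop Y). f y > 0) \<and>
     (\<forall>d\<in>atlas Y. smooth_on (snd d ` fst d) (fun_in_chart d f) \<and>
        plurisubharmonic_on (snd d ` fst d) (fun_in_chart d f)) \<and>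
     (\<forall>d\<in>atlas Y. \<forall>c\<in>atlas X. \<forall>x\<in>map_dom_in_charts d c UNIV \<pi>. \<forall>u v.
        pullback2 (map_in_charts d c \<pi>) (fundamental_form g c) x u v
          = dd_c (fun_in_chart d f) x u v / fun_in_chart d f x) \<and>
     (\<forall>\<gamma>. deck_transformation Y \<pi> \<gamma> \<longrightarrow>
        (\<exists>c. \<forall>y\<in>topspace (mtop Y). f (\<gamma> y) = exp c * f y))"

text \<open>The covering manifold has points in the type \<open>'b\<close>, which is a parameter because types cannot be
  quantified existentially.\<close>

definition lck_metric_with_potential ::
    "'b itself \<Rightarrow> ('a, 'n::finite) cmanifold \<Rightarrow> (('a, 'n) chart \<Rightarrow> 'n form2) \<Rightarrow> bool" where
  "lck_metric_with_potential (_ :: 'b itself) X g \<longleftrightarrow> lck_metric X g \<and>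
     (\<exists>(Y :: ('b, 'n) cmanifold) \<pi> f. holomorphic_covering Y X \<pi> \<and> lck_potential X g Y \<pi> f)"


section \<open>Quotients of domains by groups of automorphisms\<close>

definition orbit_of :: "('a \<Rightarrow> 'a) set \<Rightarrow> 'a \<Rightarrow> 'a set" where
  "orbit_of G x = (\<lambda>h. h x) ` G"

definition quotient_top :: "'a::topological_space set \<Rightarrow> ('a \<Rightarrow> 'a) set \<Rightarrow> 'a set topology" where
  "quotient_top \<Omega> G =
     topology (\<lambda>S. S \<subseteq> orbit_of G ` \<Omega> \<and> openin (top_of_set \<Omega>) {x \<in> \<Omega>. orbit_of G x \<in> S})"

text \<open>Charts are the local inverses of the projection of \<open>\<Omega>\<close> onto the quotient.\<close>

definition quotient_manifold ::
    "(complex^'n) set \<Rightarrow> (complex^'n \<Rightarrow> complex^'n) set \<Rightarrow> ((complex^'n) set, 'n::finite) cmanifold" where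
  "quotient_manifold \<Omega> G =
     \<lparr> mtop = quotient_top \<Omega> G,
       atlas = {(orbit_of G ` U, inv_into U (orbit_of G)) | U.
                  open U \<and> U \<subseteq> \<Omega> \<and> inj_on (orbit_of G) U} \<rparr>"

definition generated_by :: "'a set \<Rightarrow> ('a \<Rightarrow> 'a) set \<Rightarrow> ('a \<Rightarrow> 'a) set" where
  "generated_by \<Omega> S = generate (BijGroup \<Omega>) ((\<lambda>h. restrict h \<Omega>) ` S)"


section \<open>Inoue surfaces\<close>

definition CxH :: "(complex^2) set" where
  "CxH = {v. Im (v $ 2) > 0}"

subsection \<open>Type \<open>S\<^sup>0\<close>\<close>

text \<open>As \<open>\<beta>\<close> is not real and \<open>A\<close> is real, the eigenvalues of \<open>A\<close> are \<open>\<alpha>\<close>, \<open>\<beta>\<close> and \<open>cnj \<beta>\<close>.\<close>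

definition S0_data :: "int^3^3 \<Rightarrow> real \<Rightarrow> complex \<Rightarrow> real^3 \<Rightarrow> complex^3 \<Rightarrow> bool" where
  "S0_data A \<alpha> \<beta> a b \<longleftrightarrow> det A = 1 \<and> \<alpha> > 1 \<and> \<beta> \<notin> \<real> \<and>
     a \<noteq> 0 \<and> map_matrix real_of_int A *v a = \<alpha> *s a \<and>
     b \<noteq> 0 \<and> map_matrix of_int A *v b = \<beta> *s b"

definition S0_group ::
    "real \<Rightarrow> complex \<Rightarrow> real^3 \<Rightarrow> complex^3 \<Rightarrow> (complex^2 \<Rightarrow> complex^2) set" where
  "S0_group \<alpha> \<beta> a b = generated_by CxH
     (insert (\<lambda>v. vector [\<beta> * v $ 1, of_real \<alpha> * v $ 2])
       (range (\<lambda>i v. vector [v $ 1 + b $ i, v $ 2 + of_real (a $ i)])))"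

subsection \<open>Types \<open>S\<^sup>+\<close> and \<open>S\<^sup>-\<close>\<close>

definition inoue_e :: "int^2^2 \<Rightarrow> real^2 \<Rightarrow> real^2 \<Rightarrow> real^2" where
  "inoue_e N a b = (\<chi> i. let n1 = real_of_int (N $ i $ 1); n2 = real_of_int (N $ i $ 2) in
     1/2 * n1 * (n1 - 1) * a $ 1 * b $ 1 + 1/2 * n2 * (n2 - 1) * a $ 2 * b $ 2
     + n1 * n2 * b $ 1 * a $ 2)"

definition inoue_step :: "real^2 \<Rightarrow> real^2 \<Rightarrow> int \<Rightarrow> real" where
  "inoue_step a b r = (b $ 1 * a $ 2 - b $ 2 * a $ 1) / of_int r"

definition Splus_data ::
    "int^2^2 \<Rightarrow> int \<Rightarrow> int \<Rightarrow> int \<Rightarrow> real \<Rightarrow> real^2 \<Rightarrow> real^2 \<Rightarrow> real^2 \<Rightarrow> bool" where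
  "Splus_data N p q r \<alpha> a b c \<longleftrightarrow> det N = 1 \<and> \<alpha> > 1 \<and> r \<noteq> 0 \<and>
     a \<noteq> 0 \<and> map_matrix real_of_int N *v a = \<alpha> *s a \<and>
     b \<noteq> 0 \<and> map_matrix real_of_int N *v b = (1 / \<alpha>) *s b \<and>
     c = c v* transpose (map_matrix real_of_int N) + inoue_e N a b
           + inoue_step a b r *s vector [of_int p, of_int q]"

definition Sminus_data ::
    "int^2^2 \<Rightarrow> int \<Rightarrow> int \<Rightarrow> int \<Rightarrow> real \<Rightarrow> real^2 \<Rightarrow> real^2 \<Rightarrow> real^2 \<Rightarrow> bool" where
  "Sminus_data N p q r \<alpha> a b c \<longleftrightarrow> det N = -1 \<and> \<alpha> > 1 \<and> r \<noteq> 0 \<and>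
     a \<noteq> 0 \<and> map_matrix real_of_int N *v a = \<alpha> *s a \<and>
     b \<noteq> 0 \<and> map_matrix real_of_int N *v b = (- 1 / \<alpha>) *s b \<and>
     - c = c v* transpose (map_matrix real_of_int N) + inoue_e N a b
             + inoue_step a b r *s vector [of_int p, of_int q]"

text \<open>In the coordinates \<open>v $ 1 = x + \<i> y\<close> and \<open>v $ 2 = w + \<i> t\<close>, the maps \<open>g\<^sub>i\<close> for \<open>i = 1, 2\<close>
  and \<open>g\<^sub>3\<close> are \<open>(x, y, w, t) \<mapsto> (x + b\<^sub>i w + c\<^sub>i, y + b\<^sub>i t, w + a\<^sub>i, t)\<close> and
  \<open>(x, y, w, t) \<mapsto> (x + (b\<^sub>1 a\<^sub>2 - b\<^sub>2 a\<^sub>1) / r, y, w, t)\<close>.\<close>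

definition nil_generators ::
    "int \<Rightarrow> real^2 \<Rightarrow> real^2 \<Rightarrow> real^2 \<Rightarrow> (complex^2 \<Rightarrow> complex^2) set" where
  "nil_generators r a b c =
     insert (\<lambda>v. vector [v $ 1 + of_real (inoue_step a b r), v $ 2])
       (range (\<lambda>i v. vector [v $ 1 + of_real (b $ i) * v $ 2 + of_real (c $ i),
                             v $ 2 + of_real (a $ i)]))"

definition Splus_group ::
    "int \<Rightarrow> complex \<Rightarrow> real \<Rightarrow> real^2 \<Rightarrow> real^2 \<Rightarrow> real^2 \<Rightarrow> (complex^2 \<Rightarrow> complex^2) set" where
  "Splus_group r z \<alpha> a b c = generated_by CxH
     (insert (\<lambda>v. vector [v $ 1 + z, of_real \<alpha> * v $ 2]) (nil_generators r a b c))"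

definition Sminus_group ::
    "int \<Rightarrow> real \<Rightarrow> real^2 \<Rightarrow> real^2 \<Rightarrow> real^2 \<Rightarrow> (complex^2 \<Rightarrow> complex^2) set" where
  "Sminus_group r \<alpha> a b c = generated_by CxH
     (insert (\<lambda>v. vector [- (v $ 1), of_real \<alpha> * v $ 2]) (nil_generators r a b c))"

inductive inoue_surface :: "((complex^2) set, 2) cmanifold \<Rightarrow> bool" where
  S0: "S0_data A \<alpha> \<beta> a b \<Longrightarrow> inoue_surface (quotient_manifold CxH (S0_group \<alpha> \<beta> a b))"
| Splus: "Splus_data N p q r \<alpha> a b c \<Longrightarrow>
    inoue_surface (quotient_manifold CxH (Splus_group r z \<alpha> a b c))"
| Sminus: "Sminus_data N p q r \<alpha> a b c \<Longrightarrow>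
    inoue_surface (quotient_manifold CxH (Sminus_group r \<alpha> a b c))"

end

theory Submission
  imports Defs
begin

text \<open>
  The idea is that a potential is bounded, and even attains its maximum, along complex lines on
  which it is strictly subharmonic.

  Let \<open>X\<close> be a quotient of \<open>\<Omega> = \<complex> \<times> \<H>\<close> by a group \<open>G\<close>, and let \<open>\<omega>\<close> be the fundamental form of an LCK
  metric with potential \<open>f\<close> on a covering of \<open>X\<close>. Read through a local section of the covering, \<open>f\<close>
  becomes a positive function \<open>F\<close> on a small open subset of \<open>\<Omega>\<close> with \<open>dd\<^sup>c F = F \<omega>\<close>. As \<open>d (dd\<^sup>c F) = 0\<close>,
  comparison with \<open>d\<omega> = \<theta> \<and> \<omega>\<close> gives \<open>(dF + F \<theta>) \<and> \<omega> = 0\<close>; in complex dimension two the wedge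
  product with \<open>\<omega>\<close> is injective on one-forms, so that \<open>d log F = - \<theta>\<close>. The Lee form, pulled back to
  the convex set \<open>\<Omega>\<close>, has a primitive. Hence there is a global function \<open>h\<close> on \<open>\<Omega>\<close> for which \<open>exp h\<close>
  is, locally, a constant multiple of every such \<open>F\<close>; and since \<open>\<theta>\<close> lives on \<open>X\<close>, the function \<open>h\<close>
  changes only by an additive constant under each element of \<open>G\<close>. This is \<open>lck_potential_on_domain\<close>,
  which records in addition that \<open>h\<close> has no maximum on a complex line: at a maximum \<open>dd\<^sup>c F (e, i e)\<close>
  would be nonpositive, but it equals \<open>F \<omega> (e, i e) > 0\<close>.

  The group of an Inoue surface contains a subgroup that preserves each real hypersurface
  \<open>Im w = t\<close> and acts cocompactly on it, namely a lattice of translations for type \<open>S\<^sup>0\<close> and a discrete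
  Heisenberg group for types \<open>S\<^sup>+\<close> and \<open>S\<^sup>-\<close>. These hypersurfaces are foliated by the complex lines
  \<open>w = const\<close>. If \<open>h\<close> is invariant under that subgroup, then \<open>h\<close> attains a maximum on the hypersurface,
  hence on a complex line, which is the desired contradiction.

  It remains to see that the additive constants vanish on that subgroup. The constants are matched by
  a function \<open>L\<close> that is real-linear along the hypersurface \<open>Im w = t\<close>; thus \<open>h - L\<close> is invariant and
  bounded there. The remaining generator \<open>(z, w) \<mapsto> (\<beta> z, \<alpha> w)\<close> (respectively \<open>(z, w) \<mapsto> (\<plusminus> z + z\<^sub>0, \<alpha> w)\<close>) maps
  one hypersurface to another and changes \<open>h\<close> by a constant only; so it changes \<open>L\<close> by a bounded
  amount. It acts on the arguments of \<open>L\<close> without eigenvalue \<open>1\<close>, whence \<open>L = 0\<close>.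

  All of this takes place in charts of the quotient, which exist only where the orbit map is locally
  injective. Therefore the discreteness of the groups has to be established
  (\<open>charts_of_extension_by_dilation\<close>); here the integrality of the matrices and the precise formula for
  \<open>c\<^sub>1, c\<^sub>2\<close> enter.
\<close>

section \<open>Calculus of iterated directional derivatives\<close>

text \<open>The directional derivatives from which \<open>Ck_on\<close> is built, as an operator on functions, so that
  \<open>pd u (pd v F)\<close> is a second derivative.\<close>

abbreviation pd ::
    "'a::real_normed_vector \<Rightarrow> ('a \<Rightarrow> 'b::real_normed_vector) \<Rightarrow> 'a \<Rightarrow> 'b" where
  "pd v F \<equiv> (\<lambda>x. frechet_derivative F (at x) v)"

lemma frechet_derivative_eqI:
  "(F has_derivative F') (at x) \<Longrightarrow> frechet_derivative F (at x) = F'"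
  using frechet_derivative_at by metis

lemma pd_eqI: "(F has_derivative F') (at x) \<Longrightarrow> pd v F x = F' v"
  using frechet_derivative_at by metis

lemma Ck_on_cong:
  assumes "open S" "\<And>x. x \<in> S \<Longrightarrow> F x = G x" "Ck_on k S F"
  shows "Ck_on k S G"
  using assms(2,3)
proof (induction k arbitrary: F G)
  case 0
  then show ?case by (metis Ck_on.simps(1) continuous_on_cong)
next
  case (Suc k)
  have dF: "F differentiable (at x)" if "x \<in> S" for x using Suc.prems that by simp
  have "(G has_derivative frechet_derivative F (at x)) (at x)" if "x \<in> S" for x
    by (rule has_derivative_transform_within_open
          [OF dF[OF that, unfolded frechet_derivative_works] assms(1) that Suc.prems(1)])
  then have dG: "G differentiable (at x)" "frechet_derivative F (at x) = frechet_derivative G (at x)"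
    if "x \<in> S" for x
    using that by (auto simp: differentiable_def dest: frechet_derivative_at)
  have "Ck_on k S (pd v G)" for v
  proof (rule Suc.IH[of "pd v F"])
    show "Ck_on k S (pd v F)" using Suc.prems by simp
    show "pd v F x = pd v G x" if "x \<in> S" for x using dG(2)[OF that] by simp
  qed
  with dG(1) show ?case by simp
qed

lemma Ck_on_SucI:
  assumes "open S" "\<And>x. x \<in> S \<Longrightarrow> (F has_derivative F' x) (at x)" "\<And>v. Ck_on k S (\<lambda>x. F' x v)"
  shows "Ck_on (Suc k) S F"
proof -
  have "Ck_on k S (pd v F)" for v
    by (rule Ck_on_cong[OF assms(1) _ assms(3)]) (simp add: pd_eqI[OF assms(2)])
  then show ?thesis using assms(2) by (auto simp: differentiable_def)
qed

lemma Ck_on_has_derivative: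
  "Ck_on (Suc k) S F \<Longrightarrow> x \<in> S \<Longrightarrow> (F has_derivative frechet_derivative F (at x)) (at x)"
  by (simp add: frechet_derivative_works[symmetric])

lemma Ck_on_pd: "Ck_on (Suc k) S F \<Longrightarrow> Ck_on k S (pd v F)"
  by simp

lemma Ck_on_Suc_imp: "Ck_on (Suc k) S F \<Longrightarrow> Ck_on k S F"
proof (induction k arbitrary: F)
  case 0
  then show ?case
    by (auto intro!: continuous_at_imp_continuous_on differentiable_imp_continuous_within)
next
  case (Suc k)
  then show ?case by (metis Ck_on.simps(2))
qed

lemma Ck_on_mono: "Ck_on k S F \<Longrightarrow> j \<le> k \<Longrightarrow> Ck_on j S F"
proof (induction k)
  case (Suc k)
  then show ?case by (metis Ck_on_Suc_imp le_Suc_eq)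
qed simp

lemma Ck_on_imp_continuous_on: "Ck_on k S F \<Longrightarrow> continuous_on S F"
  using Ck_on_mono[of k S F 0] by simp

lemma Ck_on_subset: "Ck_on k S F \<Longrightarrow> T \<subseteq> S \<Longrightarrow> Ck_on k T F"
proof (induction k arbitrary: F)
  case 0
  then show ?case by (metis Ck_on.simps(1) continuous_on_subset)
next
  case (Suc k)
  then show ?case by (meson Ck_on.simps(2) subsetD)
qed

lemma Ck_on_const: "Ck_on k S (\<lambda>x. c)"
  by (induction k arbitrary: c) simp_all

lemma Ck_on_bounded_linear:
  assumes "open S" "bounded_linear L" "Ck_on k S F"
  shows "Ck_on k S (\<lambda>x. L (F x))"
  using assms(3)
proof (induction k arbitrary: F)
  case 0
  then show ?case by (simp add: bounded_linear.continuous_on[OF assms(2)])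
next
  case (Suc k)
  show ?case
  proof (rule Ck_on_SucI[OF assms(1)])
    show "((\<lambda>x. L (F x)) has_derivative (\<lambda>v. L (pd v F x))) (at x)" if "x \<in> S" for x
      by (rule bounded_linear.has_derivative[OF assms(2) Ck_on_has_derivative[OF Suc.prems that]])
    show "Ck_on k S (\<lambda>x. L (pd v F x))" for v
      by (rule Suc.IH[OF Ck_on_pd[OF Suc.prems]])
  qed
qed

lemma Ck_on_add:
  assumes "open S" "Ck_on k S F" "Ck_on k S G"
  shows "Ck_on k S (\<lambda>x. F x + G x)"
  using assms(2,3)
proof (induction k arbitrary: F G)
  case 0
  then show ?case by (auto intro: continuous_on_add)
next
  case (Suc k)
  show ?case
  proof (rule Ck_on_SucI[OF assms(1)])
    show "((\<lambda>x. F x + G x) has_derivative (\<lambda>v. pd v F x + pd v G x)) (at x)" if "x \<in> S" for x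
      using Ck_on_has_derivative[OF Suc.prems(1) that] Ck_on_has_derivative[OF Suc.prems(2) that]
      by (rule has_derivative_add)
    show "Ck_on k S (\<lambda>x. pd v F x + pd v G x)" for v
      by (rule Suc.IH[OF Ck_on_pd[OF Suc.prems(1)] Ck_on_pd[OF Suc.prems(2)]])
  qed
qed

lemma Ck_on_sum:
  assumes "open S" "\<And>i. i \<in> I \<Longrightarrow> Ck_on k S (F i)"
  shows "Ck_on k S (\<lambda>x. \<Sum>i\<in>I. F i x)"
  using assms(2)
  by (induction I rule: infinite_finite_induct) (simp_all add: Ck_on_add Ck_on_const assms(1))

lemma Ck_on_scaleR:
  assumes "open S" "Ck_on k S F" "Ck_on k S G"
  shows "Ck_on k S (\<lambda>x. F x *\<^sub>R G x)"
  using assms(2,3)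
proof (induction k arbitrary: F G)
  case 0
  then show ?case by (auto intro: continuous_on_scaleR)
next
  case (Suc k)
  show ?case
  proof (rule Ck_on_SucI[OF assms(1), where F' = "\<lambda>x v. F x *\<^sub>R pd v G x + pd v F x *\<^sub>R G x"])
    show "((\<lambda>x. F x *\<^sub>R G x) has_derivative (\<lambda>v. F x *\<^sub>R pd v G x + pd v F x *\<^sub>R G x)) (at x)"
      if "x \<in> S" for x
      using Ck_on_has_derivative[OF Suc.prems(1) that] Ck_on_has_derivative[OF Suc.prems(2) that]
      by (rule has_derivative_scaleR)
    show "Ck_on k S (\<lambda>x. F x *\<^sub>R pd v G x + pd v F x *\<^sub>R G x)" for v
      by (intro Ck_on_add assms(1) Suc.IH Ck_on_Suc_imp[OF Suc.prems(1)]
          Ck_on_Suc_imp[OF Suc.prems(2)] Ck_on_pd[OF Suc.prems(1)] Ck_on_pd[OF Suc.prems(2)])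
  qed
qed

lemma linear_eq_sum_Basis:
  fixes L :: "'a::euclidean_space \<Rightarrow> 'b::real_vector"
  assumes "linear L"
  shows "L x = (\<Sum>e\<in>Basis. (x \<bullet> e) *\<^sub>R L e)"
proof -
  have "L x = L (\<Sum>e\<in>Basis. (x \<bullet> e) *\<^sub>R e)" by (simp add: euclidean_representation)
  also have "\<dots> = (\<Sum>e\<in>Basis. (x \<bullet> e) *\<^sub>R L e)"
    using assms by (simp add: linear_sum linear_cmul)
  finally show ?thesis .
qed

text \<open>The chain rule expands the derivative of a composition in the basis of the middle space, as a sum
  of products of functions to which the induction hypothesis applies.\<close>

lemma Ck_on_compose:
  fixes F :: "'b::euclidean_space \<Rightarrow> 'c::real_normed_vector"
    and Q :: "'a::real_normed_vector \<Rightarrow> 'b"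
  assumes "open S" "open T" "Q ` S \<subseteq> T" "Ck_on k S Q" "Ck_on k T F"
  shows "Ck_on k S (\<lambda>x. F (Q x))"
  using assms(4,5)
proof (induction k arbitrary: F)
  case 0
  then show ?case using assms(3) by (auto intro: continuous_on_compose2)
next
  case (Suc k)
  show ?case
  proof (rule Ck_on_SucI[OF assms(1), where F' = "\<lambda>x v. pd (pd v Q x) F (Q x)"])
    show "((\<lambda>x. F (Q x)) has_derivative (\<lambda>v. pd (pd v Q x) F (Q x))) (at x)" if "x \<in> S" for x
    proof -
      have "Q x \<in> T" using that assms(3) by auto
      then show ?thesis
        using Ck_on_has_derivative[OF Suc.prems(1) that] Ck_on_has_derivative[OF Suc.prems(2)]
        by (rule_tac has_derivative_compose) auto
    qed
    fix v
    have "Ck_on k S (\<lambda>x. \<Sum>e\<in>Basis. (pd v Q x \<bullet> e) *\<^sub>R pd e F (Q x))"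
    proof (intro Ck_on_sum Ck_on_scaleR assms(1))
      fix e :: 'b
      show "Ck_on k S (\<lambda>x. pd v Q x \<bullet> e)"
        by (rule Ck_on_bounded_linear[OF assms(1) bounded_linear_inner_left Ck_on_pd[OF Suc.prems(1)]])
      show "Ck_on k S (\<lambda>x. pd e F (Q x))"
        by (rule Suc.IH[OF Ck_on_Suc_imp[OF Suc.prems(1)] Ck_on_pd[OF Suc.prems(2)]])
    qed
    then show "Ck_on k S (\<lambda>x. pd (pd v Q x) F (Q x))"
    proof (rule Ck_on_cong[OF assms(1), rotated])
      fix x assume "x \<in> S"
      then have "linear (frechet_derivative F (at (Q x)))"
        using assms(3) Suc.prems(2) by (auto intro!: linear_frechet_derivative)
      then show "(\<Sum>e\<in>Basis. (pd v Q x \<bullet> e) *\<^sub>R pd e F (Q x)) = pd (pd v Q x) F (Q x)"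
        by (rule linear_eq_sum_Basis[symmetric])
    qed
  qed
qed

lemma line_has_real_derivative:
  fixes f :: "'a::real_normed_vector \<Rightarrow> real"
  assumes "(f has_derivative f') (at (y + r *\<^sub>R u))"
  shows "((\<lambda>r. f (y + r *\<^sub>R u)) has_real_derivative f' u) (at r)"
proof -
  have "((\<lambda>r. y + r *\<^sub>R u) has_derivative (\<lambda>s. s *\<^sub>R u)) (at r)"
    by (auto intro!: derivative_eq_intros)
  from has_derivative_compose[OF this assms]
  show ?thesis
    by (rule has_derivative_imp_has_field_derivative)
       (simp add: linear_cmul[OF has_derivative_linear[OF assms]])
qed

text \<open>The mean value theorem in the direction \<open>u\<close>, followed by the one in the direction \<open>v\<close>. The second
  difference on the left is symmetric in \<open>u\<close> and \<open>v\<close>, which is what makes second derivatives commute.\<close>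

lemma second_difference_eq_derivative:
  fixes f :: "'a::real_normed_vector \<Rightarrow> real"
  assumes "Ck_on 2 S f" "h > 0"
    and S: "\<And>s t. 0 \<le> s \<Longrightarrow> s \<le> h \<Longrightarrow> 0 \<le> t \<Longrightarrow> t \<le> h \<Longrightarrow> x + s *\<^sub>R u + t *\<^sub>R v \<in> S"
  shows "\<exists>s t. 0 < s \<and> s < h \<and> 0 < t \<and> t < h \<and>
    f (x + h *\<^sub>R u + h *\<^sub>R v) - f (x + h *\<^sub>R u) - f (x + h *\<^sub>R v) + f x
      = h * h * pd v (pd u f) (x + s *\<^sub>R u + t *\<^sub>R v)"
proof -
  have C: "Ck_on (Suc (Suc 0)) S f" using assms(1) by (simp add: numeral_2_eq_2)
  note df = Ck_on_has_derivative[OF C]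
  note ddf = Ck_on_has_derivative[OF Ck_on_pd[OF C]]
  define g where "g s = f ((x + h *\<^sub>R v) + s *\<^sub>R u) - f (x + s *\<^sub>R u)" for s
  have 1: "(g has_real_derivative pd u f ((x + h *\<^sub>R v) + s *\<^sub>R u) - pd u f (x + s *\<^sub>R u)) (at s)"
    if "0 \<le> s" "s \<le> h" for s
  proof -
    have "(x + h *\<^sub>R v) + s *\<^sub>R u \<in> S" "x + s *\<^sub>R u \<in> S"
      using S[OF that, of h] S[OF that, of 0] assms(2) by (simp_all add: algebra_simps)
    then show ?thesis
      unfolding g_def by (intro DERIV_diff line_has_real_derivative df)
  qed
  obtain s where s: "0 < s" "s < h"
    and s_eq: "g h - g 0 = (h - 0) * (pd u f ((x + h *\<^sub>R v) + s *\<^sub>R u) - pd u f (x + s *\<^sub>R u))"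
    using MVT2[OF assms(2) 1] by metis
  have 2: "((\<lambda>t. pd u f ((x + s *\<^sub>R u) + t *\<^sub>R v)) has_real_derivative
      pd v (pd u f) ((x + s *\<^sub>R u) + t *\<^sub>R v)) (at t)" if "0 \<le> t" "t \<le> h" for t
    by (rule line_has_real_derivative[OF ddf[OF S]]) (use that s in simp_all)
  obtain t where t: "0 < t" "t < h" and
    t_eq: "pd u f ((x + s *\<^sub>R u) + h *\<^sub>R v) - pd u f ((x + s *\<^sub>R u) + 0 *\<^sub>R v)
      = (h - 0) * pd v (pd u f) ((x + s *\<^sub>R u) + t *\<^sub>R v)"
    using MVT2[OF assms(2) 2] by metis
  have sw: "x + h *\<^sub>R v + s *\<^sub>R u = x + s *\<^sub>R u + h *\<^sub>R v" "x + h *\<^sub>R v + h *\<^sub>R u = x + h *\<^sub>R u + h *\<^sub>R v"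
    by (simp_all add: algebra_simps)
  have "g h - g 0 = h * h * pd v (pd u f) (x + s *\<^sub>R u + t *\<^sub>R v)"
    using s_eq t_eq unfolding sw by simp
  then have "f (x + h *\<^sub>R u + h *\<^sub>R v) - f (x + h *\<^sub>R u) - f (x + h *\<^sub>R v) + f x
      = h * h * pd v (pd u f) (x + s *\<^sub>R u + t *\<^sub>R v)"
    unfolding g_def sw by simp
  with s t show ?thesis by blast
qed

lemma pd_commute_real:
  fixes f :: "'a::real_normed_vector \<Rightarrow> real"
  assumes "Ck_on 2 S f" "open S" "x \<in> S"
  shows "pd v (pd u f) x = pd u (pd v f) x"
proof (rule ccontr)
  assume ne: "pd v (pd u f) x \<noteq> pd u (pd v f) x"
  define \<epsilon> where "\<epsilon> = \<bar>pd v (pd u f) x - pd u (pd v f) x\<bar> / 2"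
  have "\<epsilon> > 0" using ne by (simp add: \<epsilon>_def)
  have C: "continuous_on S (pd v (pd u f))" "continuous_on S (pd u (pd v f))"
    using assms(1) by (auto simp: numeral_2_eq_2)
  obtain \<delta>1 where \<delta>1: "\<delta>1 > 0"
    "\<And>y. y \<in> S \<Longrightarrow> dist y x < \<delta>1 \<Longrightarrow> \<bar>pd v (pd u f) y - pd v (pd u f) x\<bar> < \<epsilon>"
    using C(1) assms(3) \<open>\<epsilon> > 0\<close> unfolding continuous_on_iff dist_real_def by metis
  obtain \<delta>2 where \<delta>2: "\<delta>2 > 0"
    "\<And>y. y \<in> S \<Longrightarrow> dist y x < \<delta>2 \<Longrightarrow> \<bar>pd u (pd v f) y - pd u (pd v f) x\<bar> < \<epsilon>"
    using C(2) assms(3) \<open>\<epsilon> > 0\<close> unfolding continuous_on_iff dist_real_def by metis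
  obtain \<delta>3 where \<delta>3: "\<delta>3 > 0" "\<And>y. dist y x < \<delta>3 \<Longrightarrow> y \<in> S"
    using assms(2,3) by (metis open_dist)
  define \<delta> where "\<delta> = min \<delta>1 (min \<delta>2 \<delta>3)"
  \<comment> \<open>so small that the parallelogram with sides \<open>h u\<close> and \<open>h v\<close> lies in the \<open>\<delta>\<close>-ball about \<open>x\<close>\<close>
  define h where "h = \<delta> / (2 * (1 + norm u + norm v))"
  have "\<delta> > 0" using \<delta>1 \<delta>2 \<delta>3 by (simp add: \<delta>_def)
  have pos: "1 + norm u + norm v > 0" by (simp add: add_pos_nonneg)
  have "h > 0" unfolding h_def using \<open>\<delta> > 0\<close> pos by (simp add: add_pos_nonneg)
  have small: "dist (x + s *\<^sub>R u + t *\<^sub>R v) x < \<delta>"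
    if "0 \<le> s" "s \<le> h" "0 \<le> t" "t \<le> h" for s t
  proof -
    have "norm (s *\<^sub>R u + t *\<^sub>R v) \<le> s * norm u + t * norm v"
      using norm_triangle_ineq[of "s *\<^sub>R u" "t *\<^sub>R v"] that by simp
    also have "\<dots> \<le> h * norm u + h * norm v"
      using that by (intro add_mono mult_right_mono) auto
    also have "\<dots> = h * (norm u + norm v)"
      by (simp add: algebra_simps)
    also have "\<dots> < h * (2 * (1 + norm u + norm v))"
      using \<open>h > 0\<close> pos by (intro mult_strict_left_mono) auto
    also have "\<dots> = \<delta>" using pos by (simp add: h_def)
    finally show ?thesis by (simp add: dist_norm algebra_simps)
  qed
  have inS: "x + s *\<^sub>R u + t *\<^sub>R v \<in> S" if "0 \<le> s" "s \<le> h" "0 \<le> t" "t \<le> h" for s t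
    using small[OF that] \<delta>3(2) by (simp add: \<delta>_def)
  obtain s t where st: "0 < s" "s < h" "0 < t" "t < h"
    "f (x + h *\<^sub>R u + h *\<^sub>R v) - f (x + h *\<^sub>R u) - f (x + h *\<^sub>R v) + f x
      = h * h * pd v (pd u f) (x + s *\<^sub>R u + t *\<^sub>R v)"
    using second_difference_eq_derivative[OF assms(1) \<open>h > 0\<close> inS] by blast
  have inS': "x + s *\<^sub>R v + t *\<^sub>R u \<in> S" if "0 \<le> s" "s \<le> h" "0 \<le> t" "t \<le> h" for s t
    using inS[OF that(3,4,1,2)] by (simp add: add.assoc add.commute[of "s *\<^sub>R v"])
  obtain s' t' where st': "0 < s'" "s' < h" "0 < t'" "t' < h"
    "f (x + h *\<^sub>R v + h *\<^sub>R u) - f (x + h *\<^sub>R v) - f (x + h *\<^sub>R u) + f x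
      = h * h * pd u (pd v f) (x + s' *\<^sub>R v + t' *\<^sub>R u)"
    using second_difference_eq_derivative[OF assms(1) \<open>h > 0\<close> inS'] by blast
  let ?y = "x + s *\<^sub>R u + t *\<^sub>R v" and ?z = "x + t' *\<^sub>R u + s' *\<^sub>R v"
  have sw: "x + s' *\<^sub>R v + t' *\<^sub>R u = ?z" "x + h *\<^sub>R v + h *\<^sub>R u = x + h *\<^sub>R u + h *\<^sub>R v"
    by (simp_all add: algebra_simps)
  have "h * h * pd v (pd u f) ?y = h * h * pd u (pd v f) ?z"
    using st(5) st'(5) unfolding sw by linarith
  then have eq: "pd v (pd u f) ?y = pd u (pd v f) ?z"
    using \<open>h > 0\<close> by simp
  have "\<bar>pd v (pd u f) ?y - pd v (pd u f) x\<bar> < \<epsilon>"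
    using \<delta>1(2)[OF inS] small[of s t] st by (simp add: \<delta>_def)
  moreover have "\<bar>pd u (pd v f) ?z - pd u (pd v f) x\<bar> < \<epsilon>"
    using \<delta>2(2)[OF inS] small[of t' s'] st' by (simp add: \<delta>_def)
  ultimately have "\<bar>pd v (pd u f) x - pd u (pd v f) x\<bar> < 2 * \<epsilon>"
    using eq by linarith
  then show False by (simp add: \<epsilon>_def)
qed

lemma pd_inner:
  assumes "F differentiable (at x)"
  shows "pd v (\<lambda>y. F y \<bullet> e) x = pd v F x \<bullet> e"
  by (rule pd_eqI)
     (use assms in \<open>auto intro!: bounded_linear.has_derivative[OF bounded_linear_inner_left]
        simp: frechet_derivative_works[symmetric]\<close>)

lemma pd_commute:
  fixes F :: "'a::real_normed_vector \<Rightarrow> 'b::euclidean_space"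
  assumes "Ck_on 2 S F" "open S" "x \<in> S"
  shows "pd v (pd u F) x = pd u (pd v F) x"
proof (rule euclidean_eqI)
  fix e :: 'b assume "e \<in> Basis"
  have C: "Ck_on (Suc (Suc 0)) S F" using assms(1) by (simp add: numeral_2_eq_2)
  have *: "pd w (pd w' (\<lambda>y. F y \<bullet> e)) x = pd w (pd w' F) x \<bullet> e" for w w'
  proof -
    have "pd w (pd w' (\<lambda>y. F y \<bullet> e)) x = pd w (\<lambda>y. pd w' F y \<bullet> e) x"
    proof (rule pd_eqI, rule has_derivative_transform_within_open[OF _ assms(2,3)])
      show "((\<lambda>y. pd w' F y \<bullet> e) has_derivative frechet_derivative (\<lambda>y. pd w' F y \<bullet> e) (at x)) (at x)"
        using Ck_on_has_derivative[OF Ck_on_bounded_linear[OF assms(2) bounded_linear_inner_left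
              Ck_on_pd[OF C]] assms(3)] .
      show "pd w' F y \<bullet> e = pd w' (\<lambda>y. F y \<bullet> e) y" if "y \<in> S" for y
        using C that by (simp add: pd_inner)
    qed
    also have "\<dots> = pd w (pd w' F) x \<bullet> e"
      using C assms(3) by (intro pd_inner) auto
    finally show ?thesis .
  qed
  have "Ck_on 2 S (\<lambda>y. F y \<bullet> e)"
    by (rule Ck_on_bounded_linear[OF assms(2) bounded_linear_inner_left assms(1)])
  from pd_commute_real[OF this assms(2,3), of v u]
  show "pd v (pd u F) x \<bullet> e = pd u (pd v F) x \<bullet> e" by (simp add: *)
qed

section \<open>Lee forms and the operator \<open>dd\<^sup>c\<close>\<close>

lemma dd_c_eq: "dd_c F x u v = pd u (pd (- (\<i> *s v)) F) x - pd v (pd (- (\<i> *s u)) F) x"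
  by (simp add: dd_c_def ext_d1_def d_c_def)

text \<open>Product rule for the evaluation of the differential of \<open>F\<close> on a variable vector; the first term uses
  the symmetry of the second derivative of \<open>F\<close>.\<close>

lemma frechet_derivative_apply_has_derivative:
  fixes F :: "'b::euclidean_space \<Rightarrow> real" and Q Z :: "'a::real_normed_vector \<Rightarrow> 'b"
  assumes F: "Ck_on 2 T F" "open T" and S: "open S" "x \<in> S" "Q ` S \<subseteq> T"
    and Q: "(Q has_derivative Q') (at x)" and Z: "(Z has_derivative Z') (at x)"
  shows "((\<lambda>y. frechet_derivative F (at (Q y)) (Z y)) has_derivative
    (\<lambda>u. pd (Q' u) (pd (Z x) F) (Q x) + frechet_derivative F (at (Q x)) (Z' u))) (at x)"
proof -
  have C: "Ck_on (Suc (Suc 0)) T F" using F(1) by (simp add: numeral_2_eq_2)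
  have QT: "Q y \<in> T" if "y \<in> S" for y using that S(3) by blast
  have lin: "linear (frechet_derivative F (at (Q y)))" if "y \<in> S" for y
    using has_derivative_linear[OF Ck_on_has_derivative[OF C QT[OF that]]] .
  have d: "((\<lambda>y. pd e F (Q y)) has_derivative (\<lambda>u. pd (Q' u) (pd e F) (Q x))) (at x)" for e
    using has_derivative_compose[OF Q Ck_on_has_derivative[OF Ck_on_pd[OF C] QT[OF S(2)]]] .
  have "((\<lambda>y. \<Sum>e\<in>Basis. (Z y \<bullet> e) * pd e F (Q y)) has_derivative
      (\<lambda>u. \<Sum>e\<in>Basis. (Z x \<bullet> e) * pd (Q' u) (pd e F) (Q x) + (Z' u \<bullet> e) * pd e F (Q x))) (at x)"
    by (intro has_derivative_sum has_derivative_mult d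
        bounded_linear.has_derivative[OF bounded_linear_inner_left Z])
  moreover have "(\<lambda>u. \<Sum>e\<in>Basis. (Z x \<bullet> e) * pd (Q' u) (pd e F) (Q x) + (Z' u \<bullet> e) * pd e F (Q x))
    = (\<lambda>u. pd (Q' u) (pd (Z x) F) (Q x) + frechet_derivative F (at (Q x)) (Z' u))"
  proof
    fix u
    have lin2: "linear (frechet_derivative (pd (Q' u) F) (at (Q x)))"
      using has_derivative_linear[OF Ck_on_has_derivative[OF Ck_on_pd[OF C] QT[OF S(2)]]] .
    have "(\<Sum>e\<in>Basis. (Z x \<bullet> e) * pd (Q' u) (pd e F) (Q x)) = pd (Z x) (pd (Q' u) F) (Q x)"
      by (subst linear_eq_sum_Basis[OF lin2])
         (simp add: pd_commute[OF F QT[OF S(2)], of "Q' u"])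
    moreover have "(\<Sum>e\<in>Basis. (Z' u \<bullet> e) * pd e F (Q x)) = frechet_derivative F (at (Q x)) (Z' u)"
      by (subst linear_eq_sum_Basis[OF lin[OF S(2)]]) simp
    ultimately show "(\<Sum>e\<in>Basis. (Z x \<bullet> e) * pd (Q' u) (pd e F) (Q x) + (Z' u \<bullet> e) * pd e F (Q x))
      = pd (Q' u) (pd (Z x) F) (Q x) + frechet_derivative F (at (Q x)) (Z' u)"
      by (simp add: sum.distrib pd_commute[OF F QT[OF S(2)], of "Q' u"])
  qed
  ultimately have "((\<lambda>y. \<Sum>e\<in>Basis. (Z y \<bullet> e) * pd e F (Q y)) has_derivative
      (\<lambda>u. pd (Q' u) (pd (Z x) F) (Q x) + frechet_derivative F (at (Q x)) (Z' u))) (at x)"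
    by simp
  then show ?thesis
    by (rule has_derivative_transform_within_open[OF _ S(1,2)])
       (use linear_eq_sum_Basis[OF lin] in simp)
qed

lemma bounded_linear_vector_scalar_mult:
  "bounded_linear (\<lambda>v. c *s v :: complex^'n::finite)"
  by (rule linear_conv_bounded_linear[THEN iffD1], rule linearI)
     (auto simp: vec_eq_iff algebra_simps)

text \<open>The operator \<open>dd\<^sup>c\<close> commutes with holomorphic changes of coordinates. By the Cauchy-Riemann
  equations \<open>d\<^sup>c\<close> is natural, and the contributions of the second derivative of \<open>Q\<close> cancel because that
  derivative is symmetric.\<close>

lemma dd_c_compose:
  fixes F :: "complex^'n::finite \<Rightarrow> real" and Q :: "complex^'m::finite \<Rightarrow> complex^'n"
  assumes F: "Ck_on 2 T F" "open T" and S: "open S" "x \<in> S" "Q ` S \<subseteq> T"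
    and Q: "holomorphic_map_on S Q"
  shows "dd_c (\<lambda>y. F (Q y)) x u v = dd_c F (Q x) (pd u Q x) (pd v Q x)"
proof -
  have C: "Ck_on (Suc (Suc 0)) T F" using F(1) by (simp add: numeral_2_eq_2)
  have CQ: "Ck_on (Suc (Suc 0)) S Q" "Ck_on 2 S Q"
    using Q by (auto simp: holomorphic_map_on_def smooth_on_def simp del: Ck_on.simps)
  have QT: "Q y \<in> T" if "y \<in> S" for y using that S(3) by blast
  note dQ = Ck_on_has_derivative[OF CQ(1)]
  have JQ: "pd (- (\<i> *s w)) Q y = - (\<i> *s pd w Q y)" if "y \<in> S" for y w
    using linear_neg[OF has_derivative_linear[OF dQ[OF that]]] Q that
    by (auto simp: holomorphic_map_on_def)
  have first: "pd (- (\<i> *s w)) (\<lambda>y. F (Q y)) y = frechet_derivative F (at (Q y)) (- (\<i> *s pd w Q y))"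
    if "y \<in> S" for y w
    unfolding JQ[OF that, symmetric]
    by (rule pd_eqI, rule has_derivative_compose[OF dQ[OF that] Ck_on_has_derivative[OF C QT[OF that]]])
  have second: "pd u (pd (- (\<i> *s w)) (\<lambda>y. F (Q y))) x
      = pd (pd u Q x) (pd (- (\<i> *s pd w Q x)) F) (Q x)
        + frechet_derivative F (at (Q x)) (- (\<i> *s pd u (pd w Q) x))" for u w
  proof (rule pd_eqI, rule has_derivative_transform_within_open[OF _ S(1,2) first[symmetric]])
    have "((\<lambda>y. - (\<i> *s pd w Q y)) has_derivative (\<lambda>u. - (\<i> *s pd u (pd w Q) x))) (at x)"
      by (intro has_derivative_minus
          bounded_linear.has_derivative[OF bounded_linear_vector_scalar_mult]
          Ck_on_has_derivative[OF Ck_on_pd[OF CQ(1)] S(2)])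
    then show "((\<lambda>y. frechet_derivative F (at (Q y)) (- (\<i> *s pd w Q y))) has_derivative
        (\<lambda>u. pd (pd u Q x) (pd (- (\<i> *s pd w Q x)) F) (Q x)
        + frechet_derivative F (at (Q x)) (- (\<i> *s pd u (pd w Q) x)))) (at x)"
      by (rule frechet_derivative_apply_has_derivative[OF F S dQ[OF S(2)]])
  qed
  show ?thesis
    unfolding dd_c_eq second by (simp add: pd_commute[OF CQ(2) S(1,2), of u v])
qed

lemma ext_d2_dd_c_eq_0:
  fixes F :: "complex^'n::finite \<Rightarrow> real"
  assumes F: "Ck_on 3 S F" and S: "open S" "x \<in> S"
  shows "ext_d2 (dd_c F) x u v w = 0"
proof -
  have C: "Ck_on (Suc (Suc (Suc 0))) S F" using F by (simp add: numeral_3_eq_3)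
  have C2: "Ck_on 2 S (pd a F)" for a using Ck_on_pd[OF C] by (simp add: numeral_2_eq_2)
  have *: "pd a (\<lambda>y. dd_c F y b c) x
    = pd a (pd b (pd (- (\<i> *s c)) F)) x - pd a (pd c (pd (- (\<i> *s b)) F)) x" for a b c
    unfolding dd_c_eq
    by (rule pd_eqI)
       (intro has_derivative_diff Ck_on_has_derivative[OF Ck_on_pd[OF Ck_on_pd[OF C]] S(2)])
  show ?thesis
    unfolding ext_d2_def *
    using pd_commute[OF C2[of "- (\<i> *s w)"] S, of u v]
      pd_commute[OF C2[of "- (\<i> *s v)"] S, of u w] pd_commute[OF C2[of "- (\<i> *s u)"] S, of v w]
    by simp
qed

lemma exists_outside_complex_line:
  fixes u :: "complex^2"
  shows "\<exists>v. \<forall>c. v \<noteq> c *s u"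
proof (cases "u $ 1 = 0")
  case True
  then show ?thesis
    by (intro exI[of _ "axis 1 1"]) (auto simp: vec_eq_iff axis_def)
next
  case False
  then show ?thesis
    by (intro exI[of _ "axis 2 1"]) (auto simp: vec_eq_iff axis_def forall_2)
qed

text \<open>In complex dimension two some \<open>v \<noteq> 0\<close> is orthogonal to both \<open>u\<close> and \<open>i u\<close>. In the identity for \<open>u\<close>,
  \<open>v\<close>, \<open>i v\<close> only the term \<open>\<eta> u * g (i v) (i v)\<close> survives.\<close>

lemma wedge_fundamental_form_injective:
  fixes g :: "complex^2 \<Rightarrow> complex^2 \<Rightarrow> real"
  assumes bil: "bilinear g" and sym: "\<And>u v. g u v = g v u"
    and pos: "\<And>u. u \<noteq> 0 \<Longrightarrow> g u u > 0"
    and J: "\<And>u v. g (\<i> *s u) (\<i> *s v) = g u v"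
    and wedge: "\<And>u v w. \<eta> u * g (\<i> *s v) w - \<eta> v * g (\<i> *s u) w + \<eta> w * g (\<i> *s u) v = 0"
  shows "\<eta> u = (0::real)"
proof -
  have JJ: "\<i> *s (\<i> *s w) = - w" for w :: "complex^2"
    by (simp add: vec_eq_iff)
  have Jg: "g w (\<i> *s w') = - g (\<i> *s w) w'" for w w'
    using J[of w "\<i> *s w'"] by (simp add: JJ bilinear_rneg[OF bil] equation_minus_iff)
  have orth: "g (\<i> *s w) w = 0" for w
    using Jg[of w w] sym[of w "\<i> *s w"] by simp
  obtain v' where v': "\<And>c. v' \<noteq> c *s u" using exists_outside_complex_line by blast
  define a where "a = g u v' / g u u"
  define b where "b = g (\<i> *s u) v' / g u u"
  define v where "v = v' - (a *\<^sub>R u + b *\<^sub>R (\<i> *s u))"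
  have "a *\<^sub>R u + b *\<^sub>R (\<i> *s u) = Complex a b *s u"
    by (simp add: vec_eq_iff complex_eq_iff)
  then have "v \<noteq> 0" using v' by (simp add: v_def)
  have div: "g u u = 0 \<Longrightarrow> u = 0" using pos by force
  have z: "g 0 w = 0" "g w 0 = 0" for w
    by (auto simp: bilinear_lzero[OF bil] bilinear_rzero[OF bil])
  have "g u v = 0"
    using div orth[of u] sym[of u "\<i> *s u"]
    by (cases "u = 0")
       (auto simp: v_def a_def b_def z bilinear_rsub[OF bil] bilinear_radd[OF bil]
          bilinear_rmul[OF bil])
  moreover have "g (\<i> *s u) v = 0"
    using div orth[of u]
    by (cases "u = 0")
       (auto simp: v_def a_def b_def z J bilinear_rsub[OF bil] bilinear_radd[OF bil]
          bilinear_rmul[OF bil])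
  ultimately have "\<eta> u * g (\<i> *s v) (\<i> *s v) = 0"
    using wedge[of u v "\<i> *s v"] by (simp add: J)
  then show ?thesis using pos[OF \<open>v \<noteq> 0\<close>] by (simp add: J)
qed

text \<open>Since \<open>F \<omega> = dd\<^sup>c F\<close> is closed, \<open>dF \<and> \<omega> + F \<theta> \<and> \<omega> = 0\<close>, and \<open>\<omega>\<close> can be cancelled. The potential is thus
  determined by the metric up to a constant factor.\<close>

lemma Lee_form_eq_dlog_potential:
  fixes F :: "complex^2 \<Rightarrow> real" and \<omega> :: "2 form2"
  assumes S: "open S" "x \<in> S" and F: "Ck_on 3 S F" "F x > 0"
    and g: "bilinear (g x)" "\<And>u v. g x u v = g x v u" "\<And>u. u \<noteq> 0 \<Longrightarrow> g x u u > 0"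
      "\<And>u v. g x (\<i> *s u) (\<i> *s v) = g x u v"
    and \<omega>: "\<And>y u v. \<omega> y u v = g y (\<i> *s u) v" "\<And>u v. (\<lambda>y. \<omega> y u v) differentiable (at x)"
    and potential: "\<And>y u v. y \<in> S \<Longrightarrow> dd_c F y u v = F y * \<omega> y u v"
    and Lee: "\<And>u v w. ext_d2 \<omega> x u v w = wedge12 \<theta> \<omega> x u v w"
  shows "pd u F x = - F x * \<theta> x u"
proof -
  have dF: "(F has_derivative frechet_derivative F (at x)) (at x)"
    using F(1) S(2) by (intro Ck_on_has_derivative[where k=2]) (simp_all add: eval_nat_numeral)
  have *: "pd a (\<lambda>y. dd_c F y b c) x = F x * pd a (\<lambda>y. \<omega> y b c) x + pd a F x * \<omega> x b c" for a b c
  proof (rule pd_eqI, rule has_derivative_transform_within_open[OF _ S potential[symmetric]])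
    show "((\<lambda>y. F y * \<omega> y b c) has_derivative
        (\<lambda>a. F x * pd a (\<lambda>y. \<omega> y b c) x + pd a F x * \<omega> x b c)) (at x)"
      by (rule has_derivative_mult[OF dF \<omega>(2)[unfolded frechet_derivative_works]])
  qed
  define \<eta> where "\<eta> a = pd a F x + F x * \<theta> x a" for a
  have "\<eta> a * g x (\<i> *s b) c - \<eta> b * g x (\<i> *s a) c + \<eta> c * g x (\<i> *s a) b = 0" for a b c
  proof -
    have "0 = F x * ext_d2 \<omega> x a b c + (pd a F x * \<omega> x b c - pd b F x * \<omega> x a c + pd c F x * \<omega> x a b)"
      using ext_d2_dd_c_eq_0[OF F(1) S, of a b c] unfolding ext_d2_def *
      by (simp add: algebra_simps)
    then show ?thesis
      unfolding Lee wedge12_def \<omega>(1)[symmetric] \<eta>_def by (simp add: algebra_simps)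
  qed
  from wedge_fundamental_form_injective[of "g x" \<eta> u, OF g this] show ?thesis
    by (simp add: \<eta>_def)
qed

lemma second_derivative_nonpos_at_maximum:
  fixes F :: "'a::real_normed_vector \<Rightarrow> real"
  assumes F: "Ck_on 2 S F" and S: "open S" "x \<in> S"
    and max: "\<And>r. x + r *\<^sub>R e \<in> S \<Longrightarrow> F (x + r *\<^sub>R e) \<le> F x"
  shows "pd e (pd e F) x \<le> 0"
proof (rule ccontr)
  assume "\<not> pd e (pd e F) x \<le> 0"
  then have pos: "pd e (pd e F) x > 0" by simp
  have C: "Ck_on (Suc (Suc 0)) S F" using F by (simp add: numeral_2_eq_2)
  define \<phi> where "\<phi> r = F (x + r *\<^sub>R e)" for r
  define \<phi>' where "\<phi>' r = pd e F (x + r *\<^sub>R e)" for r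
  have "open ((\<lambda>r. x + r *\<^sub>R e) -` S)"
    by (intro continuous_open_vimage S(1) continuous_intros) 
  then obtain d where d: "d > 0" "\<And>r. \<bar>r\<bar> < d \<Longrightarrow> x + r *\<^sub>R e \<in> S"
    using S(2) unfolding open_dist by (auto simp: dist_real_def dest!: bspec[of _ _ 0])
  have d1: "(\<phi> has_real_derivative \<phi>' r) (at r)" if "\<bar>r\<bar> < d" for r
    unfolding \<phi>_def \<phi>'_def
    by (rule line_has_real_derivative[OF Ck_on_has_derivative[OF C d(2)[OF that]]])
  have "(\<phi>' has_real_derivative pd e (pd e F) (x + 0 *\<^sub>R e)) (at 0)"
    unfolding \<phi>'_def
    by (rule line_has_real_derivative[OF Ck_on_has_derivative[OF Ck_on_pd[OF C] d(2)]])
       (use d(1) in simp)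
  then obtain d' where d': "d' > 0" "\<And>h. 0 < h \<Longrightarrow> h < d' \<Longrightarrow> \<phi>' 0 < \<phi>' h"
    using DERIV_pos_inc_right[of \<phi>' "pd e (pd e F) x" 0] pos by auto
  have "\<phi>' 0 = 0"
  proof (rule DERIV_local_max[OF d1[of 0] d(1)])
    show "\<forall>y. \<bar>0 - y\<bar> < d \<longrightarrow> \<phi> y \<le> \<phi> 0"
      using max d(2) by (simp add: \<phi>_def)
  qed (use d(1) in simp)
  define h where "h = min d d' / 2"
  have h: "0 < h" "h < d" "h < d'" using d(1) d'(1) by (auto simp: h_def min_def)
  obtain s where s: "0 < s" "s < h" "\<phi> h - \<phi> 0 = (h - 0) * \<phi>' s"
    using MVT2[OF h(1), of \<phi> \<phi>'] d1 h by auto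
  have "\<phi>' s > 0" using d'(2)[of s] s h \<open>\<phi>' 0 = 0\<close> by simp
  then have "\<phi> h > \<phi> 0" using s h by (simp add: algebra_simps)
  moreover have "\<phi> h \<le> \<phi> 0" using max[of h] d(2)[of h] h by (simp add: \<phi>_def)
  ultimately show False by simp
qed

text \<open>On a complex line \<open>dd\<^sup>c F (e, i e)\<close> is the Laplacian of the restriction of \<open>F\<close>.\<close>

lemma dd_c_nonpos_at_maximum:
  fixes F :: "complex^'n::finite \<Rightarrow> real"
  assumes F: "Ck_on 2 S F" and S: "open S" "x \<in> S"
    and max: "\<And>c. x + c *s e \<in> S \<Longrightarrow> F (x + c *s e) \<le> F x"
  shows "dd_c F x e (\<i> *s e) \<le> 0"
proof -
  have C: "Ck_on (Suc (Suc 0)) S F" using F by (simp add: numeral_2_eq_2)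
  have "- (\<i> *s (\<i> *s e)) = e" by (simp add: vec_eq_iff)
  moreover have "pd (\<i> *s e) (pd (- (\<i> *s e)) F) x = - pd (\<i> *s e) (pd (\<i> *s e) F) x"
  proof (rule pd_eqI[where F' = "\<lambda>v. - pd v (pd (\<i> *s e) F) x"],
      rule has_derivative_transform_within_open[OF _ S])
    show "((\<lambda>y. - pd (\<i> *s e) F y) has_derivative
        (\<lambda>v. - pd v (pd (\<i> *s e) F) x)) (at x)"
      by (intro has_derivative_minus Ck_on_has_derivative[OF Ck_on_pd[OF C] S(2)])
    show "- pd (\<i> *s e) F y = pd (- (\<i> *s e)) F y" if "y \<in> S" for y
      using linear_neg[OF has_derivative_linear[OF Ck_on_has_derivative[OF C that]]] by simp
  qed
  ultimately have "dd_c F x e (\<i> *s e) = pd e (pd e F) x + pd (\<i> *s e) (pd (\<i> *s e) F) x"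
    by (simp add: dd_c_eq)
  moreover have "pd e (pd e F) x \<le> 0"
  proof (rule second_derivative_nonpos_at_maximum[OF F S])
    fix r assume "x + r *\<^sub>R e \<in> S"
    moreover have "r *\<^sub>R e = complex_of_real r *s e"
      unfolding vec_eq_iff vector_scaleR_component vector_smult_component by (simp add: scaleR_conv_of_real)
    ultimately show "F (x + r *\<^sub>R e) \<le> F x" using max by simp
  qed
  moreover have "pd (\<i> *s e) (pd (\<i> *s e) F) x \<le> 0"
  proof (rule second_derivative_nonpos_at_maximum[OF F S])
    fix r assume "x + r *\<^sub>R (\<i> *s e) \<in> S"
    moreover have "r *\<^sub>R (\<i> *s e) = (complex_of_real r * \<i>) *s e"
      unfolding vec_eq_iff vector_scaleR_component vector_smult_component by (simp add: scaleR_conv_of_real)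
    ultimately show "F (x + r *\<^sub>R (\<i> *s e)) \<le> F x" using max by simp
  qed
  ultimately show ?thesis by simp
qed

section \<open>Primitives of closed one-forms on convex domains\<close>

text \<open>The primitive is the integral along the segment from a base point. It is differentiated under the
  integral sign; by closedness the result is the derivative of \<open>s \<mapsto> s * \<theta>\<close> along the segment.
  Only directional derivatives are asserted, as these suffice to compare two primitives.\<close>

lemma Poincare_convex:
  fixes \<theta> :: "'a::real_normed_vector \<Rightarrow> 'a \<Rightarrow> real"
  assumes S: "open S" "convex S"
    and lin: "\<And>x. x \<in> S \<Longrightarrow> linear (\<theta> x)"
    and C1: "\<And>u. Ck_on 1 S (\<lambda>x. \<theta> x u)"
    and closed: "\<And>x u v. x \<in> S \<Longrightarrow> pd u (\<lambda>y. \<theta> y v) x = pd v (\<lambda>y. \<theta> y u) x"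
  shows "\<exists>h. \<forall>x\<in>S. \<forall>u. ((\<lambda>r. h (x + r *\<^sub>R u)) has_real_derivative \<theta> x u) (at 0)"
proof (cases "S = {}")
  case False
  then obtain p where p: "p \<in> S" by blast
  have C: "Ck_on (Suc 0) S (\<lambda>x. \<theta> x u)" for u using C1 by simp
  note d\<theta> = Ck_on_has_derivative[OF C]
  have cont: "continuous_on S (\<lambda>x. \<theta> x u)" for u
    by (rule Ck_on_imp_continuous_on[OF C])
  have cont': "continuous_on S (pd v (\<lambda>x. \<theta> x u))" for u v
    by (rule Ck_on_imp_continuous_on[OF Ck_on_pd[OF C]])
  define h where "h x = integral {0..1} (\<lambda>s. \<theta> (p + s *\<^sub>R (x - p)) (x - p))" for x
  have "((\<lambda>r. h (x + r *\<^sub>R u)) has_real_derivative \<theta> x u) (at 0)" if x: "x \<in> S" for x u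
  proof -
    define a where "a = x - p"
    define y where "y r s = p + s *\<^sub>R (a + r *\<^sub>R u)" for r s
    have "open ((\<lambda>r. x + r *\<^sub>R u) -` S)"
      by (intro continuous_open_vimage S(1) continuous_intros) 
    then obtain d where d: "d > 0" "\<And>r. \<bar>r\<bar> < d \<Longrightarrow> x + r *\<^sub>R u \<in> S"
      using x unfolding open_dist by (auto simp: dist_real_def dest!: bspec[of _ _ 0])
    define U where "U = {-d<..<d}"
    have U: "0 \<in> U" "convex U" "open U" using d(1) by (auto simp: U_def)
    have yS: "y r s \<in> S" if "r \<in> U" "s \<in> {0..1}" for r s
    proof -
      have "(1 - s) *\<^sub>R p + s *\<^sub>R (x + r *\<^sub>R u) \<in> S"
        using that d(2)[of r] p S(2) by (intro convexD) (auto simp: U_def)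
      moreover have "(1 - s) *\<^sub>R p + s *\<^sub>R (x + r *\<^sub>R u) = y r s"
        by (simp add: y_def a_def algebra_simps)
      ultimately show ?thesis by simp
    qed
    have ycont: "continuous_on T (\<lambda>z. y (fst z) (snd z))" for T
      unfolding y_def by (intro continuous_intros)
    define f where "f r s = \<theta> (y r s) a + r * \<theta> (y r s) u" for r s
    define fx where "fx r s = s * pd u (\<lambda>x. \<theta> x a) (y r s)
      + (r * (s * pd u (\<lambda>x. \<theta> x u) (y r s)) + \<theta> (y r s) u)" for r s
    have dy: "((\<lambda>r. \<theta> (y r s) b) has_real_derivative s * pd u (\<lambda>x. \<theta> x b) (y r s)) (at r within U)"
      if "r \<in> U" "s \<in> {0..1}" for r s b
    proof -
      have e: "y r s = (p + s *\<^sub>R a) + r *\<^sub>R (s *\<^sub>R u)" for r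
        by (simp add: y_def algebra_simps)
      have D: "((\<lambda>x. \<theta> x b) has_derivative frechet_derivative (\<lambda>x. \<theta> x b) (at (y r s))) (at (y r s))"
        using d\<theta>[OF yS[OF that]] .
      have "((\<lambda>r. \<theta> (y r s) b) has_real_derivative pd (s *\<^sub>R u) (\<lambda>x. \<theta> x b) (y r s)) (at r)"
        using D unfolding e by (rule line_has_real_derivative)
      then show ?thesis
        unfolding linear_cmul[OF has_derivative_linear[OF D]] real_scaleR_def
        by (rule has_field_derivative_at_within)
    qed
    have "((\<lambda>r. integral (cbox 0 1) (f r)) has_real_derivative integral (cbox 0 1) (fx 0)) (at 0 within U)"
    proof (rule leibniz_rule_field_derivative[OF _ _ _ U(1,2)])
      show "((\<lambda>r. f r s) has_real_derivative fx r s) (at r within U)" if "r \<in> U" "s \<in> cbox 0 1" for r s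
      proof -
        have s: "s \<in> {0..1}" using that by simp
        have "((\<lambda>r. r * \<theta> (y r s) u) has_real_derivative
            r * (s * pd u (\<lambda>x. \<theta> x u) (y r s)) + 1 * \<theta> (y r s) u) (at r within U)"
          by (rule DERIV_mult'[OF DERIV_ident dy[OF that(1) s]])
        from DERIV_add[OF dy[OF that(1) s] this] show ?thesis
          by (simp add: f_def fx_def)
      qed
      have "continuous_on {0..1} (f r)" if "r \<in> U" for r
      proof -
        have "continuous_on {0..1} (y r)" unfolding y_def by (intro continuous_intros)
        then have "continuous_on {0..1} (\<lambda>s. \<theta> (y r s) b)" for b
          by (rule continuous_on_compose2[OF cont]) (use yS[OF that] in blast)
        then show ?thesis unfolding f_def by (intro continuous_intros)
      qed
      then show "f r integrable_on cbox 0 1" if "r \<in> U" for r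
        using that by (simp add: integrable_continuous_interval)
      show "continuous_on (U \<times> cbox 0 1) (\<lambda>(r, s). fx r s)"
      proof -
        have sub: "(\<lambda>z. y (fst z) (snd z)) ` (U \<times> cbox 0 1) \<subseteq> S" using yS by auto
        show ?thesis
          unfolding fx_def split_beta
          by (intro continuous_on_add continuous_on_mult continuous_on_fst continuous_on_snd
              continuous_on_id continuous_on_compose2[OF cont ycont sub]
              continuous_on_compose2[OF cont' ycont sub])
      qed
    qed
    moreover have "integral (cbox 0 1) (fx 0) = \<theta> x u"
    proof -
      have "((\<lambda>s. s * \<theta> (y 0 s) u) has_real_derivative fx 0 s) (at s)" if s: "s \<in> {0..1}" for s
      proof -
        have e: "y 0 s = p + s *\<^sub>R a" for s by (simp add: y_def)
        have y0: "y 0 s \<in> S" by (rule yS[OF U(1) s])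
        have "((\<lambda>s. \<theta> (y 0 s) u) has_real_derivative pd a (\<lambda>x. \<theta> x u) (y 0 s)) (at s)"
          unfolding e by (rule line_has_real_derivative[OF d\<theta>[OF y0[unfolded e]]])
        from DERIV_mult[OF DERIV_ident this] show ?thesis
          by (simp add: fx_def closed[OF y0, of u a] algebra_simps)
      qed
      then have "((\<lambda>s. s * \<theta> (y 0 s) u) has_vector_derivative fx 0 s) (at s within {0..1})"
        if "s \<in> {0..1}" for s
        using that
        by (metis has_real_derivative_iff_has_vector_derivative has_field_derivative_at_within)
      from fundamental_theorem_of_calculus[OF zero_le_one this]
      have "(fx 0 has_integral 1 * \<theta> (y 0 1) u - 0 * \<theta> (y 0 0) u) {0..1}" .
      then show ?thesis by (simp add: y_def a_def integral_unique)
    qed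
    ultimately have *: "((\<lambda>r. integral (cbox 0 1) (f r)) has_real_derivative \<theta> x u) (at 0)"
      unfolding at_within_open[OF U(1,3)] by (simp only:)
    have eq: "integral (cbox 0 1) (f r) = h (x + r *\<^sub>R u)" if r: "r \<in> U" for r
    proof -
      have e: "x + r *\<^sub>R u - p = a + r *\<^sub>R u" by (simp add: a_def)
      have "f r s = \<theta> (y r s) (a + r *\<^sub>R u)" if "s \<in> {0..1}" for s
        using lin[OF yS[OF r that]] by (simp add: f_def linear_add linear_cmul)
      then have "integral {0..1} (f r) = integral {0..1} (\<lambda>s. \<theta> (y r s) (a + r *\<^sub>R u))"
        by (rule integral_cong)
      then show ?thesis unfolding h_def e y_def by simp
    qed
    have ev: "\<forall>\<^sub>F r in nhds 0. integral (cbox 0 1) (f r) = h (x + r *\<^sub>R u)"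
      using eq U(1,3) unfolding eventually_nhds by blast
    show ?thesis
      using * DERIV_cong_ev[OF refl ev refl] by simp
  qed
  then show ?thesis by blast
qed simp

lemma constant_if_directional_derivatives_vanish:
  fixes f :: "'a::real_normed_vector \<Rightarrow> real"
  assumes "convex S" "x \<in> S" "y \<in> S"
    and d: "\<And>x u. x \<in> S \<Longrightarrow> ((\<lambda>r. f (x + r *\<^sub>R u)) has_real_derivative 0) (at 0)"
  shows "f x = f y"
proof -
  have "((\<lambda>r. f (x + r *\<^sub>R (y - x))) has_real_derivative 0) (at r within {0..1})"
    if r: "r \<in> {0..1}" for r
  proof -
    have "(1 - r) *\<^sub>R x + r *\<^sub>R y \<in> S"
      using r assms(1-3) by (intro convexD) auto
    then have z: "x + r *\<^sub>R (y - x) \<in> S" by (simp add: algebra_simps)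
    have "((\<lambda>s. f ((x + r *\<^sub>R (y - x)) + s *\<^sub>R (y - x))) has_real_derivative 0) (at 0)"
      by (rule d[OF z])
    then have "((\<lambda>s. f (x + (s + r) *\<^sub>R (y - x))) has_real_derivative 0) (at 0)"
      by (simp add: algebra_simps)
    then have "((\<lambda>s. f (x + s *\<^sub>R (y - x))) has_real_derivative 0) (at (0 + r))"
      by (simp only: DERIV_shift)
    then show ?thesis by (simp add: has_field_derivative_at_within)
  qed
  then obtain c where c: "\<And>r. r \<in> {0..1} \<Longrightarrow> f (x + r *\<^sub>R (y - x)) = c"
    using has_field_derivative_zero_constant[of "{0..1::real}" "\<lambda>r. f (x + r *\<^sub>R (y - x))"]
    by (meson convex_real_interval(5))
  show ?thesis using c[of 0] c[of 1] by simp
qed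

section \<open>Quotients by generated groups of bijections\<close>

text \<open>A relation that contains the graphs of the generators and is an equivalence relation on \<open>\<Omega>\<close> contains
  the orbit relation. This avoids normal forms for the elements of the generated group.\<close>

lemma generated_by_induct [consumes 3, case_names refl gen sym trans]:
  assumes S: "\<And>s. s \<in> S \<Longrightarrow> bij_betw s \<Omega> \<Omega>"
    and h: "h \<in> generated_by \<Omega> S" and x: "x \<in> \<Omega>"
    and refl: "\<And>x. x \<in> \<Omega> \<Longrightarrow> R x x"
    and gen: "\<And>s x. s \<in> S \<Longrightarrow> x \<in> \<Omega> \<Longrightarrow> R x (s x)"
    and sym: "\<And>x y. x \<in> \<Omega> \<Longrightarrow> y \<in> \<Omega> \<Longrightarrow> R x y \<Longrightarrow> R y x"
    and trans: "\<And>x y z. x \<in> \<Omega> \<Longrightarrow> y \<in> \<Omega> \<Longrightarrow> z \<in> \<Omega> \<Longrightarrow> R x y \<Longrightarrow> R y z \<Longrightarrow> R x z"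
  shows "R x (h x)"
proof -
  have inS: "restrict s \<Omega> \<in> Bij \<Omega>" if "s \<in> S" for s
    using S[OF that] by (simp add: Bij_def)
  have "h \<in> Bij \<Omega> \<and> (\<forall>x\<in>\<Omega>. R x (h x))"
    using h unfolding generated_by_def
  proof (induction rule: generate.induct)
    case one
    have "\<one>\<^bsub>BijGroup \<Omega>\<^esub> = (\<lambda>x\<in>\<Omega>. x)" by (simp add: BijGroup_def)
    then show ?case using refl id_Bij by (metis restrict_apply')
  next
    case (incl h)
    then show ?case using inS gen by auto
  next
    case (inv h)
    then obtain s where s: "s \<in> S" "h = restrict s \<Omega>" by blast
    have B: "h \<in> Bij \<Omega>" using inS s by simp
    have "R x (inv_into \<Omega> h x)" if x: "x \<in> \<Omega>" for x
    proof -
      define y where "y = inv_into \<Omega> h x"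
      have y: "y \<in> \<Omega>" unfolding y_def by (rule Bij_inv_into_mem[OF B x])
      have "h y = x" unfolding y_def
        using B x by (intro f_inv_into_f) (auto simp: Bij_def bij_betw_def)
      then have "R y x" using gen[OF s(1) y] s(2) y by simp
      then show ?thesis using sym x y by (simp add: y_def)
    qed
    then show ?case using inv_BijGroup[OF B] restrict_inv_into_Bij[OF B] by (metis restrict_apply')
  next
    case (eng h1 h2)
    then have B: "h1 \<in> Bij \<Omega>" "h2 \<in> Bij \<Omega>" by auto
    have "R x (h1 (h2 x))" if "x \<in> \<Omega>" for x
    proof -
      have "h2 x \<in> \<Omega>" "h1 (h2 x) \<in> \<Omega>"
        using B that by (auto dest!: Bij_imp_funcset)
      then show ?thesis using eng trans that by blast
    qed
    moreover have "h1 \<otimes>\<^bsub>BijGroup \<Omega>\<^esub> h2 = compose \<Omega> h1 h2"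
      using B by (simp add: BijGroup_def)
    ultimately show ?case using compose_Bij[OF B] by (metis compose_eq)
  qed
  then show ?thesis using x by blast
qed

lemma BijGroup_carrier: "carrier (BijGroup \<Omega>) = Bij \<Omega>"
  by (simp add: BijGroup_def)

lemma BijGroup_mult:
  "h \<in> Bij \<Omega> \<Longrightarrow> k \<in> Bij \<Omega> \<Longrightarrow> h \<otimes>\<^bsub>BijGroup \<Omega>\<^esub> k = compose \<Omega> h k"
  by (simp add: BijGroup_def)

lemma orbit_of_generator:
  assumes S: "\<And>s. s \<in> S \<Longrightarrow> bij_betw s \<Omega> \<Omega>" and s: "s \<in> S" and x: "x \<in> \<Omega>"
  shows "orbit_of (generated_by \<Omega> S) (s x) = orbit_of (generated_by \<Omega> S) x"
proof -
  interpret group "BijGroup \<Omega>" by (rule group_BijGroup)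
  let ?G = "generated_by \<Omega> S" and ?s = "restrict s \<Omega>"
  have sub: "(\<lambda>h. restrict h \<Omega>) ` S \<subseteq> carrier (BijGroup \<Omega>)"
    using S by (auto simp: BijGroup_def Bij_def)
  have GB: "h \<in> Bij \<Omega>" if "h \<in> ?G" for h
    using generate_in_carrier[OF sub, of h] that unfolding generated_by_def by (simp add: BijGroup_carrier)
  have sG: "?s \<in> ?G" using s by (auto simp: generated_by_def intro: generate.incl)
  have mult: "(h \<otimes>\<^bsub>BijGroup \<Omega>\<^esub> k) y = h (k y)" if "h \<in> ?G" "k \<in> ?G" "y \<in> \<Omega>" for h k y
    using BijGroup_mult[OF GB[OF that(1)] GB[OF that(2)]] that(3) by (simp add: compose_eq)
  have closed: "h \<otimes>\<^bsub>BijGroup \<Omega>\<^esub> k \<in> ?G" if "h \<in> ?G" "k \<in> ?G" for h k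
    using that unfolding generated_by_def by (rule generate.eng)
  have sx: "s x \<in> \<Omega>" using bij_betwE[OF S[OF s]] x by blast
  define t where "t = inv\<^bsub>BijGroup \<Omega>\<^esub> ?s"
  have tG: "t \<in> ?G" using s unfolding generated_by_def t_def by (auto intro: generate.inv)
  have tsx: "t (s x) = x"
    using inv_BijGroup[OF GB[OF sG]] sx x S[OF s]
    by (simp add: t_def bij_betw_def) (metis inv_into_f_f inj_on_restrict_eq restrict_apply')
  have "h (s x) \<in> orbit_of ?G x" if "h \<in> ?G" for h
    using mult[OF that sG x] closed[OF that sG] x unfolding orbit_of_def image_iff
    by (metis restrict_apply')
  moreover have "h x \<in> orbit_of ?G (s x)" if "h \<in> ?G" for h
    using mult[OF that tG sx] closed[OF that tG] tsx unfolding orbit_of_def image_iff by metis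
  ultimately show ?thesis by (auto simp: orbit_of_def)
qed

lemma mem_orbit_of_self:
  assumes "x \<in> \<Omega>"
  shows "x \<in> orbit_of (generated_by \<Omega> S) x"
proof -
  have one: "(\<lambda>x\<in>\<Omega>. x) \<in> generated_by \<Omega> S"
    using generate.one[of "BijGroup \<Omega>"] by (simp add: generated_by_def BijGroup_def)
  have "x = (\<lambda>x\<in>\<Omega>. x) x" using assms by simp
  from image_eqI[of x "\<lambda>h. h x", OF this one] show ?thesis
    by (simp only: orbit_of_def)
qed

lemma openin_quotient_top:
  "openin (quotient_top \<Omega> G) V \<longleftrightarrow>
     V \<subseteq> orbit_of G ` \<Omega> \<and> openin (top_of_set \<Omega>) {x \<in> \<Omega>. orbit_of G x \<in> V}"
proof -
  have "istopology (\<lambda>V. V \<subseteq> orbit_of G ` \<Omega> \<and> openin (top_of_set \<Omega>) {x \<in> \<Omega>. orbit_of G x \<in> V})"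
    unfolding istopology_def
  proof (intro conjI allI impI)
    fix V W
    assume V: "V \<subseteq> orbit_of G ` \<Omega> \<and> openin (top_of_set \<Omega>) {x \<in> \<Omega>. orbit_of G x \<in> V}"
      and W: "W \<subseteq> orbit_of G ` \<Omega> \<and> openin (top_of_set \<Omega>) {x \<in> \<Omega>. orbit_of G x \<in> W}"
    have "{x \<in> \<Omega>. orbit_of G x \<in> V \<inter> W} = {x \<in> \<Omega>. orbit_of G x \<in> V} \<inter> {x \<in> \<Omega>. orbit_of G x \<in> W}"
      by blast
    moreover have "openin (top_of_set \<Omega>) ({x \<in> \<Omega>. orbit_of G x \<in> V} \<inter> {x \<in> \<Omega>. orbit_of G x \<in> W})"
      by (rule openin_Int) (use V W in blast)+
    ultimately show "openin (top_of_set \<Omega>) {x \<in> \<Omega>. orbit_of G x \<in> V \<inter> W}"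
      by (simp only:)
    show "V \<inter> W \<subseteq> orbit_of G ` \<Omega>" using V by blast
  next
    fix \<K>
    assume K: "\<forall>V\<in>\<K>. V \<subseteq> orbit_of G ` \<Omega> \<and> openin (top_of_set \<Omega>) {x \<in> \<Omega>. orbit_of G x \<in> V}"
    have "{x \<in> \<Omega>. orbit_of G x \<in> \<Union>\<K>} = (\<Union>V\<in>\<K>. {x \<in> \<Omega>. orbit_of G x \<in> V})"
      by blast
    moreover have "openin (top_of_set \<Omega>) (\<Union>V\<in>\<K>. {x \<in> \<Omega>. orbit_of G x \<in> V})"
      by (rule openin_Union) (use K in blast)
    ultimately show "openin (top_of_set \<Omega>) {x \<in> \<Omega>. orbit_of G x \<in> \<Union>\<K>}"
      by (simp only:)
    show "\<Union>\<K> \<subseteq> orbit_of G ` \<Omega>" using K by blast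
  qed
  then show ?thesis by (simp add: quotient_top_def)
qed

lemma topspace_quotient_top: "topspace (quotient_top \<Omega> G) = orbit_of G ` \<Omega>"
proof
  show "topspace (quotient_top \<Omega> G) \<subseteq> orbit_of G ` \<Omega>"
    using openin_quotient_top[of \<Omega> G "topspace (quotient_top \<Omega> G)"] by simp
  have "{x \<in> \<Omega>. orbit_of G x \<in> orbit_of G ` \<Omega>} = \<Omega>" by blast
  then have "openin (quotient_top \<Omega> G) (orbit_of G ` \<Omega>)"
    by (simp add: openin_quotient_top)
  then show "orbit_of G ` \<Omega> \<subseteq> topspace (quotient_top \<Omega> G)"
    by (rule openin_subset)
qed

definition quotient_chart ::
    "(complex^'n \<Rightarrow> complex^'n) set \<Rightarrow> (complex^'n) set \<Rightarrow> ((complex^'n) set, 'n) chart" where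
  "quotient_chart G U = (orbit_of G ` U, inv_into U (orbit_of G))"

text \<open>The sets on which the quotient has a chart, that is, on which the orbit map has an inverse.\<close>

definition chart_domain :: "(complex^'n) set \<Rightarrow> (complex^'n \<Rightarrow> complex^'n) set \<Rightarrow> (complex^'n) set \<Rightarrow> bool" where
  "chart_domain \<Omega> G U \<longleftrightarrow> open U \<and> U \<subseteq> \<Omega> \<and> inj_on (orbit_of G) U"

lemma atlas_quotient_manifold:
  "atlas (quotient_manifold \<Omega> G) = {quotient_chart G U | U. chart_domain \<Omega> G U}"
  by (simp add: quotient_manifold_def quotient_chart_def chart_domain_def)

lemma mtop_quotient_manifold [simp]: "mtop (quotient_manifold \<Omega> G) = quotient_top \<Omega> G"
  by (simp add: quotient_manifold_def)

lemma fst_quotient_chart [simp]: "fst (quotient_chart G U) = orbit_of G ` U"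
  by (simp add: quotient_chart_def)

lemma snd_quotient_chart:
  "chart_domain \<Omega> G U \<Longrightarrow> v \<in> U \<Longrightarrow> snd (quotient_chart G U) (orbit_of G v) = v"
  by (simp add: quotient_chart_def chart_domain_def)

lemma quotient_chart_image:
  assumes "chart_domain \<Omega> G U"
  shows "snd (quotient_chart G U) ` orbit_of G ` U = U"
  using snd_quotient_chart[OF assms] by force

lemma inv_quotient_chart:
  assumes "chart_domain \<Omega> G U" "v \<in> U"
  shows "inv_into (orbit_of G ` U) (snd (quotient_chart G U)) v = orbit_of G v"
proof -
  have "inj_on (snd (quotient_chart G U)) (orbit_of G ` U)"
    using snd_quotient_chart[OF assms(1)] by (auto intro!: inj_onI)
  from inv_into_f_f[OF this, of "orbit_of G v"] show ?thesis
    using assms by (simp add: snd_quotient_chart)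
qed

text \<open>A form on the quotient is invariant under every map \<open>\<gamma>\<close> that preserves orbits, because \<open>\<gamma>\<close> is then the
  transition map between the two charts. With \<open>\<gamma> = id\<close> this says that the coordinate expression does
  not depend on the chart.\<close>

lemma one_form_quotient_invariant:
  assumes form: "one_form (quotient_manifold \<Omega> G) \<theta>"
    and U: "chart_domain \<Omega> G U" and U': "chart_domain \<Omega> G U'"
    and O: "open O'" "v \<in> O'" "O' \<subseteq> U" "\<gamma> ` O' \<subseteq> U'"
    and orb: "\<And>y. y \<in> O' \<Longrightarrow> orbit_of G (\<gamma> y) = orbit_of G y"
    and d: "(\<gamma> has_derivative L) (at v)"
  shows "\<theta> (quotient_chart G U) v u = \<theta> (quotient_chart G U') (\<gamma> v) (L u)"
proof -
  let ?c = "quotient_chart G U" and ?c' = "quotient_chart G U'"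
  have eq: "map_in_charts ?c ?c' id y = \<gamma> y" if "y \<in> O'" for y
  proof -
    have "y \<in> U" "\<gamma> y \<in> U'" using that O by auto
    then show ?thesis
      by (simp add: map_in_charts_def inv_quotient_chart[OF U] orb[OF that, symmetric]
          snd_quotient_chart[OF U'])
  qed
  have v: "v \<in> U" "\<gamma> v \<in> U'" using O by auto
  have "orbit_of G v \<in> orbit_of G ` U'" using v orb[OF O(2)] by (metis imageI)
  then have "v \<in> map_dom_in_charts ?c ?c' UNIV id"
    unfolding map_dom_in_charts_def
    using v by (intro image_eqI[of _ _ "orbit_of G v"]) (auto simp: snd_quotient_chart[OF U])
  then have "\<theta> ?c v u = pullback1 (map_in_charts ?c ?c' id) (\<theta> ?c') v u"
    using form U U' unfolding one_form_def atlas_quotient_manifold by blast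
  moreover have "(map_in_charts ?c ?c' id has_derivative L) (at v)"
    by (rule has_derivative_transform_within_open[OF d O(1,2)]) (simp add: eq)
  ultimately show ?thesis
    by (simp add: pullback1_def frechet_derivative_eqI eq[OF O(2)])
qed

section \<open>The global potential on the domain\<close>

lemma Ck_on_local:
  assumes "\<And>x. x \<in> S \<Longrightarrow> \<exists>T. open T \<and> x \<in> T \<and> Ck_on k T F"
  shows "Ck_on k S F"
  using assms
proof (induction k arbitrary: F)
  case 0
  then show ?case
    by (metis Ck_on.simps(1) continuous_at_imp_continuous_on continuous_on_eq_continuous_at)
next
  case (Suc k)
  then show ?case by (metis Ck_on.simps(2))
qed

text \<open>A sheet over a neighbourhood of the orbit of \<open>v\<close> gives a holomorphic local section of the covering;
  \<open>F\<close> is the pull-back of the potential along it.\<close>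

lemma local_lck_potential:
  fixes \<Omega> :: "(complex^'n::finite) set" and G
  defines "X \<equiv> quotient_manifold \<Omega> G"
  assumes \<Omega>: "open \<Omega>" and U: "chart_domain \<Omega> G U" "v \<in> U"
    and cov: "holomorphic_covering (Y :: ('b, 'n) cmanifold) X \<pi>"
    and pot: "lck_potential X g Y \<pi> f"
  shows "\<exists>N F. open N \<and> v \<in> N \<and> N \<subseteq> U \<and> smooth_on N F \<and> (\<forall>y\<in>N. F y > 0) \<and>
    (\<forall>y\<in>N. \<forall>a b. dd_c F y a b = F y * fundamental_form g (quotient_chart G U) y a b)"
proof -
  let ?p = "orbit_of G" and ?c = "quotient_chart G U"
  have mX: "mtop X = quotient_top \<Omega> G" by (simp add: X_def)
  have cX: "?c \<in> atlas X" using U by (auto simp: X_def atlas_quotient_manifold)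
  have U': "open U" "U \<subseteq> \<Omega>" using U by (auto simp: chart_domain_def)
  have vX: "?p v \<in> topspace (mtop X)" using U U' by (auto simp: mX topspace_quotient_top)
  obtain U1 \<V> where U1: "?p v \<in> U1" "openin (mtop X) U1"
    and \<V>: "\<Union>\<V> = topspace (mtop Y) \<inter> \<pi> -` U1"
    and sheet: "\<And>V. V \<in> \<V> \<Longrightarrow> openin (mtop Y) V \<and>
           homeomorphic_map (subtopology (mtop Y) V) (subtopology (mtop X) U1) \<pi> \<and>
           holomorphic_on_manifold Y X V \<pi> \<and>
           holomorphic_on_manifold X Y U1 (inv_into V \<pi>)"
    using cov vX unfolding holomorphic_covering_def by metis
  have Y: "complex_manifold Y" and "\<pi> ` topspace (mtop Y) = topspace (mtop X)"
    using cov unfolding holomorphic_covering_def by auto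
  then obtain y0 where y0: "y0 \<in> topspace (mtop Y)" "\<pi> y0 = ?p v"
    using vX by (metis imageE)
  then have "y0 \<in> \<Union>\<V>" using U1(1) by (simp add: \<V>)
  then obtain V where V: "V \<in> \<V>" "y0 \<in> V" by blast
  have "y0 \<in> (\<Union>c\<in>atlas Y. fst c)"
    using Y y0(1) unfolding complex_manifold_def by simp
  then obtain d where d: "d \<in> atlas Y" "y0 \<in> fst d" by blast
  have d': "openin (mtop Y) (fst d)" "open (snd d ` fst d)"
    "homeomorphic_map (subtopology (mtop Y) (fst d)) (top_of_set (snd d ` fst d)) (snd d)"
    using Y d(1) unfolding complex_manifold_def case_prod_unfold by simp_all
  have inj_d: "inj_on (snd d) (fst d)"
    using d'(3) openin_subset[OF d'(1)]
    by (auto simp: homeomorphic_map_def Int_absorb1)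
  have Vop: "openin (mtop Y) V" and hom: "homeomorphic_map (subtopology (mtop Y) V) (subtopology (mtop X) U1) \<pi>"
    and hol_\<pi>: "holomorphic_on_manifold Y X V \<pi>"
    and hol_inv: "holomorphic_on_manifold X Y U1 (inv_into V \<pi>)"
    using sheet[OF V(1)] by auto
  have inj_\<pi>: "inj_on \<pi> V"
    using hom openin_subset[OF Vop] by (auto simp: homeomorphic_map_def Int_absorb1)
  define W where "W = V \<inter> fst d"
  have "openin (subtopology (mtop Y) V) W"
    unfolding W_def using d'(1) by (simp add: openin_subtopology_Int2)
  then have W_open: "openin (subtopology (mtop X) U1) (\<pi> ` W)"
    using homeomorphic_imp_open_map[OF hom] by (simp add: open_map_def)
  have W: "openin (mtop X) (\<pi> ` W)" "\<pi> ` W \<subseteq> U1"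
    using openin_trans_full[OF W_open U1(2)] openin_imp_subset[OF W_open] .
  define N where "N = U \<inter> {u \<in> \<Omega>. ?p u \<in> \<pi> ` W}"
  have "openin (top_of_set \<Omega>) {u \<in> \<Omega>. ?p u \<in> \<pi> ` W}"
    using W(1) by (simp add: mX openin_quotient_top)
  then have N: "open N" "N \<subseteq> U"
    using \<Omega> U'(1) unfolding N_def by (auto intro: open_Int openin_open_trans)
  have vN: "v \<in> N"
    using U(2) U'(2) V(2) d(2) y0(2) unfolding N_def W_def by (auto intro!: image_eqI[of _ _ y0])
  have lift: "inv_into V \<pi> (?p u) \<in> W" "\<pi> (inv_into V \<pi> (?p u)) = ?p u" if "u \<in> N" for u
  proof -
    have "?p u \<in> \<pi> ` W" using that by (simp add: N_def)
    then obtain w where w: "w \<in> W" "?p u = \<pi> w" by blast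
    then have "inv_into V \<pi> (?p u) = w" using inj_\<pi> by (simp add: W_def)
    then show "inv_into V \<pi> (?p u) \<in> W" "\<pi> (inv_into V \<pi> (?p u)) = ?p u" using w by auto
  qed
  define Q where "Q = map_in_charts ?c d (inv_into V \<pi>)"
  have Q: "Q u = snd d (inv_into V \<pi> (?p u))" if "u \<in> N" for u
    using that N(2) by (auto simp: Q_def map_in_charts_def inv_quotient_chart[OF U(1)])
  have invQ: "inv_into (fst d) (snd d) (Q u) = inv_into V \<pi> (?p u)" if "u \<in> N" for u
    using lift(1)[OF that] inj_d by (simp add: Q[OF that] W_def)
  have "N \<subseteq> map_dom_in_charts ?c d U1 (inv_into V \<pi>)"
  proof
    fix u assume u: "u \<in> N"
    then have "u \<in> U" using N by blast
    have "\<pi> (inv_into V \<pi> (?p u)) \<in> \<pi> ` W" using lift(1)[OF u] by (rule imageI)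
    then have "?p u \<in> U1" using W(2) lift(2)[OF u] by auto
    then have "?p u \<in> fst ?c \<inter> U1 \<inter> inv_into V \<pi> -` fst d"
      using lift(1)[OF u] \<open>u \<in> U\<close> by (simp add: W_def)
    then show "u \<in> map_dom_in_charts ?c d U1 (inv_into V \<pi>)"
      unfolding map_dom_in_charts_def
      by (rule image_eqI[rotated]) (simp add: snd_quotient_chart[OF U(1) \<open>u \<in> U\<close>])
  qed
  moreover have "holomorphic_map_on (map_dom_in_charts ?c d U1 (inv_into V \<pi>)) Q"
    using hol_inv cX d(1) unfolding holomorphic_on_manifold_def Q_def by blast
  ultimately have hol_Q: "holomorphic_map_on N Q"
    unfolding holomorphic_map_on_def smooth_on_def by (meson Ck_on_subset subsetD)
  define T where "T = snd d ` fst d"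
  define \<phi> where "\<phi> = fun_in_chart d f"
  have T: "open T" "Q ` N \<subseteq> T"
    using d'(2) lift(1) by (auto simp: T_def Q W_def)
  have smooth_\<phi>: "smooth_on T \<phi>"
    using pot d(1) unfolding lck_potential_def T_def \<phi>_def by blast
  define F where "F u = \<phi> (Q u)" for u
  have CQ: "Ck_on k N Q" for k
    using hol_Q by (simp add: holomorphic_map_on_def smooth_on_def)
  have C\<phi>: "Ck_on k T \<phi>" for k
    using smooth_\<phi> by (simp add: smooth_on_def)
  have "smooth_on N F"
    unfolding smooth_on_def F_def using Ck_on_compose[OF N(1) T(1,2) CQ C\<phi>] by (rule allI)
  moreover have "F u > 0" if "u \<in> N" for u
  proof -
    have "inv_into V \<pi> (?p u) \<in> topspace (mtop Y)"
      using lift(1)[OF that] openin_subset[OF Vop] by (auto simp: W_def)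
    then show ?thesis
      using pot by (simp add: F_def \<phi>_def fun_in_chart_def invQ[OF that] lck_potential_def)
  qed
  moreover have "dd_c F u a b = F u * fundamental_form g ?c u a b" if u: "u \<in> N" for u a b
  proof -
    define P where "P = map_in_charts d ?c \<pi>"
    have PQ: "P (Q y) = y" if "y \<in> N" for y
      using that N(2) by (auto simp: P_def map_in_charts_def invQ lift(2) intro!: snd_quotient_chart[OF U(1)])
    have dom: "Q u \<in> map_dom_in_charts d ?c V \<pi>"
      using lift[OF u] u N(2) unfolding map_dom_in_charts_def
      by (intro image_eqI[of _ _ "inv_into V \<pi> (?p u)"]) (auto simp: Q W_def)
    then have dom': "Q u \<in> map_dom_in_charts d ?c UNIV \<pi>"
      unfolding map_dom_in_charts_def by blast
    have "holomorphic_map_on (map_dom_in_charts d ?c V \<pi>) P"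
      using hol_\<pi> cX d(1) unfolding holomorphic_on_manifold_def P_def by blast
    then have "Ck_on (Suc 0) (map_dom_in_charts d ?c V \<pi>) P"
      by (simp add: holomorphic_map_on_def smooth_on_def del: Ck_on.simps)
    note dP = Ck_on_has_derivative[OF this dom]
    have "Ck_on (Suc 0) N Q"
      using hol_Q by (simp add: holomorphic_map_on_def smooth_on_def del: Ck_on.simps)
    note dQ = Ck_on_has_derivative[OF this u]
    have "((\<lambda>y. P (Q y)) has_derivative (\<lambda>a. pd (pd a Q u) P (Q u))) (at u)"
      by (rule has_derivative_compose[OF dQ dP])
    moreover have "((\<lambda>y. P (Q y)) has_derivative (\<lambda>a. a)) (at u)"
      by (rule has_derivative_transform_within_open[OF has_derivative_ident N(1) u]) (simp add: PQ)
    ultimately have id: "pd (pd a Q u) P (Q u) = a" for a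
      by (metis has_derivative_unique)
    have "dd_c F u a b = dd_c \<phi> (Q u) (pd a Q u) (pd b Q u)"
      unfolding F_def
      by (rule dd_c_compose[OF _ T(1) N(1) u T(2) hol_Q]) (use smooth_\<phi> in \<open>simp add: smooth_on_def\<close>)
    moreover have "pullback2 P (fundamental_form g ?c) (Q u) (pd a Q u) (pd b Q u)
        = dd_c \<phi> (Q u) (pd a Q u) (pd b Q u) / \<phi> (Q u)"
      using pot d(1) cX dom' unfolding lck_potential_def P_def \<phi>_def by blast
    ultimately show ?thesis
      using \<open>u \<in> N \<Longrightarrow> F u > 0\<close> u by (simp add: pullback2_def id PQ F_def)
  qed
  ultimately show ?thesis using N vN by blast
qed

text \<open>The logarithm \<open>h\<close> of the global potential is a primitive of minus the Lee form.\<close>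

theorem lck_potential_on_domain:
  fixes \<Omega> :: "(complex^2) set"
  assumes \<Omega>: "open \<Omega>" "convex \<Omega>"
    and S: "\<And>s. s \<in> S \<Longrightarrow> bij_betw s \<Omega> \<Omega>"
    and affine: "\<And>s. s \<in> S \<Longrightarrow> \<exists>L k. bounded_linear L \<and> (\<forall>x. s x = L x + k)"
    and charts: "\<And>v. v \<in> \<Omega> \<Longrightarrow> \<exists>U. chart_domain \<Omega> (generated_by \<Omega> S) U \<and> v \<in> U"
    and lck: "lck_metric_with_potential TYPE('b) (quotient_manifold \<Omega> (generated_by \<Omega> S)) g"
  shows "\<exists>h :: complex^2 \<Rightarrow> real. continuous_on \<Omega> h \<and> (\<forall>s\<in>S. \<exists>c. \<forall>v\<in>\<Omega>. h (s v) = h v + c) \<and>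
    (\<forall>v\<in>\<Omega>. \<forall>e. e \<noteq> 0 \<longrightarrow> (\<exists>c. v + c *s e \<in> \<Omega> \<and> h v < h (v + c *s e)))"
proof -
  define G where "G = generated_by \<Omega> S"
  define X where "X = quotient_manifold \<Omega> G"
  define \<omega> where "\<omega> U = fundamental_form g (quotient_chart G U)" for U
  obtain Y :: "('b, 2) cmanifold" and \<pi> f where cov: "holomorphic_covering Y X \<pi>"
    and pot: "lck_potential X g Y \<pi> f"
    using lck unfolding lck_metric_with_potential_def X_def G_def by blast
  have herm: "hermitian_metric X g" and "\<exists>\<theta>. one_form X \<theta> \<and>
        (\<forall>c\<in>atlas X. \<forall>x\<in>snd c ` fst c.
           (\<forall>u v. ext_d1 (\<theta> c) x u v = 0) \<and>
           (\<forall>u v w. ext_d2 (fundamental_form g c) x u v w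
                      = wedge12 (\<theta> c) (fundamental_form g c) x u v w))"
    using lck unfolding lck_metric_with_potential_def lck_metric_def X_def G_def by auto
  then obtain \<theta> where \<theta>: "one_form X \<theta>"
    and \<theta>': "\<And>c x. c \<in> atlas X \<Longrightarrow> x \<in> snd c ` fst c \<Longrightarrow>
           (\<forall>u v. ext_d1 (\<theta> c) x u v = 0) \<and>
           (\<forall>u v w. ext_d2 (fundamental_form g c) x u v w
                      = wedge12 (\<theta> c) (fundamental_form g c) x u v w)" by metis
  have chart: "quotient_chart G U \<in> atlas X" "snd (quotient_chart G U) ` fst (quotient_chart G U) = U"
    if "chart_domain \<Omega> G U" for U
    using that by (auto simp: X_def atlas_quotient_manifold quotient_chart_image)
  define \<theta>U where "\<theta>U U = \<theta> (quotient_chart G U)" for U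
  have \<theta>_chart: "\<forall>x\<in>snd c ` fst c. linear (\<theta> c x)" "\<forall>u. smooth_on (snd c ` fst c) (\<lambda>x. \<theta> c x u)"
    if "c \<in> atlas X" for c
    using \<theta> that unfolding one_form_def by blast+
  have lin: "linear (\<theta>U U x)" if "chart_domain \<Omega> G U" "x \<in> U" for U x
    using \<theta>_chart(1)[OF chart(1)[OF that(1)]] that(2) unfolding chart(2)[OF that(1)] \<theta>U_def by blast
  have smooth: "smooth_on U (\<lambda>x. \<theta>U U x u)" if "chart_domain \<Omega> G U" for U u
    using \<theta>_chart(2)[OF chart(1)[OF that]] unfolding chart(2)[OF that] \<theta>U_def by blast
  have closed: "ext_d1 (\<theta>U U) x u v = 0" if "chart_domain \<Omega> G U" "x \<in> U" for U x u v
    using \<theta>'[OF chart(1)[OF that(1)]] chart(2)[OF that(1)] that(2) by (simp add: \<theta>U_def)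
  have Lee: "ext_d2 (\<omega> U) x u v w = wedge12 (\<theta>U U) (\<omega> U) x u v w"
    if "chart_domain \<Omega> G U" "x \<in> U" for U x u v w
    using \<theta>'[OF chart(1)[OF that(1)]] chart(2)[OF that(1)] that(2) by (simp add: \<theta>U_def \<omega>_def)
  have g_chart: "\<forall>x\<in>snd c ` fst c. bilinear (g c x) \<and> (\<forall>u v. g c x u v = g c x v u) \<and>
        (\<forall>u. u \<noteq> 0 \<longrightarrow> g c x u u > 0) \<and> (\<forall>u v. g c x (\<i> *s u) (\<i> *s v) = g c x u v)"
      "\<forall>u v. smooth_on (snd c ` fst c) (\<lambda>x. g c x u v)" if "c \<in> atlas X" for c
    using herm that unfolding hermitian_metric_def covariant_2_tensor_def by blast+
  have g_pointwise: "bilinear (g (quotient_chart G U) x) \<and>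
        (\<forall>u v. g (quotient_chart G U) x u v = g (quotient_chart G U) x v u) \<and>
        (\<forall>u. u \<noteq> 0 \<longrightarrow> g (quotient_chart G U) x u u > 0) \<and>
        (\<forall>u v. g (quotient_chart G U) x (\<i> *s u) (\<i> *s v) = g (quotient_chart G U) x u v)"
    if "chart_domain \<Omega> G U" "x \<in> U" for U x
    using g_chart(1)[OF chart(1)[OF that(1)]] that(2) unfolding chart(2)[OF that(1)] by blast
  have g_smooth: "\<forall>u v. smooth_on U (\<lambda>x. g (quotient_chart G U) x u v)" if "chart_domain \<Omega> G U" for U
    using g_chart(2)[OF chart(1)[OF that]] unfolding chart(2)[OF that] .
  have inv: "\<theta>U U v u = \<theta>U U' (\<gamma> v) (L u)"
    if "chart_domain \<Omega> G U" "chart_domain \<Omega> G U'" "open N" "v \<in> N" "N \<subseteq> U" "\<gamma> ` N \<subseteq> U'"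
      "\<And>y. y \<in> N \<Longrightarrow> orbit_of G (\<gamma> y) = orbit_of G y" "(\<gamma> has_derivative L) (at v)"
    for U U' N v u \<gamma> L
    unfolding \<theta>U_def by (rule one_form_quotient_invariant[OF \<theta>[unfolded X_def] that])
  have indep: "\<theta>U U v u = \<theta>U U' v u"
    if "chart_domain \<Omega> G U" "chart_domain \<Omega> G U'" "v \<in> U" "v \<in> U'" for U U' v u
  proof -
    have "open (U \<inter> U')" using that by (auto simp: chart_domain_def)
    then show ?thesis
      using inv[OF that(1,2), of "U \<inter> U'" v "\<lambda>x. x" "\<lambda>x. x" u] that by auto
  qed
  \<comment> \<open>a choice of charts; by \<open>indep\<close> the form \<open>\<eta>\<close> below does not depend on it\<close>
  define UU where "UU v = (SOME U. chart_domain \<Omega> G U \<and> v \<in> U)" for v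
  have UU: "chart_domain \<Omega> G (UU v)" "v \<in> UU v" if "v \<in> \<Omega>" for v
    using someI_ex[OF charts[OF that]] by (auto simp: UU_def G_def)
  define \<eta> where "\<eta> v u = - \<theta>U (UU v) v u" for v u
  have \<eta>: "\<eta> v u = - \<theta>U U v u" if "chart_domain \<Omega> G U" "v \<in> U" for U v u
  proof -
    have "v \<in> \<Omega>" using that by (auto simp: chart_domain_def)
    then show ?thesis using indep[OF UU(1) that(1) UU(2) that(2)] by (simp add: \<eta>_def)
  qed
  have \<eta>_smooth: "Ck_on k U (\<lambda>x. \<eta> x u)" if "chart_domain \<Omega> G U" for k U u
  proof (rule Ck_on_cong)
    show "open U" using that by (simp add: chart_domain_def)
    show "Ck_on k U (\<lambda>x. - \<theta>U U x u)"
      using smooth[OF that] \<open>open U\<close>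
      by (intro Ck_on_bounded_linear[of U uminus]) (auto simp: smooth_on_def bounded_linear_minus bounded_linear_ident)
    show "- \<theta>U U x u = \<eta> x u" if "x \<in> U" for x using \<eta> \<open>chart_domain \<Omega> G U\<close> that by simp
  qed
  have "\<exists>h. \<forall>x\<in>\<Omega>. \<forall>u. ((\<lambda>r. h (x + r *\<^sub>R u)) has_real_derivative \<eta> x u) (at 0)"
  proof (rule Poincare_convex[OF \<Omega>])
    fix x assume x: "x \<in> \<Omega>"
    define U where "U = UU x"
    have U: "chart_domain \<Omega> G U" "x \<in> U" "open U"
      using UU[OF x] by (auto simp: U_def chart_domain_def)
    have "linear (\<lambda>u. - \<theta>U U x u)"
      using lin[OF U(1,2)] by (rule linear_compose_neg)
    moreover have "\<eta> x = (\<lambda>u. - \<theta>U U x u)" using \<eta>[OF U(1,2)] by (rule ext)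
    ultimately show "linear (\<eta> x)" by (simp only:)
    fix u v
    have "pd a (\<lambda>y. \<eta> y b) x = - pd a (\<lambda>y. \<theta>U U y b) x" for a b
    proof (rule pd_eqI[where F' = "\<lambda>a. - pd a (\<lambda>y. \<theta>U U y b) x"],
        rule has_derivative_transform_within_open[OF _ U(3,2)])
      have "Ck_on (Suc 0) U (\<lambda>y. \<theta>U U y b)"
        using smooth[OF U(1)] by (simp add: smooth_on_def del: Ck_on.simps)
      then show "((\<lambda>y. - \<theta>U U y b) has_derivative (\<lambda>a. - pd a (\<lambda>y. \<theta>U U y b) x)) (at x)"
        by (intro has_derivative_minus Ck_on_has_derivative[OF _ U(2)])
    qed (simp add: \<eta>[OF U(1)])
    then show "pd u (\<lambda>y. \<eta> y v) x = pd v (\<lambda>y. \<eta> y u) x"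
      using closed[OF U(1,2), of u v] by (simp add: ext_d1_def)
  next
    show "Ck_on 1 \<Omega> (\<lambda>x. \<eta> x u)" for u
    proof (rule Ck_on_local)
      show "\<exists>T. open T \<and> x \<in> T \<and> Ck_on 1 T (\<lambda>x. \<eta> x u)" if "x \<in> \<Omega>" for x
        using UU[OF that] \<eta>_smooth[OF UU(1)[OF that]] by (meson chart_domain_def)
    qed
  qed
  then obtain h where h: "\<And>x u. x \<in> \<Omega> \<Longrightarrow> ((\<lambda>r. h (x + r *\<^sub>R u)) has_real_derivative \<eta> x u) (at 0)"
    by blast
  have local: "\<exists>B F k. open B \<and> v \<in> B \<and> B \<subseteq> U \<and> smooth_on B F \<and>
      (\<forall>y\<in>B. F y = exp (h y + k) \<and> (\<forall>a b. dd_c F y a b = F y * \<omega> U y a b))"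
    if U: "chart_domain \<Omega> G U" "v \<in> U" for U v
  proof -
    obtain N F where N: "open N" "v \<in> N" "N \<subseteq> U" and F: "smooth_on N F" "\<And>y. y \<in> N \<Longrightarrow> F y > 0"
      and ddF: "\<And>y a b. y \<in> N \<Longrightarrow> dd_c F y a b = F y * \<omega> U y a b"
      using local_lck_potential[OF \<Omega>(1) U cov[unfolded X_def] pot[unfolded X_def]]
      unfolding \<omega>_def by metis
    have NU: "y \<in> U" "y \<in> \<Omega>" if "y \<in> N" for y
      using that N(3) U(1) by (auto simp: chart_domain_def)
    have dF: "pd u F y = F y * \<eta> y u" if y: "y \<in> N" for y u
    proof -
      have g: "bilinear (g (quotient_chart G U) y)"
        "g (quotient_chart G U) y a b = g (quotient_chart G U) y b a"
        "a \<noteq> 0 \<Longrightarrow> g (quotient_chart G U) y a a > 0"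
        "g (quotient_chart G U) y (\<i> *s a) (\<i> *s b) = g (quotient_chart G U) y a b"
        "smooth_on U (\<lambda>y. g (quotient_chart G U) y a b)" for a b
        using g_pointwise[OF U(1) NU(1)[OF y]] g_smooth[OF U(1)] by blast+
      have diff: "(\<lambda>y. \<omega> U y a b) differentiable (at y)" for a b
      proof -
        have "Ck_on (Suc 0) U (\<lambda>y. g (quotient_chart G U) y (\<i> *s a) b)"
          using g(5) by (simp add: smooth_on_def del: Ck_on.simps)
        then show ?thesis using NU(1)[OF y] by (simp add: \<omega>_def fundamental_form_def)
      qed
      have "Ck_on 3 N F" using F(1) by (simp add: smooth_on_def)
      from Lee_form_eq_dlog_potential[OF N(1) y this F(2)[OF y], of "g (quotient_chart G U)" "\<omega> U" "\<theta>U U" u]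
      show ?thesis
        using g diff ddF Lee[OF U(1) NU(1)[OF y]] \<eta>[OF U(1) NU(1)[OF y]]
        by (simp add: \<omega>_def fundamental_form_def)
    qed
    obtain \<epsilon> where \<epsilon>: "\<epsilon> > 0" "ball v \<epsilon> \<subseteq> N" using N(1,2) openE by blast
    have "ln (F y) - h y = ln (F v) - h v" if "y \<in> ball v \<epsilon>" for y
    proof (rule constant_if_directional_derivatives_vanish[of "ball v \<epsilon>"])
      fix z u assume "z \<in> ball v \<epsilon>"
      then have z: "z \<in> N" using \<epsilon> by blast
      have "Ck_on (Suc 0) N F" using F(1) by (simp add: smooth_on_def del: Ck_on.simps)
      from Ck_on_has_derivative[OF this z]
      have "(F has_derivative frechet_derivative F (at z)) (at (z + 0 *\<^sub>R u))" by simp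
      from line_has_real_derivative[OF this] 
      have "((\<lambda>r. ln (F (z + r *\<^sub>R u))) has_real_derivative pd u F z / F z) (at 0)"
        using F(2)[OF z] by (auto intro!: derivative_eq_intros simp: field_simps)
      moreover have "pd u F z / F z = \<eta> z u"
        using dF[OF z] F(2)[OF z] by simp
      ultimately have "((\<lambda>r. ln (F (z + r *\<^sub>R u))) has_real_derivative \<eta> z u) (at 0)"
        by (simp only:)
      from DERIV_diff[OF this h[OF NU(2)[OF z], of u]]
      show "((\<lambda>r. ln (F (z + r *\<^sub>R u)) - h (z + r *\<^sub>R u)) has_real_derivative 0) (at 0)"
        by (simp only: diff_self)
    qed (use \<epsilon> that in auto)
    then have F_exp: "F y = exp (h y + (ln (F v) - h v))" if "y \<in> ball v \<epsilon>" for y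
      using that F(2)[of y] \<epsilon>(2) by (smt (verit) exp_ln subsetD)
    have F_smooth: "smooth_on (ball v \<epsilon>) F"
      using F(1) \<epsilon>(2) unfolding smooth_on_def by (meson Ck_on_subset)
    have "\<forall>y\<in>ball v \<epsilon>. F y = exp (h y + (ln (F v) - h v)) \<and> (\<forall>a b. dd_c F y a b = F y * \<omega> U y a b)"
      using F_exp ddF \<epsilon>(2) by blast
    moreover have "open (ball v \<epsilon>)" "v \<in> ball v \<epsilon>" "ball v \<epsilon> \<subseteq> U"
      using \<epsilon> N(3) by auto
    ultimately show ?thesis using F_smooth by blast
  qed
  have h_cont: "continuous_on \<Omega> h"
  proof -
    have "Ck_on 0 \<Omega> h"
    proof (rule Ck_on_local)
      fix v assume "v \<in> \<Omega>"
      then obtain B F k where B: "open B" "v \<in> B" "smooth_on B F" "\<forall>y\<in>B. F y = exp (h y + k)"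
        using local[OF UU] by metis
      have "continuous_on B (\<lambda>y. ln (F y) - k)"
        using B by (intro continuous_intros) (auto simp: smooth_on_def dest: spec[of _ 0])
      then have "continuous_on B h"
        using B(4) by (simp cong: continuous_on_cong)
      then show "\<exists>T. open T \<and> v \<in> T \<and> Ck_on 0 T h" using B by auto
    qed
    then show ?thesis by simp
  qed
  have h_auto: "\<exists>c. \<forall>v\<in>\<Omega>. h (s v) = h v + c" if s: "s \<in> S" for s
  proof (cases "\<Omega> = {}")
    case False
    then obtain p where p: "p \<in> \<Omega>" by blast
    obtain L k where L: "bounded_linear L" "\<And>x. s x = L x + k" using affine[OF s] by blast
    have ds: "(s has_derivative L) (at x)" for x
    proof -
      have "((\<lambda>x. L x + k) has_derivative L) (at x)"
        using has_derivative_add[OF bounded_linear_imp_has_derivative[OF L(1)] has_derivative_const[of k]]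
        by simp
      then show ?thesis using L(2) by (simp add: ext[of s "\<lambda>x. L x + k"])
    qed
    have "h (s v) - h v = h (s p) - h p" if v: "v \<in> \<Omega>" for v
    proof (rule constant_if_directional_derivatives_vanish[OF \<Omega>(2) v p])
      fix x u assume x: "x \<in> \<Omega>"
      have sx: "s x \<in> \<Omega>" using bij_betwE[OF S[OF s]] x by blast
      let ?U = "UU x" and ?U' = "UU (s x)"
      have U: "open ?U" "open ?U'" using UU(1)[OF x] UU(1)[OF sx] by (auto simp: chart_domain_def)
      have conts: "continuous_on UNIV s"
        using ds has_derivative_continuous by (blast intro: continuous_at_imp_continuous_on)
      have "\<theta>U ?U x u = \<theta>U ?U' (s x) (L u)"
      proof (rule inv[OF UU(1)[OF x] UU(1)[OF sx], of "?U \<inter> s -` ?U'"])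
        show "open (?U \<inter> s -` ?U')"
          using U conts by (intro open_Int) (auto intro: open_vimage)
        show "orbit_of G (s y) = orbit_of G y" if "y \<in> ?U \<inter> s -` ?U'" for y
          using orbit_of_generator[OF S s, of y] that UU(1)[OF x] unfolding G_def chart_domain_def by blast
      qed (use UU(2)[OF x] UU(2)[OF sx] ds in auto)
      then have "\<eta> (s x) (L u) = \<eta> x u" by (simp add: \<eta>_def)
      then have "((\<lambda>r. h (s x + r *\<^sub>R L u)) has_real_derivative \<eta> x u) (at 0)"
        using h[OF sx, of "L u"] by simp
      moreover have "s x + r *\<^sub>R L u = s (x + r *\<^sub>R u)" for r
        using L by (simp add: linear_add linear_cmul bounded_linear.linear)
      ultimately have "((\<lambda>r. h (s (x + r *\<^sub>R u))) has_real_derivative \<eta> x u) (at 0)" by simp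
      from DERIV_diff[OF this h[OF x, of u]]
      show "((\<lambda>r. h (s (x + r *\<^sub>R u)) - h (x + r *\<^sub>R u)) has_real_derivative 0) (at 0)" by simp
    qed
    then have "\<forall>v\<in>\<Omega>. h (s v) = h v + (h (s p) - h p)" by (simp add: algebra_simps)
    then show ?thesis by blast
  qed simp
  have h_inc: "\<exists>c. v + c *s e \<in> \<Omega> \<and> h v < h (v + c *s e)" if v: "v \<in> \<Omega>" and e: "e \<noteq> 0" for v e
  proof (rule ccontr)
    assume "\<not> ?thesis"
    then have max: "h (v + c *s e) \<le> h v" if "v + c *s e \<in> \<Omega>" for c using that by force
    let ?U = "UU v"
    note U = UU[OF v]
    obtain B F k where B: "open B" "v \<in> B" "B \<subseteq> ?U" "smooth_on B F"
      and F: "\<And>y. y \<in> B \<Longrightarrow> F y = exp (h y + k)"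
      and ddF: "\<And>y a b. y \<in> B \<Longrightarrow> dd_c F y a b = F y * \<omega> ?U y a b"
      using local[OF U] by metis
    have "dd_c F v e (\<i> *s e) \<le> 0"
    proof (rule dd_c_nonpos_at_maximum[OF _ B(1,2)])
      show "Ck_on 2 B F" using B(4) by (simp add: smooth_on_def)
      fix c assume c: "v + c *s e \<in> B"
      moreover from c have "v + c *s e \<in> \<Omega>" using B(3) U(1) by (auto simp: chart_domain_def)
      ultimately show "F (v + c *s e) \<le> F v" using max F B(2) by simp
    qed
    moreover have "g (quotient_chart G ?U) v (\<i> *s e) (\<i> *s e) > 0"
    proof -
      have "\<i> *s e \<noteq> 0" using e by (auto simp: vec_eq_iff)
      then show ?thesis using g_pointwise[OF U] by blast
    qed
    then have "dd_c F v e (\<i> *s e) > 0"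
      using ddF[OF B(2)] F[OF B(2)] by (simp add: \<omega>_def fundamental_form_def)
    ultimately show False by simp
  qed
  show ?thesis
    by (intro exI[of _ h] conjI ballI allI impI h_cont) (rule h_auto h_inc; assumption)+
qed

section \<open>Triangular affine automorphisms of \<open>\<complex> \<times> \<H>\<close>\<close>

text \<open>The generators of the three groups, and the products that occur, are all of this form with \<open>p \<noteq> 0\<close> and
  \<open>s > 0\<close>.\<close>

definition tri :: "complex \<Rightarrow> complex \<Rightarrow> complex \<Rightarrow> real \<Rightarrow> real \<Rightarrow> complex^2 \<Rightarrow> complex^2" where
  "tri p q r s t v = vector [p * v $ 1 + q * v $ 2 + r, of_real s * v $ 2 + of_real t]"

lemma tri_nth [simp]:
  "tri p q r s t v $ 1 = p * v $ 1 + q * v $ 2 + r"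
  "tri p q r s t v $ 2 = of_real s * v $ 2 + of_real t"
  by (simp_all add: tri_def)

lemma tri_id: "tri 1 0 0 1 0 v = v"
  by (simp add: vec_eq_iff forall_2)

lemma tri_tri:
  "tri p q r s t (tri p' q' r' s' t' v)
     = tri (p * p') (p * q' + q * of_real s') (p * r' + q * of_real t' + r) (s * s') (s * t' + t) v"
  by (simp add: vec_eq_iff forall_2 algebra_simps)

lemma Im_tri [simp]: "Im (tri p q r s t v $ 2) = s * Im (v $ 2)"
  by simp

lemma bij_betw_tri:
  assumes "p \<noteq> 0" "s > 0"
  shows "bij_betw (tri p q r s t) CxH CxH"
proof (rule bij_betw_byWitness[where f' = "tri (1/p) (-q / (p * of_real s)) ((q * of_real (t/s) - r) / p) (1/s) (-t/s)"])
  show "\<forall>a\<in>CxH. tri (1/p) (-q / (p * of_real s)) ((q * of_real (t/s) - r) / p) (1/s) (-t/s) (tri p q r s t a) = a"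
    using assms by (auto simp: vec_eq_iff forall_2 field_simps)
  show "\<forall>a\<in>CxH. tri p q r s t (tri (1/p) (-q / (p * of_real s)) ((q * of_real (t/s) - r) / p) (1/s) (-t/s) a) = a"
    using assms by (auto simp: vec_eq_iff forall_2 field_simps)
  show "tri p q r s t ` CxH \<subseteq> CxH" using assms by (auto simp: CxH_def)
  show "tri (1/p) (-q / (p * of_real s)) ((q * of_real (t/s) - r) / p) (1/s) (-t/s) ` CxH \<subseteq> CxH"
    using assms by (auto simp: CxH_def)
qed

lemma tri_affine: "\<exists>L k. bounded_linear L \<and> (\<forall>x. tri p q r s t x = L x + k)"
proof (intro exI conjI allI)
  show "bounded_linear (tri p q 0 s 0)"
    by (rule linear_conv_bounded_linear[THEN iffD1], rule linearI)
       (simp_all add: vec_eq_iff forall_2 algebra_simps)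
  show "tri p q r s t x = tri p q 0 s 0 x + vector [r, of_real t]" for x
    by (simp add: vec_eq_iff forall_2)
qed

lemma open_CxH: "open CxH"
  unfolding CxH_def by (intro open_Collect_less continuous_intros)

lemma convex_CxH: "convex CxH"
  unfolding CxH_def convex_def by (auto intro!: add_nonneg_pos add_pos_nonneg simp: less_le)
    (smt (verit) mult_nonneg_nonneg mult_pos_pos)

definition slice :: "real \<Rightarrow> (complex^2) set" where
  "slice t = {v. Im (v $ 2) = t}"

text \<open>A maximum on the hypersurface \<open>Im w = 1\<close> is also a maximum on a complex line \<open>w = const\<close>, on which the
  logarithm of a potential has none.\<close>

lemma no_lck_potential_if_max_on_slice:
  assumes tri: "\<And>s. s \<in> S \<Longrightarrow> \<exists>p q r \<sigma> t. s = tri p q r \<sigma> t \<and> p \<noteq> 0 \<and> \<sigma> > 0"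
    and charts: "\<And>v. v \<in> CxH \<Longrightarrow> \<exists>U. chart_domain CxH (generated_by CxH S) U \<and> v \<in> U"
    and max: "\<And>h. continuous_on CxH h \<Longrightarrow> (\<And>s. s \<in> S \<Longrightarrow> \<exists>c. \<forall>v\<in>CxH. h (s v) = h v + c) \<Longrightarrow>
      \<exists>k\<in>slice 1. \<forall>v\<in>slice 1. h v \<le> (h k :: real)"
  shows "\<not> (\<exists>g. lck_metric_with_potential TYPE('b) (quotient_manifold CxH (generated_by CxH S)) g)"
proof
  assume "\<exists>g. lck_metric_with_potential TYPE('b) (quotient_manifold CxH (generated_by CxH S)) g"
  then obtain g where g: "lck_metric_with_potential TYPE('b) (quotient_manifold CxH (generated_by CxH S)) g"
    by blast
  have bij: "bij_betw s CxH CxH" if "s \<in> S" for s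
    using tri[OF that] bij_betw_tri by blast
  have aff: "\<exists>L k. bounded_linear L \<and> (\<forall>x. s x = L x + k)" if "s \<in> S" for s
    using tri[OF that] tri_affine by blast
  from lck_potential_on_domain[OF open_CxH convex_CxH bij aff charts g]
  obtain h :: "complex^2 \<Rightarrow> real" where h: "continuous_on CxH h" "\<forall>s\<in>S. \<exists>c. \<forall>v\<in>CxH. h (s v) = h v + c"
    and inc: "\<And>v e. v \<in> CxH \<Longrightarrow> e \<noteq> 0 \<Longrightarrow> \<exists>c. v + c *s e \<in> CxH \<and> h v < h (v + c *s e)"
    by blast
  obtain v where v: "v \<in> slice 1" "\<And>w. w \<in> slice 1 \<Longrightarrow> h w \<le> h v"
    using max[OF h(1)] h(2) by blast
  have "axis 1 1 \<noteq> (0 :: complex^2)" by simp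
  then obtain c where "h v < h (v + c *s axis 1 1)"
    using inc[of v "axis 1 1"] v(1) by (auto simp: CxH_def slice_def)
  moreover have "h (v + c *s axis 1 1) \<le> h v"
    by (rule v(2)) (use v(1) in \<open>simp add: axis_def slice_def\<close>)
  ultimately show False by simp
qed

section \<open>Discreteness\<close>

lemma conj_power:
  assumes G0: "G0 0 = id" "\<And>m n. G0 (m + n) = G0 m \<circ> G0 (n :: int)"
    and conj: "\<And>k. k \<in> H \<Longrightarrow> \<exists>k'\<in>H. G0 1 \<circ> k = k' \<circ> G0 1"
      "\<And>k. k \<in> H \<Longrightarrow> \<exists>k'\<in>H. G0 (-1) \<circ> k = k' \<circ> G0 (-1)"
    and "k \<in> H"
  shows "\<exists>k'\<in>H. G0 n \<circ> k = k' \<circ> G0 n"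
proof (induction n rule: int_induct[where k = 0])
  case base
  then show ?case using assms by auto
next
  case (step1 i)
  then obtain k' where k': "k' \<in> H" "G0 i \<circ> k = k' \<circ> G0 i" by blast
  obtain k'' where k'': "k'' \<in> H" "G0 1 \<circ> k' = k'' \<circ> G0 1" using conj(1)[OF k'(1)] by blast
  have e: "G0 (i + 1) = G0 1 \<circ> G0 i" using G0(2)[of 1 i] by (simp add: add.commute)
  have "G0 (i + 1) \<circ> k = (G0 1 \<circ> k') \<circ> G0 i" unfolding e comp_assoc k'(2) ..
  also have "\<dots> = k'' \<circ> G0 (i + 1)" unfolding k''(2) e comp_assoc ..
  finally show ?case using k'' by blast
next
  case (step2 i)
  then obtain k' where k': "k' \<in> H" "G0 i \<circ> k = k' \<circ> G0 i" by blast
  obtain k'' where k'': "k'' \<in> H" "G0 (-1) \<circ> k' = k'' \<circ> G0 (-1)" using conj(2)[OF k'(1)] by blast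
  have e: "G0 (i - 1) = G0 (-1) \<circ> G0 i" using G0(2)[of "-1" i] by simp
  have "G0 (i - 1) \<circ> k = (G0 (-1) \<circ> k') \<circ> G0 i" unfolding e comp_assoc k'(2) ..
  also have "\<dots> = k'' \<circ> G0 (i - 1)" unfolding k''(2) e comp_assoc ..
  finally show ?case using k'' by blast
qed

text \<open>Here \<open>H\<close> is the subgroup that fixes \<open>Im w\<close>, and the dilation \<open>G0 1\<close> normalises it, so that every element
  of the generated group maps \<open>x\<close> to \<open>k (G0 n x)\<close> with \<open>k \<in> H\<close>. As \<open>G0 n\<close> multiplies \<open>Im w\<close> by \<open>\<alpha> powi n\<close>,
  on a set where \<open>Im w\<close> varies by a factor less than \<open>\<alpha>\<close> only \<open>n = 0\<close> can occur, and local injectivity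
  becomes a property of \<open>H\<close>.\<close>

lemma charts_of_extension_by_dilation:
  fixes S H :: "(complex^2 \<Rightarrow> complex^2) set" and G0 :: "int \<Rightarrow> complex^2 \<Rightarrow> complex^2"
  assumes S: "\<And>s. s \<in> S \<Longrightarrow> bij_betw s CxH CxH"
    and gen: "\<And>s. s \<in> S \<Longrightarrow> s \<in> H \<or> s = G0 1"
    and \<alpha>: "\<alpha> > 1"
    and G0: "G0 0 = id" "\<And>m n. G0 (m + n) = G0 m \<circ> G0 n"
      "\<And>n v. Im (G0 n v $ 2) = \<alpha> powi n * Im (v $ 2)"
    and H: "id \<in> H" "\<And>k k'. k \<in> H \<Longrightarrow> k' \<in> H \<Longrightarrow> k \<circ> k' \<in> H"
      "\<And>k. k \<in> H \<Longrightarrow> \<exists>k'\<in>H. k' \<circ> k = id"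
      "\<And>k v. k \<in> H \<Longrightarrow> Im (k v $ 2) = Im (v $ 2)"
    and conj: "\<And>k. k \<in> H \<Longrightarrow> \<exists>k'\<in>H. G0 1 \<circ> k = k' \<circ> G0 1"
      "\<And>k. k \<in> H \<Longrightarrow> \<exists>k'\<in>H. G0 (-1) \<circ> k = k' \<circ> G0 (-1)"
    and discrete: "\<And>v. v \<in> CxH \<Longrightarrow>
      \<exists>\<epsilon>>0. \<forall>k\<in>H. \<forall>x\<in>ball v \<epsilon>. k x \<in> ball v \<epsilon> \<longrightarrow> k x = x"
    and v: "v \<in> CxH"
  shows "\<exists>U. chart_domain CxH (generated_by CxH S) U \<and> v \<in> U"
proof -
  define R where "R x y \<longleftrightarrow> (\<exists>n. \<exists>k\<in>H. y = k (G0 n x))" for x y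
  have conjn: "\<exists>k'\<in>H. G0 n \<circ> k = k' \<circ> G0 n" if "k \<in> H" for n k
    by (rule conj_power[of G0 H, OF G0(1,2) conj that])
  have R: "R x (h x)" if h: "h \<in> generated_by CxH S" and x: "x \<in> CxH" for h x
  proof (rule generated_by_induct[OF S h x])
    show "R x x" for x
      unfolding R_def using H(1) G0(1) by (metis id_apply)
    show "R x (s x)" if "s \<in> S" for s x
      unfolding R_def using gen[OF that] H(1) G0(1) by (metis id_apply)
    show "R y x" if R: "R x y" for x y
    proof -
      obtain n k where k: "k \<in> H" "y = k (G0 n x)" using R by (auto simp: R_def)
      obtain k' where k': "k' \<in> H" "k' \<circ> k = id" using H(3)[OF k(1)] by blast
      obtain k'' where k'': "k'' \<in> H" "G0 (-n) \<circ> k' = k'' \<circ> G0 (-n)" using conjn[OF k'(1)] by blast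
      have "k' y = G0 n x" using k(2) k'(2) by (metis comp_apply id_apply)
      then have "G0 (-n) (k' y) = x" using G0(1) G0(2)[of "-n" n] by (simp add: fun_eq_iff)
      then have "x = k'' (G0 (-n) y)" using k''(2) by (metis comp_apply)
      then show ?thesis using k''(1) by (auto simp: R_def)
    qed
    show "R x z" if "R x y" "R y z" for x y z
    proof -
      obtain n k where k: "k \<in> H" "y = k (G0 n x)" using \<open>R x y\<close> by (auto simp: R_def)
      obtain m l where l: "l \<in> H" "z = l (G0 m y)" using \<open>R y z\<close> by (auto simp: R_def)
      obtain k' where k': "k' \<in> H" "G0 m \<circ> k = k' \<circ> G0 m" using conjn[OF k(1)] by blast
      have "z = (l \<circ> k') (G0 (m + n) x)" using k(2) l(2) k'(2) by (metis G0(2) comp_apply)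
      then show ?thesis using H(2)[OF l(1) k'(1)] unfolding R_def by blast
    qed
  qed
  obtain \<epsilon> where \<epsilon>: "\<epsilon> > 0" "\<And>k x. k \<in> H \<Longrightarrow> x \<in> ball v \<epsilon> \<Longrightarrow> k x \<in> ball v \<epsilon> \<Longrightarrow> k x = x"
    using discrete[OF v] by blast
  define T where "T = Im (v $ 2)"
  define \<sigma> where "\<sigma> = sqrt \<alpha>"
  have T: "T > 0" using v by (simp add: T_def CxH_def)
  have \<sigma>: "\<sigma> > 1" "\<sigma> * \<sigma> = \<alpha>" using \<alpha> by (auto simp: \<sigma>_def)
  \<comment> \<open>on \<open>U\<close> the quotient of two values of \<open>Im w\<close> is less than \<open>\<sigma> * \<sigma> = \<alpha>\<close>\<close>
  define U where "U = ball v \<epsilon> \<inter> {x. T / \<sigma> < Im (x $ 2)} \<inter> {x. Im (x $ 2) < T * \<sigma>}"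
  have inj: "inj_on (orbit_of (generated_by CxH S)) U"
  proof (rule inj_onI)
    fix x y assume xy: "x \<in> U" "y \<in> U"
      "orbit_of (generated_by CxH S) x = orbit_of (generated_by CxH S) y"
    have pos: "T / \<sigma> > 0" using T \<sigma> by simp
    have "x \<in> CxH" "y \<in> CxH" using xy pos by (auto simp: U_def CxH_def)
    then have "y \<in> orbit_of (generated_by CxH S) x"
      using mem_orbit_of_self[of y CxH S] xy(3) by simp
    then obtain h where "h \<in> generated_by CxH S" "y = h x" by (auto simp: orbit_of_def)
    then have "R x y" using R[OF _ \<open>x \<in> CxH\<close>] by blast
    then obtain n k where k: "k \<in> H" "y = k (G0 n x)" by (auto simp: R_def)
    have Im: "Im (y $ 2) = \<alpha> powi n * Im (x $ 2)" using H(4)[OF k(1)] G0(3) by (simp add: k(2))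
    have far: False if "a \<in> U" "b \<in> U" "Im (b $ 2) = \<alpha> powi m * Im (a $ 2)" "m \<ge> 1" for a b m
    proof -
      have "\<alpha> powi 1 \<le> \<alpha> powi m" using \<alpha> \<open>m \<ge> 1\<close> by (intro power_int_increasing) auto
      then have "\<alpha> * Im (a $ 2) \<le> Im (b $ 2)"
        using that(1,3) pos by (auto simp: U_def intro!: mult_right_mono)
      moreover have "\<alpha> * (T / \<sigma>) < \<alpha> * Im (a $ 2)"
        using that(1) \<alpha> by (intro mult_strict_left_mono) (auto simp: U_def)
      moreover have "\<alpha> * (T / \<sigma>) = T * \<sigma>" using \<sigma> by (simp add: \<sigma>(2)[symmetric])
      ultimately show False using that(2) by (auto simp: U_def)
    qed
    have "Im (x $ 2) = \<alpha> powi (-n) * Im (y $ 2)"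
      using Im \<alpha> by (simp add: power_int_minus)
    then have "\<not> - n \<ge> 1" using far[OF xy(2,1)] by blast
    moreover have "\<not> n \<ge> 1" using far[OF xy(1,2) Im] by blast
    ultimately have "n = 0" by linarith
    then have "y = k x" using k(2) G0(1) by simp
    then show "x = y" using \<epsilon>(2)[OF k(1), of x] xy by (auto simp: U_def)
  qed
  have "open U"
    unfolding U_def by (intro open_Int open_ball open_Collect_less continuous_intros)
  moreover have "T / \<sigma> > 0" using T \<sigma> by simp
  then have "U \<subseteq> CxH" by (auto simp: U_def CxH_def)
  moreover have "v \<in> U" using \<epsilon>(1) T \<sigma> by (simp add: U_def T_def[symmetric] field_simps)
  ultimately show ?thesis using inj by (auto simp: chart_domain_def)
qed

section \<open>Cocompact actions on the slices\<close>

text \<open>Cocompactness is phrased through invariant functions: each of them takes all its values on \<open>K\<close>,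
  which is what the maximum principle and the boundedness arguments use.\<close>

definition cocompact_on_slice :: "real \<Rightarrow> (complex^2 \<Rightarrow> complex^2) set \<Rightarrow> bool" where
  "cocompact_on_slice t S \<longleftrightarrow> (\<exists>K. compact K \<and> K \<subseteq> slice t \<and>
     (\<forall>u :: complex^2 \<Rightarrow> real. (\<forall>s\<in>S. \<forall>v\<in>slice t. u (s v) = u v) \<longrightarrow>
        (\<forall>v\<in>slice t. \<exists>k\<in>K. u v = u k)))"

lemma cocompact_on_sliceI:
  assumes "compact K" "K \<subseteq> slice t"
    and "\<And>(u :: complex^2 \<Rightarrow> real) v. (\<And>s v. s \<in> S \<Longrightarrow> v \<in> slice t \<Longrightarrow> u (s v) = u v) \<Longrightarrow>
      v \<in> slice t \<Longrightarrow> \<exists>k\<in>K. u v = u k"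
  shows "cocompact_on_slice t S"
  unfolding cocompact_on_slice_def
  by (intro exI[of _ K] conjI assms(1,2) allI impI ballI assms(3)) (drule bspec, assumption, drule bspec, assumption+)

lemma slice_nonempty: "vector [0, Complex 0 t] \<in> slice t"
  by (simp add: slice_def)

lemma cocompact_bounded_above:
  assumes "cocompact_on_slice t S" "continuous_on (slice t) u"
    and "\<And>s v. s \<in> S \<Longrightarrow> v \<in> slice t \<Longrightarrow> u (s v) = (u v :: real)"
  shows "\<exists>k\<in>slice t. \<forall>v\<in>slice t. u v \<le> u k"
proof -
  obtain K where K: "compact K" "K \<subseteq> slice t"
    and inv: "\<forall>u :: complex^2 \<Rightarrow> real. (\<forall>s\<in>S. \<forall>v\<in>slice t. u (s v) = u v) \<longrightarrow>
        (\<forall>v\<in>slice t. \<exists>k\<in>K. u v = u k)"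
    using assms(1) unfolding cocompact_on_slice_def by (elim exE conjE)
  have "\<forall>s\<in>S. \<forall>v\<in>slice t. u (s v) = u v" using assms(3) by (intro ballI)
  with spec[OF inv, of u] have K3: "\<exists>k\<in>K. u v = u k" if "v \<in> slice t" for v
    using that by (simp only: simp_thms)
  have "K \<noteq> {}" using K3[OF slice_nonempty] by blast
  then obtain k where k: "k \<in> K" "\<And>k'. k' \<in> K \<Longrightarrow> u k' \<le> u k"
    using continuous_attains_sup[OF K(1) _ continuous_on_subset[OF assms(2) K(2)]] by blast
  show ?thesis
  proof (intro bexI ballI)
    fix v assume "v \<in> slice t"
    then obtain k' where "k' \<in> K" "u v = u k'" using K3 by blast
    then show "u v \<le> u k" using k(2) by simp
  qed (use k K in blast)
qed

lemma cocompact_bounded: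
  assumes "cocompact_on_slice t S" "continuous_on (slice t) u"
    and "\<And>s v. s \<in> S \<Longrightarrow> v \<in> slice t \<Longrightarrow> u (s v) = (u v :: real)"
  shows "\<exists>B. \<forall>v\<in>slice t. \<bar>u v\<bar> \<le> B"
proof -
  obtain k where k: "\<forall>v\<in>slice t. u v \<le> u k"
    using cocompact_bounded_above[of t S u] assms by blast
  have "continuous_on (slice t) (\<lambda>v. - u v)" using assms(2) by (rule continuous_on_minus)
  then obtain l where l: "\<forall>v\<in>slice t. - u v \<le> - u l"
    using cocompact_bounded_above[OF assms(1), of "\<lambda>v. - u v"] assms(3) by auto
  have "\<bar>u v\<bar> \<le> \<bar>u k\<bar> + \<bar>u l\<bar>" if "v \<in> slice t" for v
    using k l that by fastforce
  then show ?thesis by blast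
qed

lemma norm_le_norm_components:
  fixes x :: "complex^2"
  shows "norm x \<le> norm (x $ 1) + norm (x $ 2)"
  using L2_set_le_sum[of UNIV "\<lambda>i. norm (x $ i)"] by (simp add: norm_vec_def sum_2)

lemma closed_slice: "closed (slice t)"
  unfolding slice_def by (intro closed_Collect_eq continuous_intros)

text \<open>The reduction to a fundamental domain: along an orbit a quantity \<open>\<phi>\<close> can be changed by any integral
  multiple of \<open>\<tau>\<close> without changing an invariant function \<open>u\<close>.\<close>

lemma translate_by_iteration:
  fixes \<phi> :: "'a \<Rightarrow> 'b::real_vector"
  assumes up: "\<And>v. v \<in> A \<Longrightarrow> \<exists>w\<in>A. u w = u v \<and> \<phi> w = \<phi> v + \<tau>"
    and down: "\<And>v. v \<in> A \<Longrightarrow> \<exists>w\<in>A. u w = u v \<and> \<phi> w = \<phi> v - \<tau>"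
    and v: "v \<in> A"
  shows "\<exists>w\<in>A. u w = u v \<and> \<phi> w = \<phi> v + of_int n *\<^sub>R \<tau>"
proof (induction n rule: int_induct[where k = 0])
  case base
  then show ?case using v by auto
next
  case (step1 i)
  then obtain w where w: "w \<in> A" "u w = u v" "\<phi> w = \<phi> v + of_int i *\<^sub>R \<tau>" by blast
  from up[OF w(1)] show ?case using w(2,3) by (auto simp: algebra_simps)
next
  case (step2 i)
  then obtain w where w: "w \<in> A" "u w = u v" "\<phi> w = \<phi> v + of_int i *\<^sub>R \<tau>" by blast
  from down[OF w(1)] show ?case using w(2,3) by (auto simp: algebra_simps)
qed

lemma bounded_affine_imp_zero:
  fixes a b :: real
  assumes "\<And>y. \<bar>y * a + b\<bar> \<le> C"
  shows "a = 0"
proof (rule ccontr)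
  assume "a \<noteq> 0"
  then have e: "((C + 1 - b) / a) * a + b = C + 1" by simp
  show False using assms[of "(C + 1 - b) / a"] unfolding e by linarith
qed

section \<open>Surfaces of type \<open>S\<^sup>0\<close>\<close>

text \<open>The vectors \<open>(b\<^sub>i, a\<^sub>i)\<close> form a basis of the real vector space \<open>\<complex> \<times> \<real>\<close>, since \<open>a\<close>, \<open>Re b\<close> and \<open>Im b\<close> are
  linearly independent: their complex span contains eigenvectors of \<open>A\<close> for the distinct eigenvalues
  \<open>\<alpha>\<close>, \<open>\<beta>\<close>, \<open>cnj \<beta>\<close>. The functionals
  \<open>(z, x) \<mapsto> Re (\<kappa>\<^sub>j z) + \<mu>\<^sub>j x\<close> are the dual basis.\<close>

lemma S0_dual_coordinates:
  assumes "S0_data A \<alpha> \<beta> a b"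
  shows "\<exists>\<kappa> \<mu>. (\<forall>i j. Re (\<kappa> j * b $ i) + \<mu> j * a $ i = (if i = j then 1 else 0)) \<and>
    (\<forall>z x. z = (\<Sum>j\<in>UNIV. (Re (\<kappa> j * z) + \<mu> j * x) *\<^sub>R b $ j) \<and>
           x = (\<Sum>j\<in>UNIV. (Re (\<kappa> j * z) + \<mu> j * x) * a $ j))"
proof -
  have data: "\<alpha> > 1" "\<beta> \<notin> \<real>" "a \<noteq> 0" "b \<noteq> 0"
    and Aa: "map_matrix real_of_int A *v a = \<alpha> *s a"
    and Ab: "map_matrix of_int A *v b = \<beta> *s b"
    using assms by (auto simp: S0_data_def)
  have Aa': "(\<Sum>j\<in>UNIV. of_int (A $ i $ j) * a $ j) = \<alpha> * a $ i" for i
    using arg_cong[OF Aa, of "\<lambda>v. v $ i"] by (simp add: matrix_vector_mult_def map_matrix_def)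
  have Ab': "(\<Sum>j\<in>UNIV. of_int (A $ i $ j) * b $ j) = \<beta> * b $ i" for i
    using arg_cong[OF Ab, of "\<lambda>v. v $ i"] by (simp add: matrix_vector_mult_def map_matrix_def)
  define M :: "real^3^3" where "M = (\<chi> i. vector [Re (b $ i), Im (b $ i), a $ i])"
  have M: "M $ i $ 1 = Re (b $ i)" "M $ i $ 2 = Im (b $ i)" "M $ i $ 3 = a $ i" for i
    by (simp_all add: M_def)
  have "x = 0" if "M *v x = 0" for x
  proof -
    define \<kappa> where "\<kappa> = Complex (x $ 1) (- (x $ 2))"
    have shift: "Re (\<kappa> * (\<beta> * w) * b $ i) + x $ 3 * \<alpha> * y * a $ i = 0"
      if "\<And>i. Re (\<kappa> * w * b $ i) + x $ 3 * y * a $ i = 0" for w y i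
    proof -
      have "Re (\<kappa> * w * (\<Sum>j\<in>UNIV. of_int (A $ i $ j) * b $ j))
          + x $ 3 * y * (\<Sum>j\<in>UNIV. of_int (A $ i $ j) * a $ j)
        = (\<Sum>j\<in>UNIV. of_int (A $ i $ j) * (Re (\<kappa> * w * b $ j) + x $ 3 * y * a $ j))"
        unfolding sum_3 by (simp add: algebra_simps)
      then show ?thesis unfolding Aa' Ab' that by (simp add: algebra_simps)
    qed
    have 0: "Re (\<kappa> * 1 * b $ i) + x $ 3 * 1 * a $ i = 0" for i
      using arg_cong[OF that, of "\<lambda>v. v $ i"]
      by (simp add: matrix_vector_mult_def sum_3 M \<kappa>_def algebra_simps)
    have 1: "Re (\<kappa> * (\<beta> * 1) * b $ i) + x $ 3 * \<alpha> * 1 * a $ i = 0" for i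
      by (rule shift[OF 0])
    have 2: "Re (\<kappa> * (\<beta> * (\<beta> * 1)) * b $ i) + x $ 3 * \<alpha> * (\<alpha> * 1) * a $ i = 0" for i
      by (rule shift[of "\<beta> * 1" "\<alpha> * 1"]) (use 1 in \<open>simp add: mult.assoc\<close>)
    have \<kappa>b: "\<kappa> * b $ i = 0" for i
    proof -
      define w where "w = \<kappa> * b $ i"
      define y where "y = x $ 3 * a $ i"
      define W where "W = (\<beta> - of_real \<alpha>) * w"
      have r: "Re w = - y" "Re (\<beta> * w) = - (\<alpha> * y)" "Re (\<beta> * (\<beta> * w)) = - (\<alpha> * (\<alpha> * y))"
        using 0[of i] 1[of i] 2[of i] unfolding w_def y_def
        by (simp_all add: mult.left_commute mult.commute mult.assoc eq_neg_iff_add_eq_0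
            del: times_complex.sel)
      have "Re W = Re (\<beta> * w) - \<alpha> * Re w" by (simp add: W_def algebra_simps)
      then have "Re W = 0" by (simp add: r del: times_complex.sel)
      have "Re (\<beta> * W) = Re (\<beta> * (\<beta> * w)) - \<alpha> * Re (\<beta> * w)" by (simp add: W_def algebra_simps)
      then have "Re (\<beta> * W) = 0" by (simp add: r del: times_complex.sel)
      then have "Im \<beta> * Im W = 0" using \<open>Re W = 0\<close> by simp
      moreover have "Im \<beta> \<noteq> 0" using data(2) complex_is_Real_iff by blast
      ultimately have "(\<beta> - of_real \<alpha>) * w = 0"
        using \<open>Re W = 0\<close> by (simp add: W_def[symmetric] complex_eq_iff)
      moreover have "\<beta> \<noteq> of_real \<alpha>" using data(2) by auto
      ultimately show ?thesis by (simp add: w_def)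
    qed
    obtain i where "b $ i \<noteq> 0" using data(4) by (metis vec_eq_iff zero_index)
    then have "\<kappa> = 0" using \<kappa>b[of i] by simp
    obtain i where "a $ i \<noteq> 0" using data(3) by (metis vec_eq_iff zero_index)
    then have "x $ 3 = 0" using 0[of i] \<open>\<kappa> = 0\<close> by simp
    with \<open>\<kappa> = 0\<close> show ?thesis by (simp add: \<kappa>_def vec_eq_iff forall_3 complex_eq_iff)
  qed
  then obtain L where L_left: "L ** M = mat 1" using matrix_left_invertible_ker by blast
  then have L_right: "M ** L = mat 1" using matrix_left_right_inverse by blast
  define \<kappa> where "\<kappa> j = Complex (L $ 1 $ j) (- (L $ 2 $ j))" for j
  define \<mu> where "\<mu> j = L $ 3 $ j" for j
  have 1: "Re (\<kappa> j * b $ i) + \<mu> j * a $ i = (if i = j then 1 else 0)" for i j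
    using arg_cong[OF L_right, of "\<lambda>m. m $ i $ j"]
    by (simp add: matrix_matrix_mult_def sum_3 M \<kappa>_def \<mu>_def mat_def algebra_simps)
  have L_left': "L $ i $ 1 * M $ 1 $ j + L $ i $ 2 * M $ 2 $ j + L $ i $ 3 * M $ 3 $ j = (if i = j then 1 else 0)" for i j
    using arg_cong[OF L_left, of "\<lambda>m. m $ i $ j"]
    by (simp add: matrix_matrix_mult_def sum_3 mat_def)
  have coord: "(\<Sum>j\<in>UNIV. (Re (\<kappa> j * z) + \<mu> j * x) * M $ j $ l)
    = Re z * (if 1 = l then 1 else 0) + Im z * (if 2 = l then 1 else 0) + x * (if 3 = l then 1 else 0)"
    for z x l
    unfolding L_left'[symmetric] by (simp add: sum_3 \<kappa>_def \<mu>_def algebra_simps)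
  have "z = (\<Sum>j\<in>UNIV. (Re (\<kappa> j * z) + \<mu> j * x) *\<^sub>R b $ j)" for z x
    using coord[of z x 1] coord[of z x 2] by (simp add: complex_eq_iff M sum_3)
  moreover have "x = (\<Sum>j\<in>UNIV. (Re (\<kappa> j * z) + \<mu> j * x) * a $ j)" for z x
    using coord[of z x 3] by (simp add: M sum_3)
  ultimately show ?thesis using 1 by blast
qed

text \<open>The inverse is the adjugate matrix.\<close>

lemma integer_inverse_3:
  fixes A :: "int^3^3"
  assumes "det A = 1"
  shows "\<exists>C. C ** A = mat 1"
proof -
  define C :: "int^3^3" where "C = vector [
    vector [A$2$2 * A$3$3 - A$2$3 * A$3$2, A$1$3 * A$3$2 - A$1$2 * A$3$3, A$1$2 * A$2$3 - A$1$3 * A$2$2],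
    vector [A$2$3 * A$3$1 - A$2$1 * A$3$3, A$1$1 * A$3$3 - A$1$3 * A$3$1, A$1$3 * A$2$1 - A$1$1 * A$2$3],
    vector [A$2$1 * A$3$2 - A$2$2 * A$3$1, A$1$2 * A$3$1 - A$1$1 * A$3$2, A$1$1 * A$2$2 - A$1$2 * A$2$1]]"
  have "C ** A = mat 1"
    using assms unfolding det_3
    by (simp add: vec_eq_iff forall_3 matrix_matrix_mult_def sum_3 mat_def C_def algebra_simps)
  then show ?thesis by blast
qed

theorem no_lck_potential_S0:
  assumes "S0_data A \<alpha> \<beta> a b"
  shows "\<not> (\<exists>g. lck_metric_with_potential TYPE('b) (quotient_manifold CxH (S0_group \<alpha> \<beta> a b)) g)"
proof -
  have data: "det A = 1" "\<alpha> > 1" "\<beta> \<notin> \<real>"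
    and Aa: "map_matrix real_of_int A *v a = \<alpha> *s a"
    and Ab: "map_matrix of_int A *v b = \<beta> *s b"
    using assms by (auto simp: S0_data_def)
  have "\<beta> \<noteq> 0" using data(3) by auto
  define T where "T i = tri 1 0 (b $ i) 1 (a $ i)" for i
  define D where "D = tri \<beta> 0 0 \<alpha> 0"
  define S where "S = insert D (range T)"
  have group: "S0_group \<alpha> \<beta> a b = generated_by CxH S"
    unfolding S0_group_def S_def D_def T_def tri_def by simp
  have Aa': "(\<Sum>j\<in>UNIV. of_int (A $ i $ j) * a $ j) = \<alpha> * a $ i" for i
    using arg_cong[OF Aa, of "\<lambda>v. v $ i"] by (simp add: matrix_vector_mult_def map_matrix_def)
  have Ab': "(\<Sum>j\<in>UNIV. of_int (A $ i $ j) * b $ j) = \<beta> * b $ i" for i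
    using arg_cong[OF Ab, of "\<lambda>v. v $ i"] by (simp add: matrix_vector_mult_def map_matrix_def)
  obtain \<kappa> \<mu> where dual': "\<forall>i j. Re (\<kappa> j * b $ i) + \<mu> j * a $ i = (if i = j then 1 else 0)"
    and coord': "\<forall>z x. z = (\<Sum>j\<in>UNIV. (Re (\<kappa> j * z) + \<mu> j * x) *\<^sub>R b $ j) \<and>
      x = (\<Sum>j\<in>UNIV. (Re (\<kappa> j * z) + \<mu> j * x) * a $ j)"
    using S0_dual_coordinates[OF assms] by (elim exE conjE)
  note dual = dual'[THEN spec, THEN spec]
  note coord = coord'[THEN spec, THEN spec, THEN conjunct1] coord'[THEN spec, THEN spec, THEN conjunct2]
  show ?thesis unfolding group
  proof (rule no_lck_potential_if_max_on_slice)
    show "\<exists>p q r \<sigma> t. s = tri p q r \<sigma> t \<and> p \<noteq> 0 \<and> \<sigma> > 0" if "s \<in> S" for s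
    proof -
      have "s = tri \<beta> 0 0 \<alpha> 0 \<or> (\<exists>i. s = tri 1 0 (b $ i) 1 (a $ i))"
        using that by (auto simp: S_def D_def T_def)
      moreover have "\<alpha> > 0" using data(2) by simp
      ultimately show ?thesis using \<open>\<beta> \<noteq> 0\<close> zero_less_one zero_neq_one by metis
    qed
  next
    fix v :: "complex^2" assume v: "v \<in> CxH"
    define \<Lambda> where "\<Lambda> m = tri 1 0 (\<Sum>j\<in>UNIV. of_int (m $ j) * b $ j) 1 (\<Sum>j\<in>UNIV. of_int (m $ j) * a $ j)"
      for m :: "int^3"
    define G0 where "G0 n = tri (\<beta> powi n) 0 0 (\<alpha> powi n) 0" for n
    have \<Lambda>_comp: "\<Lambda> m \<circ> \<Lambda> n = \<Lambda> (m + n)" for m n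
      by (simp add: fun_eq_iff \<Lambda>_def tri_tri algebra_simps sum.distrib)
    have \<Lambda>_0: "\<Lambda> 0 = id" by (simp add: fun_eq_iff \<Lambda>_def tri_id)
    have tdef: "m v* B = (\<chi> j. \<Sum>i\<in>UNIV. B $ i $ j * m $ i)" for m :: "int^3" and B :: "int^3^3"
      by (simp add: vector_matrix_mult_def mult.commute)
    have act: "(\<Sum>j\<in>UNIV. of_int ((m v* B) $ j) * x $ j)
        = (\<Sum>i\<in>UNIV. of_int (m $ i) * (\<Sum>j\<in>UNIV. of_int (B $ i $ j) * x $ j))"
      for m :: "int^3" and B :: "int^3^3" and x :: "'a::comm_ring_1^3"
      by (simp add: tdef sum_3 algebra_simps)
    have up: "G0 1 \<circ> \<Lambda> m = \<Lambda> (m v* A) \<circ> G0 1" for m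
    proof -
      have "(\<Sum>j\<in>UNIV. of_int ((m v* A) $ j) * a $ j) = \<alpha> * (\<Sum>j\<in>UNIV. of_int (m $ j) * a $ j)"
        unfolding act Aa' by (simp add: sum_distrib_left algebra_simps)
      moreover have "(\<Sum>j\<in>UNIV. of_int ((m v* A) $ j) * b $ j) = \<beta> * (\<Sum>j\<in>UNIV. of_int (m $ j) * b $ j)"
        unfolding act Ab' by (simp add: sum_distrib_left algebra_simps)
      ultimately show ?thesis by (simp add: fun_eq_iff \<Lambda>_def G0_def tri_tri)
    qed
    obtain C where C: "C ** A = mat 1" using integer_inverse_3[OF data(1)] by blast
    have down: "G0 (-1) \<circ> \<Lambda> m = \<Lambda> (m v* C) \<circ> G0 (-1)" for m
    proof -
      have "m v* C v* A = m" by (simp add: vector_matrix_mul_assoc C)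
      then have "G0 1 \<circ> \<Lambda> (m v* C) = \<Lambda> m \<circ> G0 1" by (simp add: up)
      moreover have "G0 1 \<circ> G0 (-1) = id" "G0 (-1) \<circ> G0 1 = id"
        using data(2) \<open>\<beta> \<noteq> 0\<close> by (simp_all add: fun_eq_iff G0_def tri_tri tri_id)
      ultimately show ?thesis by (metis comp_assoc comp_id id_comp)
    qed
    show "\<exists>U. chart_domain CxH (generated_by CxH S) U \<and> v \<in> U"
    proof (rule charts_of_extension_by_dilation[where H = "range \<Lambda>" and ?G0.0 = G0 and \<alpha> = \<alpha>])
      show "bij_betw s CxH CxH" if "s \<in> S" for s
        using that data(2) \<open>\<beta> \<noteq> 0\<close> by (auto simp: S_def D_def T_def intro!: bij_betw_tri)
      have "T i = \<Lambda> (axis i 1)" for i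
      proof -
        have axis_sum: "(\<Sum>j\<in>UNIV. of_int (axis i 1 $ j) * x $ j) = x $ i" for x :: "'a::comm_ring_1^3"
          by (simp add: axis_def if_distrib if_distribR cong: if_cong)
        show ?thesis by (simp add: T_def \<Lambda>_def axis_sum)
      qed
      then show "s \<in> range \<Lambda> \<or> s = G0 1" if "s \<in> S" for s
        using that by (auto simp: S_def D_def G0_def)
      show "G0 0 = id" by (simp add: fun_eq_iff G0_def tri_id)
      show "G0 (m + n) = G0 m \<circ> G0 n" for m n
        using data(2) \<open>\<beta> \<noteq> 0\<close> by (simp add: fun_eq_iff G0_def tri_tri power_int_add)
      show "Im (G0 n v $ 2) = \<alpha> powi n * Im (v $ 2)" for n v unfolding G0_def by (rule Im_tri)
      show "id \<in> range \<Lambda>" using \<Lambda>_0 by (metis rangeI)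
      show "k \<circ> k' \<in> range \<Lambda>" if "k \<in> range \<Lambda>" "k' \<in> range \<Lambda>" for k k'
        using that \<Lambda>_comp by auto
      show "\<exists>k'\<in>range \<Lambda>. k' \<circ> k = id" if "k \<in> range \<Lambda>" for k
      proof -
        obtain m where "k = \<Lambda> m" using \<open>k \<in> range \<Lambda>\<close> by blast
        then have "\<Lambda> (- m) \<circ> k = id" by (simp add: \<Lambda>_comp \<Lambda>_0)
        then show ?thesis by blast
      qed
      show "Im (k v $ 2) = Im (v $ 2)" if "k \<in> range \<Lambda>" for k v
        using that by (auto simp: \<Lambda>_def simp del: tri_nth)
      show "\<exists>k'\<in>range \<Lambda>. G0 1 \<circ> k = k' \<circ> G0 1" if "k \<in> range \<Lambda>" for k
        using that up by blast
      show "\<exists>k'\<in>range \<Lambda>. G0 (-1) \<circ> k = k' \<circ> G0 (-1)" if "k \<in> range \<Lambda>" for k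
        using that down by blast
    next
      fix v :: "complex^2"
      define c where "c = (\<Sum>j\<in>UNIV. norm (\<kappa> j) + \<bar>\<mu> j\<bar>)"
      have cj: "norm (\<kappa> j) + \<bar>\<mu> j\<bar> \<le> c" for j
        unfolding c_def by (rule member_le_sum) auto
      have c0: "c \<ge> 0" unfolding c_def by (intro sum_nonneg) auto
      define \<epsilon> where "\<epsilon> = 1 / (2 * (c + 1))"
      have \<epsilon>: "\<epsilon> > 0" "2 * \<epsilon> * c < 1" using c0 by (auto simp: \<epsilon>_def field_simps)
      have "k x = x" if k: "k \<in> range \<Lambda>" and x: "x \<in> ball v \<epsilon>" "k x \<in> ball v \<epsilon>" for k x
      proof -
        obtain m where m: "k = \<Lambda> m" using k by blast
        define B where "B = (\<Sum>j\<in>UNIV. of_int (m $ j) * b $ j)"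
        define A' where "A' = (\<Sum>j\<in>UNIV. of_int (m $ j) * a $ j)"
        have "dist (k x) x < 2 * \<epsilon>"
          using x dist_triangle3[of "k x" x v] by simp
        moreover have "k x $ 1 - x $ 1 = B" "k x $ 2 - x $ 2 = of_real A'"
          by (simp_all add: m \<Lambda>_def B_def A'_def)
        ultimately have small: "norm B < 2 * \<epsilon>" "\<bar>A'\<bar> < 2 * \<epsilon>"
          using Finite_Cartesian_Product.norm_nth_le[of "k x - x" 1] Finite_Cartesian_Product.norm_nth_le[of "k x - x" 2]
          by (auto simp: dist_norm)
        have "m $ j = 0" for j
        proof -
          have "Re (\<kappa> j * B) + \<mu> j * A' = (\<Sum>i\<in>UNIV. of_int (m $ i) * (Re (\<kappa> j * b $ i) + \<mu> j * a $ i))"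
            unfolding B_def A'_def sum_3 by (simp add: algebra_simps)
          also have "\<dots> = of_int (m $ j)" unfolding dual by (simp add: if_distrib cong: if_cong)
          finally have m_eq: "Re (\<kappa> j * B) + \<mu> j * A' = of_int (m $ j)" .
          have "\<bar>of_int (m $ j)\<bar> \<le> \<bar>Re (\<kappa> j * B)\<bar> + \<bar>\<mu> j * A'\<bar>"
            unfolding m_eq[symmetric] by (rule abs_triangle_ineq)
          also have "\<dots> \<le> norm (\<kappa> j) * norm B + \<bar>\<mu> j\<bar> * \<bar>A'\<bar>"
            using abs_Re_le_cmod[of "\<kappa> j * B"] by (simp only: norm_mult abs_mult add_right_mono)
          also have "\<dots> \<le> norm (\<kappa> j) * (2 * \<epsilon>) + \<bar>\<mu> j\<bar> * (2 * \<epsilon>)"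
            using small by (intro add_mono mult_left_mono) auto
          also have "\<dots> \<le> c * (2 * \<epsilon>)"
            using cj[of j] \<epsilon>(1) by (simp add: distrib_right[symmetric])
          also have "\<dots> < 1" using \<epsilon>(2) by (simp add: algebra_simps)
          finally show ?thesis by linarith
        qed
        then have "m = 0" by (simp add: vec_eq_iff)
        then show ?thesis by (simp add: m \<Lambda>_0)
      qed
      then show "\<exists>\<epsilon>>0. \<forall>k\<in>range \<Lambda>. \<forall>x\<in>ball v \<epsilon>. k x \<in> ball v \<epsilon> \<longrightarrow> k x = x"
        using \<epsilon>(1) by blast
    qed (use data(2) v in auto)
  next
    fix h :: "complex^2 \<Rightarrow> real"
    assume cont: "continuous_on CxH h" and mult: "\<And>s. s \<in> S \<Longrightarrow> \<exists>c. \<forall>v\<in>CxH. h (s v) = h v + c"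
    have "\<forall>i. \<exists>c. \<forall>v\<in>CxH. h (T i v) = h v + c" using mult by (simp add: S_def)
    then obtain c where c: "\<And>i v. v \<in> CxH \<Longrightarrow> h (T i v) = h v + c i" by metis
    obtain c0 where c0: "\<And>v. v \<in> CxH \<Longrightarrow> h (D v) = h v + c0" using mult[of D] by (auto simp: S_def)
    \<comment> \<open>the real-linear functional with the same increments as \<open>h\<close> under the translations\<close>
    define \<kappa>' where "\<kappa>' = (\<Sum>j\<in>UNIV. of_real (c j) * \<kappa> j)"
    define \<mu>' where "\<mu>' = (\<Sum>j\<in>UNIV. c j * \<mu> j)"
    define L where "L v = Re (\<kappa>' * v $ 1) + \<mu>' * Re (v $ 2)" for v :: "complex^2"
    have slice_sub: "slice t \<subseteq> CxH" if "t > 0" for t using that by (auto simp: slice_def CxH_def)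
    have L_T: "L (T i v) = L v + c i" for i v
    proof -
      have "Re (\<kappa>' * b $ i) + \<mu>' * a $ i = (\<Sum>j\<in>UNIV. c j * (Re (\<kappa> j * b $ i) + \<mu> j * a $ i))"
        unfolding \<kappa>'_def \<mu>'_def sum_3 by (simp add: algebra_simps)
      also have "\<dots> = c i" unfolding dual by (simp add: if_distrib cong: if_cong)
      finally show ?thesis by (simp add: L_def T_def algebra_simps)
    qed
    have cocompact: "cocompact_on_slice t (range T)" for t
    proof -
      define R where "R = (\<Sum>j\<in>UNIV. norm (b $ j) + \<bar>a $ j\<bar>)"
      define K where "K = cball 0 (2 * R + \<bar>t\<bar>) \<inter> slice t"
      have "compact K" unfolding K_def by (intro compact_Int_closed closed_slice compact_cball)
      then show ?thesis
      proof (rule cocompact_on_sliceI)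
        show "K \<subseteq> slice t" by (simp add: K_def)
        fix u :: "complex^2 \<Rightarrow> real" and v
        assume inv: "\<And>s v. s \<in> range T \<Longrightarrow> v \<in> slice t \<Longrightarrow> u (s v) = u v" and v: "v \<in> slice t"
        define \<tau> :: "3 \<Rightarrow> complex^2" where "\<tau> i = vector [b $ i, of_real (a $ i)]" for i
        have T\<tau>: "T i w = w + \<tau> i" for i w
          by (simp add: vec_eq_iff forall_2 T_def \<tau>_def)
        have sl: "w + \<tau> i \<in> slice t" "w - \<tau> i \<in> slice t" if "w \<in> slice t" for i w
          using that by (auto simp: slice_def \<tau>_def)
        have inv': "u (w + \<tau> i) = u w" if "w \<in> slice t" for i w
          using inv that by (simp add: T\<tau>[symmetric])
        have iter: "\<exists>x\<in>slice t. u x = u w \<and> x = w + of_int n *\<^sub>R \<tau> i" if "w \<in> slice t" for n w i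
        proof (rule translate_by_iteration[where \<phi> = "\<lambda>x. x", OF _ _ that])
          show "\<exists>x\<in>slice t. u x = u w \<and> x = w + \<tau> i" if "w \<in> slice t" for w
            using sl(1) inv' that by blast
          show "\<exists>x\<in>slice t. u x = u w \<and> x = w - \<tau> i" if "w \<in> slice t" for w
            using sl(2)[OF that, of i] inv'[OF sl(2)[OF that, of i], of i] by auto
        qed
        define \<phi> where "\<phi> j = Re (\<kappa> j * v $ 1) + \<mu> j * Re (v $ 2)" for j
        define n where "n j = - \<lfloor>\<phi> j\<rfloor>" for j
        obtain x1 where x1: "x1 \<in> slice t" "u x1 = u v" "x1 = v + of_int (n 1) *\<^sub>R \<tau> 1"
          using iter[OF v] by blast
        obtain x2 where x2: "x2 \<in> slice t" "u x2 = u v" "x2 = v + of_int (n 1) *\<^sub>R \<tau> 1 + of_int (n 2) *\<^sub>R \<tau> 2"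
          using iter[OF x1(1)] x1 by metis
        obtain x where x: "x \<in> slice t" "u x = u v"
          "x = v + of_int (n 1) *\<^sub>R \<tau> 1 + of_int (n 2) *\<^sub>R \<tau> 2 + of_int (n 3) *\<^sub>R \<tau> 3"
          using iter[OF x2(1)] x2 by metis
        have frac: "\<bar>\<phi> j + of_int (n j)\<bar> \<le> 1" for j
          unfolding n_def by linarith
        have "x $ 1 = (\<Sum>j\<in>UNIV. \<phi> j *\<^sub>R b $ j) + (\<Sum>j\<in>UNIV. of_int (n j) *\<^sub>R b $ j)"
          unfolding \<phi>_def coord(1)[symmetric] by (simp add: x(3) \<tau>_def sum_3)
        also have "\<dots> = (\<Sum>j\<in>UNIV. (\<phi> j + of_int (n j)) *\<^sub>R b $ j)"
          by (simp add: sum.distrib scaleR_add_left)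
        finally have x1_eq: "x $ 1 = (\<Sum>j\<in>UNIV. (\<phi> j + of_int (n j)) *\<^sub>R b $ j)" .
        have "norm (x $ 1) \<le> (\<Sum>j\<in>UNIV. norm ((\<phi> j + of_int (n j)) *\<^sub>R b $ j))"
          unfolding x1_eq by (rule norm_sum)
        also have "\<dots> \<le> R"
          unfolding R_def
        proof (rule sum_mono)
          show "norm ((\<phi> j + of_int (n j)) *\<^sub>R b $ j) \<le> norm (b $ j) + \<bar>a $ j\<bar>" for j
            using mult_right_mono[OF frac[of j] norm_ge_zero[of "b $ j"]] by simp
        qed
        finally have 1: "norm (x $ 1) \<le> R" .
        have "Re (x $ 2) = (\<Sum>j\<in>UNIV. \<phi> j * a $ j) + (\<Sum>j\<in>UNIV. of_int (n j) * a $ j)"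
          unfolding \<phi>_def coord(2)[symmetric] by (simp add: x(3) \<tau>_def sum_3)
        also have "\<dots> = (\<Sum>j\<in>UNIV. (\<phi> j + of_int (n j)) * a $ j)"
          by (simp add: sum.distrib distrib_right)
        finally have x2_eq: "Re (x $ 2) = (\<Sum>j\<in>UNIV. (\<phi> j + of_int (n j)) * a $ j)" .
        have "\<bar>Re (x $ 2)\<bar> \<le> (\<Sum>j\<in>UNIV. \<bar>(\<phi> j + of_int (n j)) * a $ j\<bar>)"
          unfolding x2_eq by (rule sum_abs)
        also have "\<dots> \<le> R"
          unfolding R_def
        proof (rule sum_mono)
          show "\<bar>(\<phi> j + of_int (n j)) * a $ j\<bar> \<le> norm (b $ j) + \<bar>a $ j\<bar>" for j
            using mult_right_mono[OF frac[of j] abs_ge_zero[of "a $ j"]] norm_ge_zero[of "b $ j"]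
            unfolding abs_mult by linarith
        qed
        finally have 2: "\<bar>Re (x $ 2)\<bar> \<le> R" .
        have "Im (x $ 2) = t" using x(1) by (simp add: slice_def)
        then have "norm (x $ 2) \<le> R + \<bar>t\<bar>" using 2 cmod_le[of "x $ 2"] by simp
        then have "norm x \<le> 2 * R + \<bar>t\<bar>"
          using 1 norm_le_norm_components[of x] by linarith
        then have "x \<in> K" using x(1) by (simp add: K_def)
        then show "\<exists>k\<in>K. u v = u k" by (rule bexI[rotated]) (simp add: x(2))
      qed
    qed
    have cont_L: "continuous_on A L" for A unfolding L_def by (intro continuous_intros)
    have "\<exists>B. \<forall>v\<in>slice t. \<bar>h v - L v\<bar> \<le> B" if "t > 0" for t
    proof (rule cocompact_bounded[OF cocompact])
      show "continuous_on (slice t) (\<lambda>v. h v - L v)"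
        by (intro continuous_on_diff cont_L continuous_on_subset[OF cont slice_sub[OF that]])
      show "h (s v) - L (s v) = h v - L v" if "s \<in> range T" "v \<in> slice t" for s v
        using that slice_sub[OF \<open>t > 0\<close>] c L_T by auto
    qed
    then obtain B where B: "\<And>t v. t > 0 \<Longrightarrow> v \<in> slice t \<Longrightarrow> \<bar>h v - L v\<bar> \<le> B t" by metis
    have bound: "\<bar>L (D v) - L v\<bar> \<le> B \<alpha> + B 1 + \<bar>c0\<bar>" if v: "v \<in> slice 1" for v
    proof -
      have "D v \<in> slice \<alpha>" using v by (simp add: D_def slice_def)
      then have "\<bar>h (D v) - L (D v)\<bar> \<le> B \<alpha>" "\<bar>h v - L v\<bar> \<le> B 1"
        using B data(2) v by auto
      moreover have "h (D v) = h v + c0" using c0 v slice_sub[of 1] by auto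
      ultimately show ?thesis by linarith
    qed
    define \<nu> where "\<nu> = \<kappa>' * (\<beta> - 1)"
    \<comment> \<open>along \<open>z = y * cnj \<nu>\<close> the increment \<open>Re (\<nu> z)\<close> is \<open>y * |\<nu>|\<^sup>2\<close>\<close>
    have "(norm \<nu>)\<^sup>2 = 0"
    proof (rule bounded_affine_imp_zero)
      fix y :: real
      have "vector [of_real y * cnj \<nu>, \<i>] \<in> slice 1" by (simp add: slice_def)
      from bound[OF this] 
      have "\<bar>Re (\<nu> * (of_real y * cnj \<nu>))\<bar> \<le> B \<alpha> + B 1 + \<bar>c0\<bar>"
        by (simp add: L_def D_def \<nu>_def algebra_simps)
      moreover have "\<nu> * (of_real y * cnj \<nu>) = of_real (y * (norm \<nu>)\<^sup>2)"
        unfolding of_real_mult complex_norm_square by (simp add: mult.left_commute)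
      ultimately show "\<bar>y * (norm \<nu>)\<^sup>2 + 0\<bar> \<le> B \<alpha> + B 1 + \<bar>c0\<bar>" by (simp del: of_real_mult)
    qed
    then have "\<kappa>' = 0" using data(3) by (auto simp: \<nu>_def)
    have "\<mu>' * (\<alpha> - 1) = 0"
    proof (rule bounded_affine_imp_zero)
      fix y :: real
      have "vector [0, Complex y 1] \<in> slice 1" by (simp add: slice_def)
      from bound[OF this] show "\<bar>y * (\<mu>' * (\<alpha> - 1)) + 0\<bar> \<le> B \<alpha> + B 1 + \<bar>c0\<bar>"
        by (simp add: L_def D_def algebra_simps)
    qed
    then have "\<mu>' = 0" using data(2) by simp
    with \<open>\<kappa>' = 0\<close> have "L v = 0" for v by (simp add: L_def)
    then have "c i = 0" for i using L_T by simp
    show "\<exists>k\<in>slice 1. \<forall>v\<in>slice 1. h v \<le> h k"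
    proof (rule cocompact_bounded_above[OF cocompact])
      show "continuous_on (slice 1) h" by (rule continuous_on_subset[OF cont slice_sub]) simp
      show "h (s v) = h v" if "s \<in> range T" "v \<in> slice 1" for s v
        using that slice_sub[of 1] c \<open>\<And>i. c i = 0\<close> by auto
    qed
  qed
qed

section \<open>Surfaces of types \<open>S\<^sup>+\<close> and \<open>S\<^sup>-\<close>\<close>

text \<open>A common setting for both types: \<open>\<epsilon>\<close> is the determinant of \<open>N\<close>, and the first generator is
  \<open>(z', w) \<mapsto> (\<epsilon> z' + z, \<alpha> w)\<close>, with \<open>z = 0\<close> for type \<open>S\<^sup>-\<close>.\<close>

locale inoue_nil =
  fixes N :: "int^2^2" and p q r \<epsilon> :: int and \<alpha> :: real and z :: complex and a b c :: "real^2"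
  assumes det: "N$1$1 * N$2$2 - N$1$2 * N$2$1 = \<epsilon>"
    and eps: "\<epsilon> = 1 \<or> \<epsilon> = -1 \<and> z = 0"
    and \<alpha>: "\<alpha> > 1" and r: "r \<noteq> 0" and nonzero: "a \<noteq> 0" "b \<noteq> 0"
    and Na: "\<And>i. of_int (N$i$1) * a$1 + of_int (N$i$2) * a$2 = \<alpha> * a$i"
    and Nb: "\<And>i. of_int (N$i$1) * b$1 + of_int (N$i$2) * b$2 = of_int \<epsilon> / \<alpha> * b$i"
    and Nc: "\<And>i. of_int \<epsilon> * c$i = of_int (N$i$1) * c$1 + of_int (N$i$2) * c$2
      + inoue_e N a b $ i + inoue_step a b r * of_int (if i = 1 then p else q)"
begin

text \<open>The commutator of the two generators \<open>gen 1\<close> and \<open>gen 2\<close> is the translation of \<open>z\<close> by this number.\<close>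

definition area :: real where "area = b$1 * a$2 - b$2 * a$1"

abbreviation step :: real where "step \<equiv> inoue_step a b r"

lemma area_eq: "area = of_int r * step"
  using r by (simp add: area_def inoue_step_def)

lemma eps_sq: "\<epsilon> * \<epsilon> = 1" "of_int \<epsilon> * of_int \<epsilon> = (1 :: 'x::ring_1)" "\<epsilon> \<noteq> 0"
  using eps by auto

lemma area_nonzero: "area \<noteq> 0"
proof
  assume "area = 0"
  then have dep: "b$1 * a$2 = b$2 * a$1" by (simp add: area_def)
  obtain i where i: "a $ i \<noteq> 0" using nonzero(1) by (metis vec_eq_iff zero_index)
  define k where "k = b $ i / a $ i"
  have "b $ j = k * a $ j" for j
    using dep i exhaust_2[of i] exhaust_2[of j] by (auto simp: k_def field_simps)
  then have bk: "b $ 1 = k * a $ 1" "b $ 2 = k * a $ 2" "b $ i = k * a $ i" by auto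
  have "k \<noteq> 0" using nonzero(2) \<open>\<And>j. b $ j = k * a $ j\<close> by (metis mult_zero_left vec_eq_iff zero_index)
  have "of_int \<epsilon> / \<alpha> * (k * a $ i) = k * (of_int (N$i$1) * a$1 + of_int (N$i$2) * a$2)"
    using Nb[of i] by (simp add: bk algebra_simps)
  also have "\<dots> = \<alpha> * (k * a $ i)" unfolding Na by simp
  finally have "of_int \<epsilon> / \<alpha> * (k * a $ i) = \<alpha> * (k * a $ i)" .
  moreover have "k * a $ i \<noteq> 0" using i \<open>k \<noteq> 0\<close> by simp
  ultimately have "of_int \<epsilon> / \<alpha> = \<alpha>" using mult_right_cancel by blast
  then have "of_int \<epsilon> = \<alpha> * \<alpha>" using \<alpha> by (simp add: field_simps)
  moreover have "\<alpha> * \<alpha> > 1" using \<alpha> by (simp add: less_1_mult)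
  ultimately show False using eps by auto
qed

lemma step_nonzero: "step \<noteq> 0"
  using area_nonzero area_eq by auto

text \<open>The quadratic function that turns the cocycle \<open>(m\<cdot>b)(m'\<cdot>a)\<close> of the Heisenberg group into a coboundary
  modulo \<open>area\<close>, see \<open>quad_add\<close>. The numbers \<open>e\<^sub>i\<close> are its values on the rows of \<open>N\<close>.\<close>

definition quad :: "real \<Rightarrow> real \<Rightarrow> real" where
  "quad m n = 1/2 * m * (m - 1) * a$1 * b$1 + 1/2 * n * (n - 1) * a$2 * b$2 + m * n * b$1 * a$2"

lemma quad_add:
  "quad (m + m') (n + n') = quad m n + quad m' n'
     + (m * b$1 + n * b$2) * (m' * a$1 + n' * a$2) + n * m' * area"
  unfolding quad_def area_def by (simp add: field_simps)

lemma inoue_e_eq: "inoue_e N a b $ i = quad (of_int (N$i$1)) (of_int (N$i$2))"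
  by (simp add: inoue_e_def quad_def Let_def)

text \<open>The elements of the group generated by \<open>gen 1\<close>, \<open>gen 2\<close> and the translation by \<open>step\<close>, in normal form.\<close>

definition heis :: "int \<Rightarrow> int \<Rightarrow> int \<Rightarrow> complex^2 \<Rightarrow> complex^2" where
  "heis m n k = tri 1 (of_real (of_int m * b$1 + of_int n * b$2))
     (of_real (of_int m * c$1 + of_int n * c$2 + quad (of_int m) (of_int n) + of_int k * step))
     1 (of_int m * a$1 + of_int n * a$2)"

lemma tri_translation_comp:
  "tri 1 (of_real s) (of_real \<tau>) 1 \<sigma> \<circ> tri 1 (of_real s') (of_real \<tau>') 1 \<sigma>'
     = tri 1 (of_real (s + s')) (of_real (\<tau> + \<tau>' + s * \<sigma>')) 1 (\<sigma> + \<sigma>')"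
  by (simp add: fun_eq_iff tri_tri algebra_simps)

lemma heis_comp: "heis m n k \<circ> heis m' n' k' = heis (m + m') (n + n') (k + k' - n * m' * r)"
proof -
  have 1: "(of_int m * b$1 + of_int n * b$2) + (of_int m' * b$1 + of_int n' * b$2)
      = of_int (m + m') * b$1 + of_int (n + n') * b$2"
    "(of_int m * a$1 + of_int n * a$2) + (of_int m' * a$1 + of_int n' * a$2)
      = of_int (m + m') * a$1 + of_int (n + n') * a$2"
    by (simp_all add: algebra_simps)
  have 2: "(of_int m * c$1 + of_int n * c$2 + quad (of_int m) (of_int n) + of_int k * step)
     + (of_int m' * c$1 + of_int n' * c$2 + quad (of_int m') (of_int n') + of_int k' * step)
     + (of_int m * b$1 + of_int n * b$2) * (of_int m' * a$1 + of_int n' * a$2)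
    = of_int (m + m') * c$1 + of_int (n + n') * c$2 + quad (of_int (m + m')) (of_int (n + n'))
      + of_int (k + k' - n * m' * r) * step"
    unfolding of_int_add quad_add area_eq by (simp add: algebra_simps)
  show ?thesis unfolding heis_def tri_translation_comp 1 2 ..
qed

lemma heis_0: "heis 0 0 0 = id"
  by (simp add: fun_eq_iff heis_def quad_def tri_id)

text \<open>Iteration of \<open>quad_add\<close>: the value at the combination of two vectors \<open>(x, y)\<close> and \<open>(u, v)\<close> with
  coefficients \<open>m\<close> and \<open>n\<close>.\<close>

lemma quad_multiples:
  "quad (m * x + n * u) (m * y + n * v) = m * quad x y + n * quad u v
    + m * (m - 1) / 2 * ((x * b$1 + y * b$2) * (x * a$1 + y * a$2) + x * y * area)
    + n * (n - 1) / 2 * ((u * b$1 + v * b$2) * (u * a$1 + v * a$2) + u * v * area)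
    + m * n * ((x * b$1 + y * b$2) * (u * a$1 + v * a$2)) + m * y * n * u * area"
  unfolding quad_def area_def by (simp add: field_simps)

lemma real_half_product: "real_of_int (m * (m - 1) div 2) = of_int m * (of_int m - 1) / 2"
proof -
  have "even (m * (m - 1))" by simp
  then show ?thesis by (simp add: real_of_int_div)
qed

text \<open>The reason for the formula that defines \<open>c\<close>: it makes the translation parts compatible with
  conjugation by the dilation, up to multiples of \<open>step\<close>. For the two standard vectors \<open>(m, n)\<close> this is
  the equation for \<open>c\<close>; the general case follows because \<open>N\<close> multiplies the cocycle by \<open>\<epsilon>\<close>.\<close>

lemma quad_twisted:
  defines "m' m n \<equiv> m * N$1$1 + n * N$2$1" and "n' m n \<equiv> m * N$1$2 + n * N$2$2"
  shows "\<exists>j. of_int \<epsilon> * (of_int m * c$1 + of_int n * c$2 + quad (of_int m) (of_int n))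
    = of_int (m' m n) * c$1 + of_int (n' m n) * c$2 + quad (of_int (m' m n)) (of_int (n' m n))
      + of_int j * step"
proof -
  let ?N = "\<lambda>i j. real_of_int (N$i$j)"
  \<comment> \<open>the divisions by two are exact, as consecutive integers are multiplied\<close>
  define J where "J = m * p + n * q - r * (m * (m - 1) div 2 * N$1$1 * N$1$2
    + n * (n - 1) div 2 * N$2$1 * N$2$2 + m * N$1$2 * n * N$2$1)"
  have prod: "(?N i 1 * b$1 + ?N i 2 * b$2) * (?N j 1 * a$1 + ?N j 2 * a$2) = of_int \<epsilon> * b$i * a$j" for i j
    unfolding Na Nb using \<alpha> by simp
  have "quad (of_int (m' m n)) (of_int (n' m n))
    = of_int m * quad (?N 1 1) (?N 1 2) + of_int n * quad (?N 2 1) (?N 2 2)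
    + of_int m * (of_int m - 1) / 2 * (of_int \<epsilon> * b$1 * a$1 + ?N 1 1 * ?N 1 2 * area)
    + of_int n * (of_int n - 1) / 2 * (of_int \<epsilon> * b$2 * a$2 + ?N 2 1 * ?N 2 2 * area)
    + of_int m * of_int n * (of_int \<epsilon> * b$1 * a$2) + of_int m * ?N 1 2 * of_int n * ?N 2 1 * area"
    unfolding m'_def n'_def of_int_add of_int_mult quad_multiples prod ..
  moreover have "of_int \<epsilon> * c$1 = ?N 1 1 * c$1 + ?N 1 2 * c$2 + quad (?N 1 1) (?N 1 2) + step * of_int p"
    "of_int \<epsilon> * c$2 = ?N 2 1 * c$1 + ?N 2 2 * c$2 + quad (?N 2 1) (?N 2 2) + step * of_int q"
    using Nc[of 1] Nc[of 2] by (simp_all add: inoue_e_eq)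
  moreover have "of_int \<epsilon> * (of_int m * c$1 + of_int n * c$2 + quad (of_int m) (of_int n))
     = of_int m * (of_int \<epsilon> * c$1) + of_int n * (of_int \<epsilon> * c$2) + of_int \<epsilon> * quad (of_int m) (of_int n)"
    by (simp add: algebra_simps)
  moreover have "of_int J * step = step * (of_int m * of_int p + of_int n * of_int q)
     - area * (of_int m * (of_int m - 1) / 2 * ?N 1 1 * ?N 1 2
        + of_int n * (of_int n - 1) / 2 * ?N 2 1 * ?N 2 2 + of_int m * ?N 1 2 * of_int n * ?N 2 1)"
    unfolding J_def area_eq of_int_diff of_int_add of_int_mult real_half_product by (simp add: algebra_simps)
  moreover have "real_of_int (m' m n) = of_int m * ?N 1 1 + of_int n * ?N 2 1"
    "real_of_int (n' m n) = of_int m * ?N 1 2 + of_int n * ?N 2 2"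
    by (simp_all add: m'_def n'_def)
  moreover have "quad (of_int m) (of_int n) = of_int m * (of_int m - 1) / 2 * (b$1 * a$1)
      + of_int n * (of_int n - 1) / 2 * (b$2 * a$2) + of_int m * of_int n * (b$1 * a$2)"
    by (simp add: quad_def algebra_simps)
  ultimately show ?thesis
    by (intro exI[of _ J]) (simp only: distrib_left distrib_right, simp add: algebra_simps)
qed

text \<open>The iterates of the first generator. The formula for the translation part is correct because
  \<open>\<epsilon> = 1\<close> or \<open>z = 0\<close>.\<close>

definition dil :: "int \<Rightarrow> complex^2 \<Rightarrow> complex^2" where
  "dil n = tri (of_int \<epsilon> powi n) 0 (of_int n * z) (\<alpha> powi n) 0"

lemma dil_0: "dil 0 = id"
  by (simp add: fun_eq_iff dil_def tri_id)

lemma dil_add: "dil (m + n) = dil m \<circ> dil n"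
proof -
  have "of_int \<epsilon> powi m * (of_int n * z) + of_int m * z = of_int (m + n) * z"
    using eps by (auto simp: algebra_simps)
  moreover have "of_int \<epsilon> powi (m + n) = of_int \<epsilon> powi m * (of_int \<epsilon> powi n :: complex)"
    using eps_sq(3) by (simp add: power_int_add)
  moreover have "\<alpha> powi (m + n) = \<alpha> powi m * \<alpha> powi n"
    using \<alpha> by (simp add: power_int_add)
  ultimately show ?thesis
    by (simp add: fun_eq_iff dil_def tri_tri)
qed

lemma dil_1: "dil 1 = tri (of_int \<epsilon>) 0 z \<alpha> 0"
  by (simp add: dil_def)

lemma dil_heis:
  "\<exists>j. \<forall>k. dil 1 \<circ> heis m n k
     = heis (m * N$1$1 + n * N$2$1) (m * N$1$2 + n * N$2$2) (\<epsilon> * k + j) \<circ> dil 1"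
proof -
  define m' n' where "m' = m * N$1$1 + n * N$2$1" and "n' = m * N$1$2 + n * N$2$2"
  obtain j where j: "of_int \<epsilon> * (of_int m * c$1 + of_int n * c$2 + quad (of_int m) (of_int n))
    = of_int m' * c$1 + of_int n' * c$2 + quad (of_int m') (of_int n') + of_int j * step"
    using quad_twisted[of m n] unfolding m'_def n'_def by blast
  have A: "of_int m' * a$1 + of_int n' * a$2 = \<alpha> * (of_int m * a$1 + of_int n * a$2)"
  proof -
    have "of_int m' * a$1 + of_int n' * a$2 = of_int m * (of_int (N$1$1) * a$1 + of_int (N$1$2) * a$2)
        + of_int n * (of_int (N$2$1) * a$1 + of_int (N$2$2) * a$2)"
      by (simp add: m'_def n'_def algebra_simps)
    then show ?thesis unfolding Na by (simp add: algebra_simps)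
  qed
  have B: "(of_int m' * b$1 + of_int n' * b$2) * \<alpha> = of_int \<epsilon> * (of_int m * b$1 + of_int n * b$2)"
  proof -
    have "of_int m' * b$1 + of_int n' * b$2 = of_int m * (of_int (N$1$1) * b$1 + of_int (N$1$2) * b$2)
        + of_int n * (of_int (N$2$1) * b$1 + of_int (N$2$2) * b$2)"
      by (simp add: m'_def n'_def algebra_simps)
    then show ?thesis unfolding Nb using \<alpha> by (simp add: field_simps)
  qed
  have "dil 1 \<circ> heis m n k = heis m' n' (\<epsilon> * k + j) \<circ> dil 1" for k
  proof -
    have C: "of_int m' * c$1 + of_int n' * c$2 + quad (of_int m') (of_int n') + of_int (\<epsilon> * k + j) * step
       = of_int \<epsilon> * (of_int m * c$1 + of_int n * c$2 + quad (of_int m) (of_int n) + of_int k * step)"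
      using j by (simp add: algebra_simps)
    have *: "dil 1 \<circ> tri 1 (of_real s) (of_real \<tau>) 1 \<sigma> = tri 1 (of_real s') (of_real (of_int \<epsilon> * \<tau>)) 1 (\<alpha> * \<sigma>) \<circ> dil 1"
      if "s' * \<alpha> = of_int \<epsilon> * s" for s s' \<tau> \<sigma>
    proof -
      have "(of_real s' :: complex) * of_real \<alpha> = of_int \<epsilon> * of_real s"
        using arg_cong[OF that, of complex_of_real] by simp
      then show ?thesis by (simp add: fun_eq_iff dil_1 tri_tri add.commute)
    qed
    show ?thesis unfolding heis_def C A by (rule *[OF B])
  qed
  then show ?thesis unfolding m'_def n'_def by blast
qed

lemma dil_inv: "dil (-1) \<circ> dil 1 = id" "dil 1 \<circ> dil (-1) = id"
  using dil_add[of "-1" 1] dil_add[of 1 "-1"] by (simp_all add: dil_0)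

text \<open>The inverse of \<open>N\<close> is integral, so \<open>dil_heis\<close> can be solved for the parameters on the other side.\<close>

lemma dil_inv_heis: "\<exists>m' n' k'. dil (-1) \<circ> heis m n k = heis m' n' k' \<circ> dil (-1)"
proof -
  define m' n' where "m' = \<epsilon> * (m * N$2$2 - n * N$2$1)" and "n' = \<epsilon> * (n * N$1$1 - m * N$1$2)"
  have "m' * N$1$1 + n' * N$2$1 = \<epsilon> * (N$1$1 * N$2$2 - N$1$2 * N$2$1) * m"
    "m' * N$1$2 + n' * N$2$2 = \<epsilon> * (N$1$1 * N$2$2 - N$1$2 * N$2$1) * n"
    by (simp_all add: m'_def n'_def algebra_simps)
  then have mn: "m' * N$1$1 + n' * N$2$1 = m" "m' * N$1$2 + n' * N$2$2 = n"
    by (simp_all add: det eps_sq)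
  obtain j where j: "\<And>k. dil 1 \<circ> heis m' n' k = heis m n (\<epsilon> * k + j) \<circ> dil 1"
    using dil_heis[of m' n'] unfolding mn by blast
  have "\<epsilon> * (\<epsilon> * (k - j)) + j = k" using eps_sq(1) by (simp add: mult.assoc[symmetric])
  then have "dil 1 \<circ> heis m' n' (\<epsilon> * (k - j)) = heis m n k \<circ> dil 1"
    using j[of "\<epsilon> * (k - j)"] by simp
  then have "dil (-1) \<circ> (dil 1 \<circ> heis m' n' (\<epsilon> * (k - j))) \<circ> dil (-1)
      = dil (-1) \<circ> (heis m n k \<circ> dil 1) \<circ> dil (-1)" by simp
  then have "(dil (-1) \<circ> dil 1) \<circ> heis m' n' (\<epsilon> * (k - j)) \<circ> dil (-1)
      = dil (-1) \<circ> heis m n k \<circ> (dil 1 \<circ> dil (-1))" by (simp only: comp_assoc)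
  then have "heis m' n' (\<epsilon> * (k - j)) \<circ> dil (-1) = dil (-1) \<circ> heis m n k"
    by (simp only: dil_inv id_comp comp_id)
  then show ?thesis by metis
qed

definition gen :: "2 \<Rightarrow> complex^2 \<Rightarrow> complex^2" where
  "gen i = tri 1 (of_real (b$i)) (of_real (c$i)) 1 (a$i)"

definition shift :: "real \<Rightarrow> complex^2 \<Rightarrow> complex^2" where
  "shift s = tri 1 0 (of_real s) 1 0"

definition gens :: "(complex^2 \<Rightarrow> complex^2) set" where
  "gens = insert (dil 1) (insert (shift step) (range gen))"

lemma gen_heis: "\<exists>m n k. gen i = heis m n k"
proof -
  have "gen 1 = heis 1 0 0" "gen 2 = heis 0 1 0" by (simp_all add: gen_def heis_def quad_def)
  then show ?thesis using exhaust_2[of i] by metis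
qed

lemma shift_heis: "shift step = heis 0 0 1"
  by (simp add: shift_def heis_def quad_def)

lemma gens_tri: "s \<in> gens \<Longrightarrow> \<exists>p q r \<sigma> t. s = tri p q r \<sigma> t \<and> p \<noteq> 0 \<and> \<sigma> > 0"
proof -
  assume "s \<in> gens"
  then have "s = tri (of_int \<epsilon>) 0 z \<alpha> 0 \<or> s = tri 1 0 (of_real step) 1 0 \<or>
      (\<exists>i. s = tri 1 (of_real (b$i)) (of_real (c$i)) 1 (a$i))"
    by (auto simp: gens_def dil_1 gen_def shift_def)
  moreover have "\<alpha> > 0" "complex_of_int \<epsilon> \<noteq> 0" using \<alpha> eps_sq(3) by auto
  ultimately show ?thesis using zero_less_one zero_neq_one by metis
qed

text \<open>If \<open>x\<close> and its image are close, then so are their second components and, as \<open>Im w\<close> is bounded below,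
  the slope \<open>m\<cdot>b\<close> is small as well. Since \<open>a\<close> and \<open>b\<close> are independent this forces \<open>m = n = 0\<close>, and what
  remains is a translation by a multiple of \<open>step\<close>.\<close>

lemma heis_discrete:
  assumes v: "v \<in> CxH"
  shows "\<exists>\<delta>>0. \<forall>m n k. \<forall>x\<in>ball v \<delta>. heis m n k x \<in> ball v \<delta> \<longrightarrow> heis m n k x = x"
proof -
  define T where "T = Im (v $ 2)"
  have T: "T > 0" using v by (simp add: T_def CxH_def)
  \<comment> \<open>the bounds \<open>|s| < 4 \<delta> / T\<close> and \<open>|\<sigma>| < 2 \<delta>\<close> below, weighted by entries of \<open>a\<close> and \<open>b\<close>, add up to
    less than \<open>\<delta> * C\<close>\<close>
  define C where "C = (\<bar>b$1\<bar> + \<bar>b$2\<bar> + \<bar>a$1\<bar> + \<bar>a$2\<bar>) * (2 + 4 / T) + 1"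
  have C: "C \<ge> 1" using T by (simp add: C_def)
  define \<delta> where "\<delta> = min (T / 2) (min (\<bar>area\<bar> / C) (\<bar>step\<bar> / 2))"
  have \<delta>: "\<delta> > 0" "\<delta> \<le> T / 2" "\<delta> * C \<le> \<bar>area\<bar>" "2 * \<delta> \<le> \<bar>step\<bar>"
  proof -
    show "\<delta> > 0" using T C area_nonzero step_nonzero by (simp add: \<delta>_def)
    have "\<delta> \<le> \<bar>area\<bar> / C" by (simp add: \<delta>_def)
    then show "\<delta> * C \<le> \<bar>area\<bar>" using C by (simp add: pos_le_divide_eq)
    show "\<delta> \<le> T / 2" "2 * \<delta> \<le> \<bar>step\<bar>" unfolding \<delta>_def by linarith+
  qed
  have "heis m n k x = x" if x: "x \<in> ball v \<delta>" "heis m n k x \<in> ball v \<delta>" for m n k x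
  proof -
    define s where "s = of_int m * b$1 + of_int n * b$2"
    define \<sigma> where "\<sigma> = of_int m * a$1 + of_int n * a$2"
    define \<tau> where "\<tau> = of_int m * c$1 + of_int n * c$2 + quad (of_int m) (of_int n) + of_int k * step"
    have heis_eq: "heis m n k = tri 1 (of_real s) (of_real \<tau>) 1 \<sigma>"
      by (simp add: heis_def s_def \<sigma>_def \<tau>_def)
    have "dist (heis m n k x) x < 2 * \<delta>"
      using x dist_triangle3[of "heis m n k x" x v] by simp
    then have near: "norm ((heis m n k x - x) $ i) < 2 * \<delta>" for i
      using Finite_Cartesian_Product.norm_nth_le[of "heis m n k x - x" i] by (simp add: dist_norm)
    have "norm (of_real \<sigma> :: complex) < 2 * \<delta>" using near[of 2] by (simp add: heis_eq)
    then have \<sigma>: "\<bar>\<sigma>\<bar> < 2 * \<delta>" by (simp only: norm_of_real)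
    have d1: "norm (of_real s * x $ 2 + of_real \<tau>) < 2 * \<delta>"
      using near[of 1] by (simp add: heis_eq)
    have "\<bar>Im ((x - v) $ 2)\<bar> < \<delta>"
      using x(1) abs_Im_le_cmod[of "(x - v) $ 2"] Finite_Cartesian_Product.norm_nth_le[of "x - v" 2]
      by (simp add: dist_norm norm_minus_commute)
    then have ImT: "Im (x $ 2) \<ge> T / 2" using \<delta>(2) by (simp add: T_def)
    have "\<bar>s * Im (x $ 2)\<bar> < 2 * \<delta>"
      using abs_Im_le_cmod[of "of_real s * x $ 2 + of_real \<tau>"] d1 by simp
    moreover have "\<bar>s\<bar> * (T / 2) \<le> \<bar>s * Im (x $ 2)\<bar>"
      unfolding abs_mult using ImT T by (intro mult_left_mono) auto
    ultimately have s: "\<bar>s\<bar> < 4 / T * \<delta>" using T by (simp add: field_simps)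
    have small: "\<bar>s * y1 - \<sigma> * y2\<bar> < \<bar>area\<bar>"
      if "\<bar>y1\<bar> \<le> \<bar>b$1\<bar> + \<bar>b$2\<bar> + \<bar>a$1\<bar> + \<bar>a$2\<bar>" "\<bar>y2\<bar> \<le> \<bar>b$1\<bar> + \<bar>b$2\<bar> + \<bar>a$1\<bar> + \<bar>a$2\<bar>" for y1 y2
    proof -
      let ?Y = "\<bar>b$1\<bar> + \<bar>b$2\<bar> + \<bar>a$1\<bar> + \<bar>a$2\<bar>"
      have "\<bar>s * y1 - \<sigma> * y2\<bar> \<le> \<bar>s\<bar> * \<bar>y1\<bar> + \<bar>\<sigma>\<bar> * \<bar>y2\<bar>"
        using abs_triangle_ineq4[of "s * y1" "\<sigma> * y2"] by (simp add: abs_mult)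
      also have "\<dots> \<le> (4 / T * \<delta>) * ?Y + (2 * \<delta>) * ?Y"
        using that s \<sigma> \<delta>(1) T by (intro add_mono mult_mono) auto
      also have "\<dots> < \<delta> * C" using \<delta>(1) by (simp add: C_def algebra_simps)
      finally show ?thesis using \<delta>(3) by simp
    qed
    have "s * a$2 - \<sigma> * b$2 = of_int m * area" "\<sigma> * b$1 - s * a$1 = of_int n * area"
      by (simp_all add: s_def \<sigma>_def area_def algebra_simps)
    moreover have "\<bar>s * a$2 - \<sigma> * b$2\<bar> < \<bar>area\<bar>" "\<bar>\<sigma> * b$1 - s * a$1\<bar> < \<bar>area\<bar>"
      using small[of "a$2" "b$2"] small[of "a$1" "b$1"] by (simp_all add: abs_minus_commute)
    ultimately have "\<bar>real_of_int m\<bar> * \<bar>area\<bar> < 1 * \<bar>area\<bar>" "\<bar>real_of_int n\<bar> * \<bar>area\<bar> < 1 * \<bar>area\<bar>"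
      by (simp_all add: abs_mult)
    then have "\<bar>real_of_int m\<bar> < 1" "\<bar>real_of_int n\<bar> < 1"
      using mult_less_cancel_right_pos[of "\<bar>area\<bar>"] area_nonzero by simp_all
    then have mn: "m = 0" "n = 0" by linarith+
    then have "s = 0" "\<tau> = of_int k * step" by (simp_all add: s_def \<tau>_def quad_def)
    then have "\<bar>real_of_int k\<bar> * \<bar>step\<bar> < 2 * \<delta>"
      using d1 by (simp add: norm_mult abs_mult)
    also have "\<dots> \<le> 1 * \<bar>step\<bar>" using \<delta>(4) by simp
    finally have "\<bar>real_of_int k\<bar> < 1"
      using mult_less_cancel_right_pos[of "\<bar>step\<bar>"] step_nonzero by simp
    then have "k = 0" by linarith
    then show ?thesis using mn heis_0 by simp
  qed
  then show ?thesis using \<delta>(1) by blast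
qed

lemma charts:
  assumes "v \<in> CxH"
  shows "\<exists>U. chart_domain CxH (generated_by CxH gens) U \<and> v \<in> U"
proof -
  define H where "H = {k. \<exists>m n l. k = heis m n l}"
  have H: "k \<in> H \<longleftrightarrow> (\<exists>m n l. k = heis m n l)" for k by (simp add: H_def)
  show ?thesis
  proof (rule charts_of_extension_by_dilation[where H = H and ?G0.0 = dil and \<alpha> = \<alpha>])
    show "bij_betw s CxH CxH" if "s \<in> gens" for s
      using gens_tri[OF that] bij_betw_tri by blast
    show "s \<in> H \<or> s = dil 1" if "s \<in> gens" for s
    proof -
      consider "s = dil 1" | "s = shift step" | i where "s = gen i"
        using \<open>s \<in> gens\<close> unfolding gens_def by blast
      then show ?thesis
      proof cases
        case 2
        then show ?thesis unfolding H using shift_heis by blast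
      next
        case 3
        then show ?thesis unfolding H using gen_heis by blast
      qed blast
    qed
    show "Im (dil n v $ 2) = \<alpha> powi n * Im (v $ 2)" for n v unfolding dil_def by (rule Im_tri)
    show "id \<in> H" unfolding H using heis_0 by metis
    show "k \<circ> k' \<in> H" if "k \<in> H" "k' \<in> H" for k k'
      using that heis_comp unfolding H by metis
    show "\<exists>k'\<in>H. k' \<circ> k = id" if k: "k \<in> H" for k
    proof -
      obtain m n l where "k = heis m n l" using k unfolding H by blast
      then have "heis (-m) (-n) (- l - n * m * r) \<circ> k = id" by (simp add: heis_comp heis_0)
      then show ?thesis unfolding H Bex_def by blast
    qed
    show "Im (k v $ 2) = Im (v $ 2)" if k: "k \<in> H" for k v
    proof -
      obtain m n l where "k = heis m n l" using k unfolding H by blast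
      then show ?thesis unfolding heis_def by (simp only: Im_tri mult_1)
    qed
    show "\<exists>k'\<in>H. dil 1 \<circ> k = k' \<circ> dil 1" if k: "k \<in> H" for k
    proof -
      obtain m n l where kl: "k = heis m n l" using k unfolding H by blast
      obtain j where "dil 1 \<circ> heis m n l
          = heis (m * N$1$1 + n * N$2$1) (m * N$1$2 + n * N$2$2) (\<epsilon> * l + j) \<circ> dil 1"
        using dil_heis[of m n] by blast
      then show ?thesis unfolding kl H Bex_def by blast
    qed
    show "\<exists>k'\<in>H. dil (-1) \<circ> k = k' \<circ> dil (-1)" if k: "k \<in> H" for k
    proof -
      obtain m n l where kl: "k = heis m n l" using k unfolding H by blast
      show ?thesis using dil_inv_heis[of m n l] unfolding kl H Bex_def by blast
    qed
    show "\<exists>\<epsilon>>0. \<forall>k\<in>H. \<forall>x\<in>ball v \<epsilon>. k x \<in> ball v \<epsilon> \<longrightarrow> k x = x" if v: "v \<in> CxH" for v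
    proof -
      obtain \<delta> where "\<delta> > 0" "\<forall>m n k. \<forall>x\<in>ball v \<delta>. heis m n k x \<in> ball v \<delta> \<longrightarrow> heis m n k x = x"
        using heis_discrete[OF v] by blast
      then show ?thesis unfolding Ball_def H by blast
    qed
  qed (use \<alpha> assms dil_0 dil_add in auto)
qed

text \<open>First \<open>(Im z, Re w)\<close> is reduced modulo the lattice spanned by the vectors \<open>(t b\<^sub>i, a\<^sub>i)\<close>, then \<open>Re z\<close>
  modulo \<open>area\<close>.\<close>

lemma cocompact:
  assumes t: "t > 0"
  shows "cocompact_on_slice t (insert (shift area) (range gen))"
proof -
  define R where "R = \<bar>area\<bar> + t * (\<bar>b$1\<bar> + \<bar>b$2\<bar>) + (\<bar>a$1\<bar> + \<bar>a$2\<bar>) + t"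
  have "compact (cball 0 R \<inter> slice t)" by (intro compact_Int_closed closed_slice compact_cball)
  then show ?thesis
  proof (rule cocompact_on_sliceI)
    fix u :: "complex^2 \<Rightarrow> real" and v
    assume inv: "\<And>s v. s \<in> insert (shift area) (range gen) \<Longrightarrow> v \<in> slice t \<Longrightarrow> u (s v) = u v"
      and v: "v \<in> slice t"
    define \<phi> where "\<phi> v = (Im (v $ 1), Re (v $ 2))" for v :: "complex^2"
    have iter: "\<exists>x\<in>slice t. u x = u w \<and> \<phi> x = \<phi> w + of_int n *\<^sub>R (t * b$i, a$i)"
      if "w \<in> slice t" for n w i
    proof (rule translate_by_iteration[OF _ _ that])
      fix w assume w: "w \<in> slice t"
      have "gen i w \<in> slice t" "\<phi> (gen i w) = \<phi> w + (t * b$i, a$i)"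
        using w by (simp_all add: slice_def \<phi>_def gen_def)
      then show "\<exists>x\<in>slice t. u x = u w \<and> \<phi> x = \<phi> w + (t * b$i, a$i)"
        using inv[of "gen i" w] w by blast
      define x where "x = tri 1 (of_real (- (b$i))) (of_real (b$i * a$i - c$i)) 1 (- (a$i)) w"
      have x: "x \<in> slice t" "\<phi> x = \<phi> w - (t * b$i, a$i)"
        using w by (simp_all add: slice_def \<phi>_def x_def)
      have "gen i x = w"
        by (simp add: x_def gen_def vec_eq_iff forall_2 algebra_simps)
      then have "u x = u w" using inv[of "gen i" x] x(1) by simp
      then show "\<exists>x\<in>slice t. u x = u w \<and> \<phi> x = \<phi> w - (t * b$i, a$i)"
        using x by blast
    qed
    define \<tau> :: "complex^2" where "\<tau> = vector [of_real area, 0]"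
    have iter': "\<exists>x\<in>slice t. u x = u w \<and> x = w + of_int n *\<^sub>R \<tau>" if "w \<in> slice t" for n w
    proof (rule translate_by_iteration[where \<phi> = "\<lambda>x. x", OF _ _ that])
      fix w assume w: "w \<in> slice t"
      have sh: "shift area x = x + \<tau>" for x by (simp add: shift_def \<tau>_def vec_eq_iff forall_2)
      have sl: "w + \<tau> \<in> slice t" "w - \<tau> \<in> slice t" using w by (simp_all add: slice_def \<tau>_def)
      show "\<exists>x\<in>slice t. u x = u w \<and> x = w + \<tau>"
        using sl(1) inv[of "shift area" w] w by (auto simp: sh)
      show "\<exists>x\<in>slice t. u x = u w \<and> x = w - \<tau>"
        using sl(2) inv[of "shift area" "w - \<tau>"] by (auto simp: sh)
    qed
    define \<xi> where "\<xi> i = (if i = 1 then Im (v $ 1) / t * a$2 - Re (v $ 2) * b$2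
      else b$1 * Re (v $ 2) - a$1 * (Im (v $ 1) / t)) / area" for i :: 2
    have \<xi>: "\<xi> 1 * area = Im (v $ 1) / t * a$2 - Re (v $ 2) * b$2"
      "\<xi> 2 * area = b$1 * Re (v $ 2) - a$1 * (Im (v $ 1) / t)"
      using area_nonzero by (simp_all add: \<xi>_def)
    have "(\<xi> 1 * b$1 + \<xi> 2 * b$2) * area = (\<xi> 1 * area) * b$1 + (\<xi> 2 * area) * b$2"
      by (simp add: algebra_simps)
    also have "\<dots> = Im (v $ 1) / t * area" unfolding \<xi> by (simp add: area_def algebra_simps)
    finally have "\<xi> 1 * b$1 + \<xi> 2 * b$2 = Im (v $ 1) / t"
      using mult_right_cancel[OF area_nonzero] by blast
    then have Im_v: "Im (v $ 1) = t * (\<xi> 1 * b$1 + \<xi> 2 * b$2)" using t by simp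
    have "(\<xi> 1 * a$1 + \<xi> 2 * a$2) * area = (\<xi> 1 * area) * a$1 + (\<xi> 2 * area) * a$2"
      by (simp add: algebra_simps)
    also have "\<dots> = Re (v $ 2) * area" unfolding \<xi> by (simp add: area_def algebra_simps)
    finally have Re_v: "Re (v $ 2) = \<xi> 1 * a$1 + \<xi> 2 * a$2"
      using area_nonzero by simp
    define n where "n i = - \<lfloor>\<xi> i\<rfloor>" for i
    have frac: "\<bar>\<xi> i + of_int (n i)\<bar> \<le> 1" for i
      unfolding n_def by linarith
    obtain x1 where x1: "x1 \<in> slice t" "u x1 = u v" "\<phi> x1 = \<phi> v + of_int (n 1) *\<^sub>R (t * b$1, a$1)"
      using iter[OF v] by blast
    obtain x2 where x2: "x2 \<in> slice t" "u x2 = u x1" "\<phi> x2 = \<phi> x1 + of_int (n 2) *\<^sub>R (t * b$2, a$2)"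
      using iter[OF x1(1)] by blast
    obtain x where x: "x \<in> slice t" "u x = u x2" "x = x2 + of_int (- \<lfloor>Re (x2 $ 1) / area\<rfloor>) *\<^sub>R \<tau>"
      using iter'[OF x2(1)] by blast
    have "Re (x $ 1) = (Re (x2 $ 1) / area - of_int \<lfloor>Re (x2 $ 1) / area\<rfloor>) * area"
      unfolding x(3) using area_nonzero by (simp add: \<tau>_def algebra_simps)
    moreover have "\<bar>Re (x2 $ 1) / area - of_int \<lfloor>Re (x2 $ 1) / area\<rfloor>\<bar> \<le> 1" by linarith
    ultimately have 1: "\<bar>Re (x $ 1)\<bar> \<le> \<bar>area\<bar>"
      using mult_right_mono[OF _ abs_ge_zero[of area]] by (fastforce simp: abs_mult)
    have combine: "\<bar>(\<xi> 1 + of_int (n 1)) * y1 + (\<xi> 2 + of_int (n 2)) * y2\<bar> \<le> \<bar>y1\<bar> + \<bar>y2\<bar>" for y1 y2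
    proof -
      have "\<bar>(\<xi> 1 + of_int (n 1)) * y1\<bar> \<le> 1 * \<bar>y1\<bar>" "\<bar>(\<xi> 2 + of_int (n 2)) * y2\<bar> \<le> 1 * \<bar>y2\<bar>"
        unfolding abs_mult by (rule mult_right_mono[OF frac abs_ge_zero])+
      then show ?thesis by linarith
    qed
    have "Im (x $ 1) = t * ((\<xi> 1 + of_int (n 1)) * b$1 + (\<xi> 2 + of_int (n 2)) * b$2)"
      using x1(3) x2(3) Im_v unfolding x(3) by (simp add: \<phi>_def \<tau>_def algebra_simps)
    then have 2: "\<bar>Im (x $ 1)\<bar> \<le> t * (\<bar>b$1\<bar> + \<bar>b$2\<bar>)"
      using combine[of "b$1" "b$2"] t by (simp only: abs_mult) simp
    have "Re (x $ 2) = (\<xi> 1 + of_int (n 1)) * a$1 + (\<xi> 2 + of_int (n 2)) * a$2"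
      using x1(3) x2(3) Re_v unfolding x(3) by (simp add: \<phi>_def \<tau>_def algebra_simps)
    then have 3: "\<bar>Re (x $ 2)\<bar> \<le> \<bar>a$1\<bar> + \<bar>a$2\<bar>"
      using combine[of "a$1" "a$2"] by simp
    have "Im (x $ 2) = t" using x(1) by (simp add: slice_def)
    then have "norm x \<le> R"
      using 1 2 3 t norm_le_norm_components[of x] cmod_le[of "x $ 1"] cmod_le[of "x $ 2"]
      unfolding R_def by linarith
    then show "\<exists>k\<in>cball 0 R \<inter> slice t. u v = u k"
      using x(1,2) x2(2) x1(2) by (intro bexI[of _ x]) auto
  qed blast
qed

text \<open>The commutator relation gives invariance under the translation by \<open>area\<close>. The constants of \<open>gen 1\<close> and
  \<open>gen 2\<close> are matched by \<open>\<kappa> Im z / t + \<mu> Re w\<close>; as the dilation multiplies the two arguments by \<open>\<epsilon> / \<alpha>\<close> and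
  \<open>\<alpha>\<close>, up to a constant, both coefficients vanish.\<close>

lemma no_lck_potential:
  "\<not> (\<exists>g. lck_metric_with_potential TYPE('b) (quotient_manifold CxH (generated_by CxH gens)) g)"
proof (rule no_lck_potential_if_max_on_slice[OF gens_tri charts])
  fix h :: "complex^2 \<Rightarrow> real"
  assume cont: "continuous_on CxH h"
    and mult: "\<And>s. s \<in> gens \<Longrightarrow> \<exists>c. \<forall>v\<in>CxH. h (s v) = h v + c"
  have "\<forall>i. \<exists>c. \<forall>v\<in>CxH. h (gen i v) = h v + c" using mult by (simp add: gens_def)
  then obtain \<rho> where \<rho>: "\<And>i v. v \<in> CxH \<Longrightarrow> h (gen i v) = h v + \<rho> i" by metis
  obtain c0 where c0: "\<And>v. v \<in> CxH \<Longrightarrow> h (dil 1 v) = h v + c0"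
    using mult[of "dil 1"] by (auto simp: gens_def)
  have bij: "bij_betw (gen i) CxH CxH" for i unfolding gen_def by (rule bij_betw_tri) auto
  have shift_inv: "h (shift area v) = h v" if "v \<in> CxH" for v
  proof -
    have surj: "gen i ` CxH = CxH" for i using bij by (simp add: bij_betw_def)
    obtain w where w: "w \<in> CxH" "v = gen 2 w" using surj[of 2] \<open>v \<in> CxH\<close> by blast
    obtain x where x: "x \<in> CxH" "w = gen 1 x" using surj[of 1] w(1) by blast
    have x2: "gen 2 x \<in> CxH" using surj[of 2] x(1) by blast
    have "gen 1 (gen 2 x) = shift area (gen 2 (gen 1 x))"
      by (simp add: gen_def shift_def area_def vec_eq_iff forall_2 algebra_simps)
    then have "h (shift area v) = h x + \<rho> 2 + \<rho> 1"
      using \<rho>[OF x2, of 1] \<rho>[OF x(1), of 2] w x by simp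
    also have "\<dots> = h v" using \<rho>[OF w(1), of 2] \<rho>[OF x(1), of 1] w x by simp
    finally show ?thesis .
  qed
  define \<kappa> where "\<kappa> = (\<rho> 1 * a$2 - \<rho> 2 * a$1) / area"
  define \<mu> where "\<mu> = (\<rho> 2 * b$1 - \<rho> 1 * b$2) / area"
  have lin: "\<kappa> * b$i + \<mu> * a$i = \<rho> i" for i
  proof -
    have "(\<kappa> * area) * b$i + (\<mu> * area) * a$i = \<rho> i * area"
      using area_nonzero exhaust_2[of i] by (auto simp: \<kappa>_def \<mu>_def) (simp_all add: area_def algebra_simps)
    then have "(\<kappa> * b$i + \<mu> * a$i) * area = \<rho> i * area" by (simp add: algebra_simps)
    then show ?thesis using area_nonzero by simp
  qed
  define L where "L t v = \<kappa> * (Im (v $ 1) / t) + \<mu> * Re (v $ 2)" for t and v :: "complex^2"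
  have slice_sub: "slice t \<subseteq> CxH" if "t > 0" for t using that by (auto simp: slice_def CxH_def)
  have L_gen: "L t (gen i v) = L t v + \<rho> i" if "t > 0" "v \<in> slice t" for t i v
    using that lin[of i, symmetric] by (simp add: L_def gen_def slice_def add_divide_distrib algebra_simps)
  have L_shift: "L t (shift area v) = L t v" for t v
    by (simp add: L_def shift_def)
  have cont_L: "continuous_on A (L t)" if "t > 0" for t A
    unfolding L_def using that by (intro continuous_intros) auto
  have "\<exists>B. \<forall>v\<in>slice t. \<bar>h v - L t v\<bar> \<le> B" if t: "t > 0" for t
  proof (rule cocompact_bounded[OF cocompact[OF t]])
    show "continuous_on (slice t) (\<lambda>v. h v - L t v)"
      by (intro continuous_on_diff cont_L t continuous_on_subset[OF cont slice_sub[OF t]])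
    fix s v assume s: "s \<in> insert (shift area) (range gen)" and v: "v \<in> slice t"
    have vH: "v \<in> CxH" using slice_sub[OF t] v by blast
    from s consider "s = shift area" | i where "s = gen i" by blast
    then show "h (s v) - L t (s v) = h v - L t v"
      by cases (simp_all add: shift_inv[OF vH] L_shift \<rho>[OF vH] L_gen[OF t v])
  qed
  then obtain B where B: "\<And>t v. t > 0 \<Longrightarrow> v \<in> slice t \<Longrightarrow> \<bar>h v - L t v\<bar> \<le> B t" by metis
  have bound: "\<bar>L \<alpha> (dil 1 v) - L 1 v\<bar> \<le> B \<alpha> + B 1 + \<bar>c0\<bar>" if v: "v \<in> slice 1" for v
  proof -
    have "dil 1 v \<in> slice \<alpha>" using v by (simp add: dil_1 slice_def)
    then have "\<bar>h (dil 1 v) - L \<alpha> (dil 1 v)\<bar> \<le> B \<alpha>" "\<bar>h v - L 1 v\<bar> \<le> B 1"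
      using B \<alpha> v by auto
    moreover have "h (dil 1 v) = h v + c0" using c0 v slice_sub[of 1] by auto
    ultimately show ?thesis by linarith
  qed
  \<comment> \<open>\<open>z = i y\<close> and \<open>w = i\<close> isolate the coefficient of \<open>Im z\<close>\<close>
  have "\<kappa> * (of_int \<epsilon> / \<alpha> - 1) = 0"
  proof (rule bounded_affine_imp_zero)
    fix y :: real
    have "vector [Complex 0 y, \<i>] \<in> slice 1" by (simp add: slice_def)
    from bound[OF this]
    show "\<bar>y * (\<kappa> * (of_int \<epsilon> / \<alpha> - 1)) + \<kappa> * Im z / \<alpha>\<bar> \<le> B \<alpha> + B 1 + \<bar>c0\<bar>"
      by (simp add: L_def dil_1 add_divide_distrib algebra_simps)
  qed
  moreover have "of_int \<epsilon> / \<alpha> - 1 \<noteq> 0" using \<alpha> eps by auto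
  ultimately have "\<kappa> = 0" by (metis mult_eq_0_iff)
  have "\<mu> * (\<alpha> - 1) = 0"
  proof (rule bounded_affine_imp_zero)
    fix y :: real
    have "vector [0, Complex y 1] \<in> slice 1" by (simp add: slice_def)
    from bound[OF this] show "\<bar>y * (\<mu> * (\<alpha> - 1)) + 0\<bar> \<le> B \<alpha> + B 1 + \<bar>c0\<bar>"
      by (simp add: L_def dil_1 \<open>\<kappa> = 0\<close> algebra_simps)
  qed
  then have "\<mu> = 0" using \<alpha> by simp
  have \<rho>0: "\<rho> i = 0" for i using lin[of i] \<open>\<kappa> = 0\<close> \<open>\<mu> = 0\<close> by simp
  show "\<exists>k\<in>slice 1. \<forall>v\<in>slice 1. h v \<le> h k"
  proof (rule cocompact_bounded_above[OF cocompact[OF zero_less_one]])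
    show "continuous_on (slice 1) h" by (rule continuous_on_subset[OF cont slice_sub]) simp
    fix s v assume s: "s \<in> insert (shift area) (range gen)" and v: "v \<in> slice 1"
    have vH: "v \<in> CxH" using slice_sub[OF zero_less_one] v by blast
    from s consider "s = shift area" | i where "s = gen i" by blast
    then show "h (s v) = h v"
      by cases (simp_all add: shift_inv[OF vH] \<rho>[OF vH] \<rho>0)
  qed
qed

end

lemma Splus_inoue_nil:
  assumes "Splus_data N p q r \<alpha> a b c"
  shows "inoue_nil N p q r 1 \<alpha> z a b c"
proof -
  have data: "det N = 1" "\<alpha> > 1" "r \<noteq> 0" "a \<noteq> 0" "b \<noteq> 0"
    and Na: "map_matrix real_of_int N *v a = \<alpha> *s a"
    and Nb: "map_matrix real_of_int N *v b = (1 / \<alpha>) *s b"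
    and Nc: "c = c v* transpose (map_matrix real_of_int N) + inoue_e N a b
           + inoue_step a b r *s vector [of_int p, of_int q]"
    using assms by (auto simp: Splus_data_def)
  show ?thesis
  proof
    show "N$1$1 * N$2$2 - N$1$2 * N$2$1 = 1" using data(1) by (simp add: det_2)
    show "of_int (N$i$1) * a$1 + of_int (N$i$2) * a$2 = \<alpha> * a$i" for i
      using arg_cong[OF Na, of "\<lambda>v. v $ i"] by (simp add: matrix_vector_mult_def map_matrix_def sum_2)
    show "of_int (N$i$1) * b$1 + of_int (N$i$2) * b$2 = of_int 1 / \<alpha> * b$i" for i
      using arg_cong[OF Nb, of "\<lambda>v. v $ i"] by (simp add: matrix_vector_mult_def map_matrix_def sum_2)
    show "of_int 1 * c$i = of_int (N$i$1) * c$1 + of_int (N$i$2) * c$2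
      + inoue_e N a b $ i + inoue_step a b r * of_int (if i = 1 then p else q)" for i
    proof -
      have "c $ i = (c v* transpose (map_matrix real_of_int N) + inoue_e N a b
           + inoue_step a b r *s vector [of_int p, of_int q]) $ i"
        using Nc by simp
      moreover have "(vector [of_int p, of_int q] :: real^2) $ i = of_int (if i = 1 then p else q)"
        using exhaust_2[of i] by auto
      ultimately show ?thesis
        by (simp add: vector_matrix_mult_def transpose_def map_matrix_def sum_2)
    qed
  qed (use data in auto)
qed

lemma Sminus_inoue_nil:
  assumes "Sminus_data N p q r \<alpha> a b c"
  shows "inoue_nil N p q r (-1) \<alpha> 0 a b c"
proof -
  have data: "det N = -1" "\<alpha> > 1" "r \<noteq> 0" "a \<noteq> 0" "b \<noteq> 0"
    and Na: "map_matrix real_of_int N *v a = \<alpha> *s a"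
    and Nb: "map_matrix real_of_int N *v b = (- 1 / \<alpha>) *s b"
    and Nc: "- c = c v* transpose (map_matrix real_of_int N) + inoue_e N a b
           + inoue_step a b r *s vector [of_int p, of_int q]"
    using assms by (auto simp: Sminus_data_def)
  show ?thesis
  proof
    show "N$1$1 * N$2$2 - N$1$2 * N$2$1 = -1" using data(1) by (simp add: det_2)
    show "of_int (N$i$1) * a$1 + of_int (N$i$2) * a$2 = \<alpha> * a$i" for i
      using arg_cong[OF Na, of "\<lambda>v. v $ i"] by (simp add: matrix_vector_mult_def map_matrix_def sum_2)
    show "of_int (N$i$1) * b$1 + of_int (N$i$2) * b$2 = of_int (-1) / \<alpha> * b$i" for i
      using arg_cong[OF Nb, of "\<lambda>v. v $ i"] by (simp add: matrix_vector_mult_def map_matrix_def sum_2)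
    show "of_int (-1) * c$i = of_int (N$i$1) * c$1 + of_int (N$i$2) * c$2
      + inoue_e N a b $ i + inoue_step a b r * of_int (if i = 1 then p else q)" for i
    proof -
      have "- c $ i = (c v* transpose (map_matrix real_of_int N) + inoue_e N a b
           + inoue_step a b r *s vector [of_int p, of_int q]) $ i"
        using arg_cong[OF Nc, of "\<lambda>v. v $ i"] by simp
      moreover have "(vector [of_int p, of_int q] :: real^2) $ i = of_int (if i = 1 then p else q)"
        using exhaust_2[of i] by auto
      ultimately show ?thesis
        by (simp add: vector_matrix_mult_def transpose_def map_matrix_def sum_2)
    qed
  qed (use data in auto)
qed

theorem corollary4p13:
  fixes X :: "((complex^2) set, 2) cmanifold"
  assumes "inoue_surface X"
  shows "\<not> (\<exists>g. lck_metric_with_potential TYPE('b) X g)"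
  using assms
proof cases
  case (S0 A \<alpha> \<beta> a b)
  then show ?thesis using no_lck_potential_S0 by blast
next
  case (Splus N p q r \<alpha> a b c z)
  interpret inoue_nil N p q r 1 \<alpha> z a b c
    by (rule Splus_inoue_nil[OF Splus(2)])
  have "Splus_group r z \<alpha> a b c = generated_by CxH gens"
    by (simp add: Splus_group_def nil_generators_def gens_def dil_1 shift_def gen_def [abs_def] tri_def [abs_def])
  then show ?thesis using no_lck_potential Splus(1) by simp
next
  case (Sminus N p q r \<alpha> a b c)
  interpret inoue_nil N p q r "-1" \<alpha> 0 a b c
    by (rule Sminus_inoue_nil[OF Sminus(2)])
  have "Sminus_group r \<alpha> a b c = generated_by CxH gens"
    by (simp add: Sminus_group_def nil_generators_def gens_def dil_1 shift_def gen_def [abs_def] tri_def [abs_def])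
  then show ?thesis using no_lck_potential Sminus(1) by simp
qed

end
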